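(* Neither of the language classes $\mathcal{L}(\mathsf{DRX})$ and $\mathcal{L}(\mathsf{DTMFA^{rej}})$ is closed under any of the following operations: union, concatenation, reversal, complement, homomorphism, and inverse homomorphism. Moreover, $\mathcal{L}(\mathsf{DRX})$ is also not closed under intersection, and not closed under intersection with languages from $\mathcal{L}(\mathsf{DREG})$.
   Context: For a class $\mathcal{C}$ of language descriptions, $\mathcal{L}(\mathcal{C})$ is the class of all languages $\mathcal{L}(C)$ with $C\in\mathcal{C}$. Languages are over finite terminal alphabets. Regex. Let $\Sigma$ be a finite terminal alphabet and $\Xi$ an infinite variable alphabet disjoint from $\Sigma$. The set $\mathsf{RX}$ of regex, with $\mathsf{var}(\alpha)\subset\Xi$ the set of variables occurring in $\alpha$, is defined recursively: every $a\in\Sigma\cup\{\varepsilon\}$ is a regex; $\&x$ (variable reference) for $x\in\Xi$; $(\alpha\cdot\beta)$, $(\alpha\vee\beta)$, $(\alpha^+)$ for $\alpha,\beta\in\mathsf{RX}$; and $\langle x:\alpha\rangle$ (variable binding) for $\alpha\in\mathsf{RX}$ and $x\in\Xi\setminus\mathsf{var}(\alpha)$. Also $\emptyset$ is a regex, but may not occur inside another regex. $\alpha^*$ abbreviates $\varepsilon\vee\alpha^+$; a nonempty set $A\subseteq\Sigma$ abbreviates $\bigvee_{a\in A}a$. Let $\Gamma=\{[_x,]_x\mid x\in\Xi\}$. The ref-language $\mathcal{R}(\alpha)\subseteq(\Sigma\cup\Xi\cup\Gamma)^*$ is given by $\mathcal{R}(\emptyset)=\emptyset$, $\mathcal{R}(a)=\{a\}$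 for $a\in\Sigma\cup\{\varepsilon\}$, $\mathcal{R}(\&x)=\{x\}$, $\mathcal{R}(\langle x:\alpha\rangle)=[_x\mathcal{R}(\alpha)]_x$, $\mathcal{R}(\alpha\cdot\beta)=\mathcal{R}(\alpha)\mathcal{R}(\beta)$, $\mathcal{R}(\alpha\vee\beta)=\mathcal{R}(\alpha)\cup\mathcal{R}(\beta)$, $\mathcal{R}(\alpha^+)=\mathcal{R}(\alpha)^+$. For $r\in\mathcal{R}(\alpha)$, the dereference $\mathcal{D}(r)\in\Sigma^*$ is obtained by replacing each occurrence of a variable $x$ by $v$, where $[_x v]_x$ is the nearest such factor to the left of this occurrence (or by $\varepsilon$ if there is none; variables inside $v$ are replaced likewise), and then deleting all symbols of $\Gamma$. $\mathcal{L}(\alpha)=\{\mathcal{D}(r)\mid r\in\mathcal{R}(\alpha)\}$. Deterministic regex. Let $\alpha_{\mathcal{R}}$ be the regular expression over $\Sigma\cup\Xi\cup\Gamma$ obtained from $\alpha$ by replacing each $\langle x:\beta\rangle$ by $[_x\beta_{\mathcal{R}}]_x$ and each $\&x$ by $x$. The marked regex $\tilde\alpha$ is obtained from $\alpha_{\mathcal{R}}$ by attaching to each occurrence of a symbol $\chi\in\Sigma\cup\Xi\cup\Gamma$ its own unique number $i$, written $\chi_{(i)}$; $\mathcal{R}(\tilde\alpha)$ is the language of marked ref-words it generates. $\tilde A$ denotes the set of marked symbols from $A$. A regex $\alpha$ is not deterministic if there exist $\rho_1,\rho_2\in\mathcal{R}(\tilde\alpha)$, $r,s_1,s_2\in(\tilde\Sigma\cup\tilde\Xi\cup\tilde\Gamma)^*$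 and $\gamma_1,\gamma_2\in\tilde\Gamma^*$ such that one of the following holds: (1) $\rho_1=r\gamma_1a_{(i)}s_1$ and $\rho_2=r\gamma_2a_{(j)}s_2$ with $a\in\Sigma$, $i\ne j$; (2) $\rho_1=r\gamma_1x_{(i)}s_1$ and $\rho_2=r\gamma_2\chi_{(j)}s_2$ with $x\in\Xi$, $\chi\in\Sigma\cup\Xi$, $i\neq j$; (3) $\rho_1=r\gamma_1\chi_{(i)}s_1$ and $\rho_2=r\gamma_2\chi_{(i)}s_2$ with $\chi\in\Sigma\cup\Xi$, $\gamma_1\ne\gamma_2$; (4) $\rho_1=r\gamma_1$ and $\rho_2=r\gamma_2$ with $\gamma_1\neq\gamma_2$. Otherwise $\alpha$ is deterministic. $\mathsf{DRX}$ is the set of deterministic regex and $\mathsf{DREG}$ is the set of $\alpha\in\mathsf{DRX}$ with $\mathsf{var}(\alpha)=\emptyset$. Memory automata with trap-state. A $\mathsf{TMFA}$ with $k$ memories is $M=(Q,\Sigma,\delta,q_0,F)$ with finite state set $Q$ containing a special state $[\mathsf{trap}]$, initial state $q_0\in Q$, final states $F\subseteq Q$, and $\delta: Q\times(\Sigma\cup\{\varepsilon\}\cup\{1,\dots,k\})\to\mathcal{P}(Q\times\{\mathtt{o},\mathtt{c},\mathtt{r},\diamond\}^k)$, where $\delta([\mathsf{trap}],b)=\{([\mathsf{trap}],\diamond,\dots,\diamond)\}$ for $b\in\Sigma$ and $\delta([\mathsf{trap}],b)=\emptyset$ for other $b$. A configuration is $(q,w,(u_1,r_1),\dots,(u_k,r_k))$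 with state $q$, remaining input $w$, memory contents $u_i\in\Sigma^*$ and statuses $r_i\in\{\mathtt{O},\mathtt{C}\}$ (open/closed). The initial configuration on $w$ is $(q_0,w,(\varepsilon,\mathtt{C}),\dots,(\varepsilon,\mathtt{C}))$; a configuration is accepting if $w=\varepsilon$ and $q\in F$. $M$ can move from $(q,vw,(u_i,r_i)_i)$ to $(p,w,(u_i',r_i')_i)$ if there is $(p,s_1,\dots,s_k)\in\delta(q,b)$ with either $b\in\Sigma\cup\{\varepsilon\}$, $v=b$, or $b\in\{1,\dots,k\}$, $s_b=\mathtt{c}$, $v=u_b$ (memory recall), and for every $i$: $s_i=\diamond$, $r_i=\mathtt{O}$ give $(u_iv,\mathtt{O})$; $s_i=\diamond$, $r_i=\mathtt{C}$ give $(u_i,\mathtt{C})$; $s_i=\mathtt{o}$ gives $(v,\mathtt{O})$; $s_i=\mathtt{c}$ gives $(u_i,\mathtt{C})$; $s_i=\mathtt{r}$ gives $(\varepsilon,\mathtt{C})$. Furthermore (memory recall failure), $M$ can move from $(q,vw,(u_i,r_i)_i)$ to $([\mathsf{trap}],w,(u_i,r_i)_i)$ if there is $(p,s_1,\dots,s_k)\in\delta(q,b)$ with $b\in\{1,\dots,k\}$, $s_b=\mathtt{c}$, $u_b=vv'$, $v'\ne\varepsilon$, and $w=\varepsilon$ or the first letters of $v'$ and $w$ differ. $\mathcal{L}(M)$ is the set of $w\in\Sigma^*$ for which an accepting configuration is reachable from the initial configuration on $w$. A $\mathsf{TMFA}$ is deterministic (a $\mathsf{DTMFA}$) if $|\delta(q,b)|\le1$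 for all $q,b$, and whenever $\delta(q,x)\neq\emptyset$ for some $x\in\{1,\dots,k\}\cup\{\varepsilon\}$, then $\delta(q,y)=\emptyset$ for all $y\ne x$. $\mathsf{DTMFA^{rej}}$ denotes the $\mathsf{DTMFA}$ with $[\mathsf{trap}]\notin F$. *)

theory Defs
  imports Main
begin

section \<open>Ordinary regular expressions and marking\<close>

definition conc :: "'s list set \<Rightarrow> 's list set \<Rightarrow> 's list set" where
  "conc A B = {u @ v | u v. u \<in> A \<and> v \<in> B}"

definition lplus :: "'s list set \<Rightarrow> 's list set" where
  "lplus A = {concat ws | ws. ws \<noteq> [] \<and> set ws \<subseteq> A}"

datatype 's re = Zero | One | Atom 's | Times "'s re" "'s re" | Or "'s re" "'s re" | Iter "'s re"

primrec re_lang :: "'s re \<Rightarrow> 's list set" where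
  "re_lang Zero = {}"
| "re_lang One = {[]}"
| "re_lang (Atom c) = {[c]}"
| "re_lang (Times e f) = conc (re_lang e) (re_lang f)"
| "re_lang (Or e f) = re_lang e \<union> re_lang f"
| "re_lang (Iter e) = lplus (re_lang e)"

primrec occs :: "'s re \<Rightarrow> nat" where
  "occs Zero = 0"
| "occs One = 0"
| "occs (Atom c) = 1"
| "occs (Times e f) = occs e + occs f"
| "occs (Or e f) = occs e + occs f"
| "occs (Iter e) = occs e"

text \<open>The occurrences of symbols are numbered \<open>n, n + 1, \<dots>\<close> from left to right;
  the marked symbol \<open>c\<^sub>(\<^sub>i\<^sub>)\<close> is the pair \<open>(c, i)\<close>.\<close>

primrec mark :: "nat \<Rightarrow> 's re \<Rightarrow> ('s \<times> nat) re" where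
  "mark n Zero = Zero"
| "mark n One = One"
| "mark n (Atom c) = Atom (c, n)"
| "mark n (Times e f) = Times (mark n e) (mark (n + occs e) f)"
| "mark n (Or e f) = Or (mark n e) (mark (n + occs e) f)"
| "mark n (Iter e) = Iter (mark n e)"

section \<open>Regex with variables\<close>

text \<open>Terminals have type \<open>'a\<close>; the variable alphabet is \<open>nat\<close>.\<close>

datatype 'a rx =
    REmpty
  | REps
  | RLet 'a
  | RRef nat
  | RCat "'a rx" "'a rx"
  | RAlt "'a rx" "'a rx"
  | RPlus "'a rx"
  | RBind nat "'a rx"

primrec vars :: "'a rx \<Rightarrow> nat set" where
  "vars REmpty = {}"
| "vars REps = {}"
| "vars (RLet a) = {}"
| "vars (RRef x) = {x}"
| "vars (RCat \<alpha> \<beta>) = vars \<alpha> \<union> vars \<beta>"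
| "vars (RAlt \<alpha> \<beta>) = vars \<alpha> \<union> vars \<beta>"
| "vars (RPlus \<alpha>) = vars \<alpha>"
| "vars (RBind x \<alpha>) = insert x (vars \<alpha>)"

inductive_set RX_nonempty :: "'a set \<Rightarrow> 'a rx set" for \<Sigma> :: "'a set" where
  "REps \<in> RX_nonempty \<Sigma>"
| "a \<in> \<Sigma> \<Longrightarrow> RLet a \<in> RX_nonempty \<Sigma>"
| "RRef x \<in> RX_nonempty \<Sigma>"
| "\<alpha> \<in> RX_nonempty \<Sigma> \<Longrightarrow> \<beta> \<in> RX_nonempty \<Sigma> \<Longrightarrow> RCat \<alpha> \<beta> \<in> RX_nonempty \<Sigma>"
| "\<alpha> \<in> RX_nonempty \<Sigma> \<Longrightarrow> \<beta> \<in> RX_nonempty \<Sigma> \<Longrightarrow> RAlt \<alpha> \<beta> \<in> RX_nonempty \<Sigma>"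
| "\<alpha> \<in> RX_nonempty \<Sigma> \<Longrightarrow> RPlus \<alpha> \<in> RX_nonempty \<Sigma>"
| "\<alpha> \<in> RX_nonempty \<Sigma> \<Longrightarrow> x \<notin> vars \<alpha> \<Longrightarrow> RBind x \<alpha> \<in> RX_nonempty \<Sigma>"

definition RX :: "'a set \<Rightarrow> 'a rx set" where
  "RX \<Sigma> = insert REmpty (RX_nonempty \<Sigma>)"

text \<open>The symbols of ref-words: \<open>Opn x\<close> and \<open>Cls x\<close> are the brackets
  \<open>[\<^sub>x\<close> and \<open>]\<^sub>x\<close> that form \<open>\<Gamma>\<close>.\<close>

datatype 'a sym = Ter 'a | Var nat | Opn nat | Cls nat

primrec ref_lang :: "'a rx \<Rightarrow> 'a sym list set" where
  "ref_lang REmpty = {}"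
| "ref_lang REps = {[]}"
| "ref_lang (RLet a) = {[Ter a]}"
| "ref_lang (RRef x) = {[Var x]}"
| "ref_lang (RCat \<alpha> \<beta>) = conc (ref_lang \<alpha>) (ref_lang \<beta>)"
| "ref_lang (RAlt \<alpha> \<beta>) = ref_lang \<alpha> \<union> ref_lang \<beta>"
| "ref_lang (RPlus \<alpha>) = lplus (ref_lang \<alpha>)"
| "ref_lang (RBind x \<alpha>) = {[Opn x] @ r @ [Cls x] | r. r \<in> ref_lang \<alpha>}"

primrec terminals :: "'a sym list \<Rightarrow> 'a list" where
  "terminals [] = []"
| "terminals (c # r) = (case c of Ter a \<Rightarrow> a # terminals r | _ \<Rightarrow> terminals r)"

text \<open>\<open>last_factor x p v\<close>: the last factor of \<open>p\<close> of the form \<open>[\<^sub>x v ]\<^sub>x\<close> has content \<open>v\<close>.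
  A binding of \<open>x\<close> never contains another binding of \<open>x\<close>, so \<open>v\<close> may be required to be free
  of both brackets; it can contain brackets of other variables.\<close>

definition last_factor :: "nat \<Rightarrow> 'a sym list \<Rightarrow> 'a sym list \<Rightarrow> bool" where
  "last_factor x p v \<longleftrightarrow>
     (\<exists>u w. p = u @ [Opn x] @ v @ [Cls x] @ w
        \<and> Opn x \<notin> set v \<and> Cls x \<notin> set v \<and> Cls x \<notin> set w)"

lemma last_factor_unique:
  assumes "last_factor x p v" "last_factor x p v'"
  shows "v = v'"
proof -
  have aux: "w = w' \<and> a = a'"
    if "a @ c # w = a' @ c # w'" "c \<notin> set w" "c \<notin> set w'" for c :: "'a sym" and a a' w w'
    using that
  proof (induction w arbitrary: w' rule: rev_induct)
    case Nil
    then show ?case by (cases w' rule: rev_cases) auto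
  next
    case (snoc b w)
    then show ?case by (cases w' rule: rev_cases) auto
  qed
  obtain u w where 1: "p = (u @ Opn x # v) @ Cls x # w" "Opn x \<notin> set v" "Cls x \<notin> set w"
    using assms(1) unfolding last_factor_def by auto
  obtain u' w' where 2: "p = (u' @ Opn x # v') @ Cls x # w'" "Opn x \<notin> set v'" "Cls x \<notin> set w'"
    using assms(2) unfolding last_factor_def by auto
  have "u @ Opn x # v = u' @ Opn x # v'"
    using aux[of "u @ Opn x # v" "Cls x" w "u' @ Opn x # v'" w'] 1 2 by simp
  then show ?thesis
    using aux[of u "Opn x" v u' v'] 1 2 by simp
qed

definition var_value :: "nat \<Rightarrow> 'a sym list \<Rightarrow> 'a list" where
  "var_value x p = (if \<exists>v. last_factor x p v then terminals (THE v. last_factor x p v) else [])"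

text \<open>Variables are replaced from left to right: \<open>p\<close> is the part of the ref-word in which this
  has been done, so that the values substituted are themselves free of variables.  Brackets
  are not copied together with a value, so the nearest factor always refers to a bracket pair
  of the given ref-word.\<close>

fun replace_vars :: "'a sym list \<Rightarrow> 'a sym list \<Rightarrow> 'a sym list" where
  "replace_vars p [] = p"
| "replace_vars p (Var x # r) = replace_vars (p @ map Ter (var_value x p)) r"
| "replace_vars p (c # r) = replace_vars (p @ [c]) r"

definition deref :: "'a sym list \<Rightarrow> 'a list" where
  "deref r = terminals (replace_vars [] r)"

definition rx_lang :: "'a rx \<Rightarrow> 'a list set" where
  "rx_lang \<alpha> = deref ` ref_lang \<alpha>"

section \<open>Deterministic regex\<close>

primrec rx_re :: "'a rx \<Rightarrow> 'a sym re" where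
  "rx_re REmpty = Zero"
| "rx_re REps = One"
| "rx_re (RLet a) = Atom (Ter a)"
| "rx_re (RRef x) = Atom (Var x)"
| "rx_re (RCat \<alpha> \<beta>) = Times (rx_re \<alpha>) (rx_re \<beta>)"
| "rx_re (RAlt \<alpha> \<beta>) = Or (rx_re \<alpha>) (rx_re \<beta>)"
| "rx_re (RPlus \<alpha>) = Iter (rx_re \<alpha>)"
| "rx_re (RBind x \<alpha>) = Times (Atom (Opn x)) (Times (rx_re \<alpha>) (Atom (Cls x)))"

lemma re_lang_rx_re: "re_lang (rx_re \<alpha>) = ref_lang \<alpha>"
  by (induction \<alpha>) (auto simp: conc_def)

definition marked_lang :: "'a rx \<Rightarrow> ('a sym \<times> nat) list set" where
  "marked_lang \<alpha> = re_lang (mark 0 (rx_re \<alpha>))"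

definition Gam :: "'a sym set" where
  "Gam = range Opn \<union> range Cls"

definition mGam_words :: "('a sym \<times> nat) list set" where
  "mGam_words = lists (Gam \<times> UNIV)"

definition nondeterministic :: "'a rx \<Rightarrow> bool" where
  "nondeterministic \<alpha> \<longleftrightarrow>
    (\<exists>\<rho>1 \<in> marked_lang \<alpha>. \<exists>\<rho>2 \<in> marked_lang \<alpha>. \<exists>r s1 s2.
     \<exists>\<gamma>1 \<in> mGam_words. \<exists>\<gamma>2 \<in> mGam_words.
       (\<exists>a i j. i \<noteq> j \<and> \<rho>1 = r @ \<gamma>1 @ [(Ter a, i)] @ s1 \<and> \<rho>2 = r @ \<gamma>2 @ [(Ter a, j)] @ s2)
     \<or> (\<exists>x \<chi> i j. \<chi> \<in> range Ter \<union> range Var \<and> i \<noteq> j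
          \<and> \<rho>1 = r @ \<gamma>1 @ [(Var x, i)] @ s1 \<and> \<rho>2 = r @ \<gamma>2 @ [(\<chi>, j)] @ s2)
     \<or> (\<exists>\<chi> i. \<chi> \<in> range Ter \<union> range Var \<and> \<gamma>1 \<noteq> \<gamma>2
          \<and> \<rho>1 = r @ \<gamma>1 @ [(\<chi>, i)] @ s1 \<and> \<rho>2 = r @ \<gamma>2 @ [(\<chi>, i)] @ s2)
     \<or> (\<gamma>1 \<noteq> \<gamma>2 \<and> \<rho>1 = r @ \<gamma>1 \<and> \<rho>2 = r @ \<gamma>2))"

definition DRX :: "'a set \<Rightarrow> 'a rx set" where
  "DRX \<Sigma> = {\<alpha> \<in> RX \<Sigma>. \<not> nondeterministic \<alpha>}"

definition DREG :: "'a set \<Rightarrow> 'a rx set" where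
  "DREG \<Sigma> = {\<alpha> \<in> DRX \<Sigma>. vars \<alpha> = {}}"

section \<open>Memory automata with trap state\<close>

text \<open>The \<open>k\<close> memories are numbered \<open>0, \<dots>, k - 1\<close>.\<close>

datatype 'a label = Letter 'a | Eps | Mem nat

datatype instr = IOpen | IClose | IReset | IKeep

datatype status = Opened | Closed

record 'a tmfa =
  states :: "nat set"
  alphabet :: "'a set"
  mems :: nat
  delta :: "nat \<Rightarrow> 'a label \<Rightarrow> (nat \<times> instr list) set"
  start :: nat
  finals :: "nat set"
  trap :: nat

definition labels :: "'a tmfa \<Rightarrow> 'a label set" where
  "labels M = Letter ` alphabet M \<union> {Eps} \<union> Mem ` {..<mems M}"

text \<open>The transition function is extended by \<open>{}\<close> outside its domain.\<close>

definition TMFA :: "'a tmfa set" where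
  "TMFA = {M. finite (states M) \<and> finite (alphabet M) \<and> trap M \<in> states M
     \<and> start M \<in> states M \<and> finals M \<subseteq> states M
     \<and> (\<forall>q \<in> states M. \<forall>b \<in> labels M.
          delta M q b \<subseteq> states M \<times> {s. length s = mems M})
     \<and> (\<forall>q b. q \<notin> states M \<or> b \<notin> labels M \<longrightarrow> delta M q b = {})
     \<and> (\<forall>a \<in> alphabet M. delta M (trap M) (Letter a) = {(trap M, replicate (mems M) IKeep)})
     \<and> (\<forall>b. b \<notin> Letter ` alphabet M \<longrightarrow> delta M (trap M) b = {})}"

fun upd :: "'a list \<Rightarrow> instr \<Rightarrow> 'a list \<times> status \<Rightarrow> 'a list \<times> status" where
  "upd v IKeep (u, Opened) = (u @ v, Opened)"
| "upd v IKeep (u, Closed) = (u, Closed)"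
| "upd v IOpen (u, r) = (v, Opened)"
| "upd v IClose (u, r) = (u, Closed)"
| "upd v IReset (u, r) = ([], Closed)"

type_synonym 'a config = "nat \<times> 'a list \<times> ('a list \<times> status) list"

inductive move :: "'a tmfa \<Rightarrow> 'a config \<Rightarrow> 'a config \<Rightarrow> bool" for M :: "'a tmfa" where
  letter: "(p, s) \<in> delta M q (Letter a) \<Longrightarrow>
     move M (q, [a] @ w, m) (p, w, map2 (upd [a]) s m)"
| eps: "(p, s) \<in> delta M q Eps \<Longrightarrow>
     move M (q, w, m) (p, w, map2 (upd []) s m)"
| recall: "(p, s) \<in> delta M q (Mem i) \<Longrightarrow> s ! i = IClose \<Longrightarrow> v = fst (m ! i) \<Longrightarrow>
     move M (q, v @ w, m) (p, w, map2 (upd v) s m)"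
| failure: "(p, s) \<in> delta M q (Mem i) \<Longrightarrow> s ! i = IClose \<Longrightarrow> fst (m ! i) = v @ v' \<Longrightarrow>
     v' \<noteq> [] \<Longrightarrow> w = [] \<or> hd v' \<noteq> hd w \<Longrightarrow>
     move M (q, v @ w, m) (trap M, w, m)"

definition tmfa_lang :: "'a tmfa \<Rightarrow> 'a list set" where
  "tmfa_lang M = {w \<in> lists (alphabet M). \<exists>q m. q \<in> finals M \<and>
     (move M)\<^sup>*\<^sup>* (start M, w, replicate (mems M) ([], Closed)) (q, [], m)}"

definition DTMFA :: "'a tmfa set" where
  "DTMFA = {M \<in> TMFA. (\<forall>q b. card (delta M q b) \<le> 1)
     \<and> (\<forall>q x y. x \<in> {Eps} \<union> Mem ` {..<mems M} \<and> delta M q x \<noteq> {} \<and> y \<noteq> x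
          \<longrightarrow> delta M q y = {})}"

lemma TMFA_finite_delta:
  assumes "M \<in> TMFA"
  shows "finite (delta M q b)"
proof (cases "q \<in> states M \<and> b \<in> labels M")
  case True
  have "x \<in> {IOpen, IClose, IReset, IKeep}" for x :: instr
    by (cases x) simp_all
  then have "finite (UNIV :: instr set)"
    by (intro finite_subset[of UNIV "{IOpen, IClose, IReset, IKeep}"] subsetI) simp_all
  then have fin: "finite {s :: instr list. length s = mems M}"
    using finite_lists_length_eq[of "UNIV :: instr set" "mems M"] by simp
  have "finite (states M)" and "delta M q b \<subseteq> states M \<times> {s. length s = mems M}"
    using assms True by (simp_all add: TMFA_def)
  then show ?thesis
    using finite_subset[OF _ finite_cartesian_product[OF _ fin]] by blast
next
  case False
  then have "delta M q b = {}"
    using assms by (simp add: TMFA_def)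
  then show ?thesis by simp
qed

definition DTMFA_rej :: "'a tmfa set" where
  "DTMFA_rej = {M \<in> DTMFA. trap M \<notin> finals M}"

section \<open>Language classes and closure properties\<close>

text \<open>Terminal alphabets are finite subsets of \<open>nat\<close>, i.e. arbitrary finite alphabets up to
  renaming of letters.\<close>

definition L_DRX :: "nat list set set" where
  "L_DRX = {rx_lang \<alpha> | \<alpha> \<Sigma>. finite \<Sigma> \<and> \<alpha> \<in> DRX \<Sigma>}"

definition L_DREG :: "nat list set set" where
  "L_DREG = {rx_lang \<alpha> | \<alpha> \<Sigma>. finite \<Sigma> \<and> \<alpha> \<in> DREG \<Sigma>}"

definition L_DTMFA_rej :: "nat list set set" where
  "L_DTMFA_rej = tmfa_lang ` DTMFA_rej"

definition closed_union :: "'a list set set \<Rightarrow> bool" where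
  "closed_union \<C> \<longleftrightarrow> (\<forall>L1 \<in> \<C>. \<forall>L2 \<in> \<C>. L1 \<union> L2 \<in> \<C>)"

definition closed_concatenation :: "'a list set set \<Rightarrow> bool" where
  "closed_concatenation \<C> \<longleftrightarrow> (\<forall>L1 \<in> \<C>. \<forall>L2 \<in> \<C>. conc L1 L2 \<in> \<C>)"

definition closed_reversal :: "'a list set set \<Rightarrow> bool" where
  "closed_reversal \<C> \<longleftrightarrow> (\<forall>L \<in> \<C>. rev ` L \<in> \<C>)"

definition closed_complement :: "'a list set set \<Rightarrow> bool" where
  "closed_complement \<C> \<longleftrightarrow>
     (\<forall>\<Sigma>. \<forall>L \<in> \<C>. finite \<Sigma> \<and> L \<subseteq> lists \<Sigma> \<longrightarrow> lists \<Sigma> - L \<in> \<C>)"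

text \<open>The homomorphism \<open>\<Sigma>\<^sup>* \<rightarrow> \<Delta>\<^sup>*\<close> extending \<open>h\<close>; images of letters may be empty.\<close>

definition hom_ext :: "('a \<Rightarrow> 'b list) \<Rightarrow> 'a list \<Rightarrow> 'b list" where
  "hom_ext h w = concat (map h w)"

definition closed_homomorphism :: "'a list set set \<Rightarrow> bool" where
  "closed_homomorphism \<C> \<longleftrightarrow>
     (\<forall>\<Sigma> \<Delta> h. \<forall>L \<in> \<C>. finite \<Sigma> \<and> finite \<Delta> \<and> h ` \<Sigma> \<subseteq> lists \<Delta> \<and> L \<subseteq> lists \<Sigma>
        \<longrightarrow> hom_ext h ` L \<in> \<C>)"

definition closed_inverse_homomorphism :: "'a list set set \<Rightarrow> bool" where
  "closed_inverse_homomorphism \<C> \<longleftrightarrow>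
     (\<forall>\<Sigma> \<Delta> h. \<forall>L \<in> \<C>. finite \<Sigma> \<and> finite \<Delta> \<and> h ` \<Sigma> \<subseteq> lists \<Delta> \<and> L \<subseteq> lists \<Delta>
        \<longrightarrow> {w \<in> lists \<Sigma>. hom_ext h w \<in> L} \<in> \<C>)"

definition closed_intersection_with :: "'a list set set \<Rightarrow> 'a list set set \<Rightarrow> bool" where
  "closed_intersection_with \<C> \<D> \<longleftrightarrow> (\<forall>L1 \<in> \<C>. \<forall>L2 \<in> \<D>. L1 \<inter> L2 \<in> \<C>)"

definition closed_intersection :: "'a list set set \<Rightarrow> bool" where
  "closed_intersection \<C> \<longleftrightarrow> closed_intersection_with \<C> \<C>"

end

theory Submission
  imports Defs
begin

text \<open>Every deterministic regex is turned into a deterministic memory automaton that rejects in the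
  trap state: its states are the marked symbols, and determinism makes the brackets between two
  consecutive visible symbols unique, so that they become memory instructions.  It therefore
  suffices to take languages of deterministic regex, apply an operation, and show that the result
  is not the language of such an automaton.

  For this, suppose that no position in a word of the language forces a factor of length at least
  two.  Then an accepting run never recalls a longer memory, since a deterministic automaton about
  to recall \<open>v\<close> rejects every nonempty continuation that does not start with \<open>v\<close>.
  So only the first two letters of each memory matter and the language is regular.  The closure
  operations lead from \<open>a\<^sup>n b a\<^sup>n\<close> and variants to such languages that are not regular, for
  instance \<open>a\<^sup>m b a\<^sup>n\<close> with \<open>n \<le> m\<close>.

  For intersections the witness is regular: words that alternate between letters from
  \<open>{0, 1}\<close> and \<open>{2, 3}\<close>.  Every proper prefix has two continuations, so a
  deterministic regex for it recalls only empty words.  As the language is infinite, the regex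
  iterates some subexpression; as it is prefix-closed, an iteration may end right after its first
  letter and start again, which yields a forbidden factor \<open>aa\<close>.\<close>

section \<open>Linear expressions\<close>

text \<open>The results of the operations must offer a second way on at every position, and this
  dictates the witnesses. \<open>no_jump\<close> speaks of two letters and not of one because of
  \<open>0^m 1 0^n\<close> with \<open>n \<le> m\<close>: after \<open>0^m 1 0^j\<close> only 0 can
  follow, so recalling one letter is compatible with the language; but the word may stop after this
  0, which recalling two zeros would prevent.

  For intersections this route is barred, since a regular witness is accepted by a finite automaton
  without memories. There the position structure of the expression itself is used: once symbols are
  marked, each labels a single atom, so what may follow a symbol depends on that symbol only, and a
  symbol read twice lies under an iteration. The same structure supplies the states of the automaton
  in the first route.

  Dereferencing searches backwards through a ref-word, an automaton works forwards with memories;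
  both arguments therefore pass to a forward evaluation, \<open>emitted\<close>.\<close>

definition lstar :: "'s list set \<Rightarrow> 's list set" where
  "lstar A = {concat ws | ws. set ws \<subseteq> A}"

lemma lstar_Nil [simp]: "[] \<in> lstar A"
  unfolding lstar_def by (auto intro: exI[of _ "[]"])

lemma lstar_append:
  assumes "u \<in> lstar A" "v \<in> lstar A"
  shows "u @ v \<in> lstar A"
proof -
  obtain us vs where "u = concat us" "set us \<subseteq> A" "v = concat vs" "set vs \<subseteq> A"
    using assms unfolding lstar_def by blast
  then have "u @ v = concat (us @ vs)" "set (us @ vs) \<subseteq> A" by auto
  then show ?thesis unfolding lstar_def by blast
qed

lemma lstar_single: "u \<in> A \<Longrightarrow> u \<in> lstar A"
  unfolding lstar_def by (auto intro: exI[of _ "[u]"])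

lemma lplus_lstar: "u \<in> lplus A \<Longrightarrow> u \<in> lstar A"
  unfolding lstar_def lplus_def by blast

lemma lplusI:
  assumes "u \<in> lstar A" "w \<in> A" "v \<in> lstar A"
  shows "u @ w @ v \<in> lplus A"
proof -
  obtain us vs where "u = concat us" "set us \<subseteq> A" "v = concat vs" "set vs \<subseteq> A"
    using assms unfolding lstar_def by blast
  then have "u @ w @ v = concat (us @ w # vs)" "set (us @ w # vs) \<subseteq> A" "us @ w # vs \<noteq> []"
    using assms by auto
  then show ?thesis unfolding lplus_def by blast
qed

lemma concI: "u \<in> A \<Longrightarrow> v \<in> B \<Longrightarrow> u @ v \<in> conc A B"
  by (auto simp: conc_def)

lemma conc_split:
  assumes "r @ c # s \<in> conc A B"
  obtains (left) s1 s2 where "s = s1 @ s2" "r @ c # s1 \<in> A" "s2 \<in> B"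
  | (right) r1 r2 where "r = r1 @ r2" "r1 \<in> A" "r2 @ c # s \<in> B"
proof -
  obtain u v where uv: "r @ c # s = u @ v" "u \<in> A" "v \<in> B"
    using assms by (auto simp: conc_def)
  then consider us where "u = r @ c # us" "s = us @ v" | us where "r = u @ us" "v = us @ c # s"
    by (auto simp: append_eq_append_conv2 Cons_eq_append_conv)
  then show thesis
    by cases (use uv left right in blast)+
qed

lemma lplus_split:
  assumes "r @ c # s \<in> lplus A"
  obtains r1 r2 s1 s2 where "r = r1 @ r2" "s = s1 @ s2"
    "r1 \<in> lstar A" "r2 @ c # s1 \<in> A" "s2 \<in> lstar A"
proof -
  have "\<exists>r1 r2 s1 s2. r = r1 @ r2 \<and> s = s1 @ s2 \<and> r1 \<in> lstar A \<and> r2 @ c # s1 \<in> A \<and> s2 \<in> lstar A"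
    if "r @ c # s = concat ws" "set ws \<subseteq> A" for ws
    using that
  proof (induction ws arbitrary: r)
    case Nil
    then show ?case by simp
  next
    case (Cons w ws)
    have "concat ws \<in> lstar A" using Cons.prems unfolding lstar_def by auto
    have "r @ c # s \<in> conc {w} {concat ws}"
      using Cons.prems by (auto simp: conc_def)
    then show ?case
    proof (cases rule: conc_split)
      case (left s1 s2)
      then have "w = r @ c # s1" "s2 = concat ws" by simp_all
      then show ?thesis using left Cons.prems \<open>concat ws \<in> lstar A\<close>
        by (intro exI[of _ "[]"] exI[of _ r] exI[of _ s1] exI[of _ s2]) simp
    next
      case (right r1 r2)
      then obtain r1' r2' s1 s2 where "r2 = r1' @ r2'" "s = s1 @ s2" "r1' \<in> lstar A"
          "r2' @ c # s1 \<in> A" "s2 \<in> lstar A"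
        using Cons.IH[of r2] Cons.prems(2) by auto
      moreover have "w @ r1' \<in> lstar A"
        using Cons.prems(2) \<open>r1' \<in> lstar A\<close> by (simp add: lstar_append lstar_single)
      ultimately show ?thesis using right
        by (intro exI[of _ "w @ r1'"] exI[of _ r2'] exI[of _ s1] exI[of _ s2]) simp
    qed
  qed
  then show thesis using assms that unfolding lplus_def by blast
qed

lemma lplus_set: "w \<in> lplus A \<Longrightarrow> x \<in> set w \<Longrightarrow> \<exists>u\<in>A. x \<in> set u"
  unfolding lplus_def by fastforce

lemma mark_index:
  "w \<in> re_lang (mark n e) \<Longrightarrow> c \<in> set w \<Longrightarrow> n \<le> snd c \<and> snd c < n + occs e"
proof (induction e arbitrary: n w)
  case (Times e1 e2)
  obtain u v where "w = u @ v" "u \<in> re_lang (mark n e1)" "v \<in> re_lang (mark (n + occs e1) e2)"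
    using Times.prems by (auto simp: conc_def)
  then show ?case
    using Times.prems Times.IH(1)[of u n] Times.IH(2)[of v "n + occs e1"] by auto
next
  case (Or e1 e2)
  then show ?case using Or.IH(1)[of w n] Or.IH(2)[of w "n + occs e1"] by fastforce
next
  case (Iter e)
  then show ?case using lplus_set[of w "re_lang (mark n e)" c] by auto
qed auto

text \<open>By \<open>mark_index\<close> the numbers used by two operands lie in disjoint intervals,
  so a number picks out one operand and, recursively, one atom.\<close>

lemma mark_index_unique:
  "w \<in> re_lang (mark n e) \<Longrightarrow> c \<in> set w \<Longrightarrow> w' \<in> re_lang (mark n e) \<Longrightarrow> c' \<in> set w' \<Longrightarrow>
   snd c = snd c' \<Longrightarrow> c = c'"
proof (induction e arbitrary: n w w')
  case (Times e1 e2)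
  obtain u1 v1 u2 v2 where uv:
    "w = u1 @ v1" "u1 \<in> re_lang (mark n e1)" "v1 \<in> re_lang (mark (n + occs e1) e2)"
    "w' = u2 @ v2" "u2 \<in> re_lang (mark n e1)" "v2 \<in> re_lang (mark (n + occs e1) e2)"
    using Times.prems by (auto simp: conc_def)
  then consider "c \<in> set u1" "c' \<in> set u2" | "c \<in> set v1" "c' \<in> set v2"
    | "c \<in> set u1" "c' \<in> set v2" | "c \<in> set v1" "c' \<in> set u2"
    using Times.prems(2,4) by auto
  then show ?case
  proof cases
    case 1
    then show ?thesis using Times.IH(1) uv Times.prems(5) by blast
  next
    case 2
    then show ?thesis using Times.IH(2) uv Times.prems(5) by blast
  next
    case 3
    then show ?thesis using mark_index[OF uv(2) 3(1)] mark_index[OF uv(6) 3(2)] Times.prems(5) by simp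
  next
    case 4
    then show ?thesis using mark_index[OF uv(3) 4(1)] mark_index[OF uv(5) 4(2)] Times.prems(5) by simp
  qed
next
  case (Or e1 e2)
  let ?A = "re_lang (mark n e1)" and ?B = "re_lang (mark (n + occs e1) e2)"
  consider "w \<in> ?A" "w' \<in> ?A" | "w \<in> ?B" "w' \<in> ?B"
    | "w \<in> ?A" "w' \<in> ?B" | "w \<in> ?B" "w' \<in> ?A"
    using Or.prems(1,3) by auto
  then show ?case
  proof cases
    case 1
    then show ?thesis using Or.IH(1) Or.prems by blast
  next
    case 2
    then show ?thesis using Or.IH(2) Or.prems by blast
  next
    case 3
    then show ?thesis using mark_index[OF 3(1) Or.prems(2)] mark_index[OF 3(2) Or.prems(4)] Or.prems(5) by simp
  next
    case 4
    then show ?thesis using mark_index[OF 4(1) Or.prems(2)] mark_index[OF 4(2) Or.prems(4)] Or.prems(5) by simp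
  qed
next
  case (Iter e)
  then have "w \<in> lplus (re_lang (mark n e))" "w' \<in> lplus (re_lang (mark n e))" by simp_all
  from lplus_set[OF this(1) Iter.prems(2)] lplus_set[OF this(2) Iter.prems(4)]
  show ?case using Iter.IH Iter.prems(5) by blast
qed auto

text \<open>The language is local, as in the Glushkov construction: \<open>c\<close> labels exactly
  one atom. In a product or union it therefore decides the operand; in an iteration the round
  containing it is completed from the second word, whose later rounds are then appended.\<close>

lemma mark_local:
  "r @ c # s \<in> re_lang (mark n e) \<Longrightarrow> r' @ c # s' \<in> re_lang (mark n e) \<Longrightarrow>
   r @ c # s' \<in> re_lang (mark n e)"
proof (induction e arbitrary: n r s r' s')
  case (Atom a)
  then show ?case by (simp add: append_eq_Cons_conv)
next
  case (Times e1 e2)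
  let ?A = "re_lang (mark n e1)" and ?B = "re_lang (mark (n + occs e1) e2)"
  have disj: False if "u \<in> ?A" "v \<in> ?B" "c \<in> set u" "c \<in> set v" for u v
    using mark_index[OF that(1,3)] mark_index[OF that(2,4)] by simp
  from Times.prems(1) have "r @ c # s \<in> conc ?A ?B" by simp
  then show ?case
  proof (cases rule: conc_split)
    case (left s1 s2)
    note 1 = left
    from Times.prems(2) have "r' @ c # s' \<in> conc ?A ?B" by simp
    then show ?thesis
    proof (cases rule: conc_split)
      case (left s1' s2')
      then have "r @ c # s1' \<in> ?A" using 1 Times.IH(1) by blast
      from concI[OF this left(3)] show ?thesis using left(1) by simp
    next
      case (right r1 r2)
      then show ?thesis using 1 disj[OF 1(2) right(3)] by simp
    qed
  next
    case (right r1 r2)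
    note 1 = right
    from Times.prems(2) have "r' @ c # s' \<in> conc ?A ?B" by simp
    then show ?thesis
    proof (cases rule: conc_split)
      case (left s1' s2')
      then show ?thesis using 1 disj[OF left(2) 1(3)] by simp
    next
      case (right r1' r2')
      then have "r2 @ c # s' \<in> ?B" using 1 Times.IH(2) by blast
      from concI[OF 1(2) this] show ?thesis using 1(1) by simp
    qed
  qed
next
  case (Or e1 e2)
  let ?A = "re_lang (mark n e1)" and ?B = "re_lang (mark (n + occs e1) e2)"
  have disj: False if "u \<in> ?A" "v \<in> ?B" "c \<in> set u" "c \<in> set v" for u v
    using mark_index[OF that(1,3)] mark_index[OF that(2,4)] by simp
  have "\<not> (r @ c # s \<in> ?A \<and> r' @ c # s' \<in> ?B)" "\<not> (r @ c # s \<in> ?B \<and> r' @ c # s' \<in> ?A)"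
    using disj[of "r @ c # s" "r' @ c # s'"] disj[of "r' @ c # s'" "r @ c # s"] by auto
  moreover have "r @ c # s \<in> ?A \<union> ?B" "r' @ c # s' \<in> ?A \<union> ?B" using Or.prems by simp_all
  ultimately have "r @ c # s' \<in> ?A \<union> ?B" using Or.IH by blast
  then show ?case by simp
next
  case (Iter e)
  let ?A = "re_lang (mark n e)"
  from Iter.prems(1) have "r @ c # s \<in> lplus ?A" by simp
  then obtain r1 r2 s1 s2 where 1: "r = r1 @ r2" "s = s1 @ s2" "r1 \<in> lstar ?A"
      "r2 @ c # s1 \<in> ?A" "s2 \<in> lstar ?A"
    by (rule lplus_split)
  from Iter.prems(2) have "r' @ c # s' \<in> lplus ?A" by simp
  then obtain r1' r2' s1' s2' where 2: "r' = r1' @ r2'" "s' = s1' @ s2'" "r1' \<in> lstar ?A"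
      "r2' @ c # s1' \<in> ?A" "s2' \<in> lstar ?A"
    by (rule lplus_split)
  note * = 1 2
  then have "r2 @ c # s1' \<in> ?A" using Iter.IH by blast
  then have "r1 @ (r2 @ c # s1') @ s2' \<in> lplus ?A" using * lplusI by blast
  then show ?case using * by simp
qed auto

text \<open>A nonempty prefix \<open>c\<close> of the iteration \<open>v\<close> that starts after \<open>u\<close>, completed to an iteration
  in any way, may be run through twice.\<close>

definition repeatable :: "'s list set \<Rightarrow> 's list \<Rightarrow> 's list \<Rightarrow> bool" where
  "repeatable A u v \<longleftrightarrow> (\<forall>c d s. c \<noteq> [] \<and> c @ d = v \<and> u @ c @ s \<in> A \<longrightarrow>
     (\<exists>y z. s = y @ z \<and> u @ c @ y @ c @ y @ z \<in> A))"

text \<open>Splitting off the last letter \<open>x\<close> of the prefix gives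
  \<open>conc_split\<close> and \<open>lplus_split\<close> a letter at which to cut.\<close>

lemma repeatableI:
  assumes "\<And>c x d s. c @ x # d = v \<Longrightarrow> u @ c @ x # s \<in> A \<Longrightarrow>
     \<exists>y z. s = y @ z \<and> u @ (c @ [x]) @ y @ (c @ [x]) @ y @ z \<in> A"
  shows "repeatable A u v"
  unfolding repeatable_def
proof (intro allI impI)
  fix c d s
  assume *: "c \<noteq> [] \<and> c @ d = v \<and> u @ c @ s \<in> A"
  then obtain c0 x where x: "c = c0 @ [x]" by (cases c rule: rev_cases) auto
  show "\<exists>y z. s = y @ z \<and> u @ c @ y @ c @ y @ z \<in> A"
    using assms[of c0 x d s] * unfolding x by simp
qed

lemma repeatableD:
  assumes "repeatable A u v" "c @ x # d = v" "u @ c @ x # s \<in> A"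
  obtains y z where "s = y @ z" "u @ (c @ [x]) @ y @ (c @ [x]) @ y @ z \<in> A"
  using assms(1)[unfolded repeatable_def, rule_format, of "c @ [x]" d s] assms(2,3) by auto

text \<open>Since \<open>f\<close> labels one atom, reading it twice is possible only under an
  iteration. Descend to the iteration in which the two occurrences fall into different rounds:
  \<open>s1\<close> completes the rounds before the second \<open>f\<close>, and \<open>s2\<close>
  leads to it from the start of its round. However a prefix of that round is completed, the whole
  round can be inserted once more.\<close>

lemma mark_loop:
  "r @ f # s @ f # t \<in> re_lang (mark n e) \<Longrightarrow>
   \<exists>s1 s2. s = s1 @ s2 \<and> repeatable (re_lang (mark n e)) (r @ f # s1) (s2 @ [f])"
proof (induction e arbitrary: n r s t)
  case (Atom a)
  then show ?case by (simp add: append_eq_Cons_conv)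
next
  case (Times e1 e2)
  let ?A = "re_lang (mark n e1)" and ?B = "re_lang (mark (n + occs e1) e2)"
  have disj: False if "u \<in> ?A" "v \<in> ?B" "c \<in> set u" "c \<in> set v" for u v c
    using mark_index[OF that(1,3)] mark_index[OF that(2,4)] by simp
  from Times.prems have "(r @ f # s) @ f # t \<in> conc ?A ?B" by simp
  then show ?case
  proof (cases rule: conc_split)
    case (left t1 t2)
    then have A: "r @ f # s @ f # t1 \<in> ?A" by simp
    from Times.IH(1)[OF this] obtain s1 s2 where s: "s = s1 @ s2"
      and rep: "repeatable ?A (r @ f # s1) (s2 @ [f])" by blast
    have "repeatable (conc ?A ?B) (r @ f # s1) (s2 @ [f])"
    proof (rule repeatableI)
      fix c x d s'
      assume c: "c @ x # d = s2 @ [f]" and "(r @ f # s1) @ c @ x # s' \<in> conc ?A ?B"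
      then have "((r @ f # s1) @ c) @ x # s' \<in> conc ?A ?B" by simp
      moreover have "x \<in> set (s2 @ [f])" unfolding c[symmetric] by simp
      then have xA: "x \<in> set (r @ f # s @ f # t1)" using s by auto
      ultimately show "\<exists>y z. s' = y @ z \<and>
          (r @ f # s1) @ (c @ [x]) @ y @ (c @ [x]) @ y @ z \<in> conc ?A ?B"
      proof (cases rule: conc_split)
        case (left s1' s2')
        then have "(r @ f # s1) @ c @ x # s1' \<in> ?A" by simp
        from repeatableD[OF rep c this] obtain y z where
          yz: "s1' = y @ z" "(r @ f # s1) @ (c @ [x]) @ y @ (c @ [x]) @ y @ z \<in> ?A" .
        show ?thesis
          using concI[OF yz(2) left(3)] left(1) yz(1)
          by (intro exI[of _ y] exI[of _ "z @ s2'"]) simp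
      next
        case (right r1 r2)
        then show ?thesis using disj[OF A right(3) xA] by simp
      qed
    qed
    then show ?thesis using s by (intro exI[of _ s1] exI[of _ s2]) simp
  next
    case (right r1 r2)
    have "f \<notin> set r1" using disj[OF right(2,3), of f] by auto
    then obtain r' where r': "r = r1 @ r'" "r2 = r' @ f # s"
      using right(1) by (auto simp: append_eq_append_conv2 Cons_eq_append_conv)
    then have B: "r' @ f # s @ f # t \<in> ?B" using right by simp
    from Times.IH(2)[OF this] obtain s1 s2 where s: "s = s1 @ s2"
      and rep: "repeatable ?B (r' @ f # s1) (s2 @ [f])" by blast
    have "repeatable (conc ?A ?B) (r @ f # s1) (s2 @ [f])"
    proof (rule repeatableI)
      fix c x d s'
      assume c: "c @ x # d = s2 @ [f]" and "(r @ f # s1) @ c @ x # s' \<in> conc ?A ?B"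
      then have "((r @ f # s1) @ c) @ x # s' \<in> conc ?A ?B" by simp
      moreover have "x \<in> set (s2 @ [f])" unfolding c[symmetric] by simp
      then have xB: "x \<in> set (r' @ f # s @ f # t)" using s by auto
      ultimately show "\<exists>y z. s' = y @ z \<and>
          (r @ f # s1) @ (c @ [x]) @ y @ (c @ [x]) @ y @ z \<in> conc ?A ?B"
      proof (cases rule: conc_split)
        case (left s1' s2')
        then show ?thesis using disj[OF left(2) B _ xB] by simp
      next
        case (right r1' r2')
        have eq: "r' @ f # s @ f # t = ((r' @ f # s1) @ c) @ x # d @ t"
          using arg_cong[OF c, of "\<lambda>z. z @ t"] s by simp
        \<comment> \<open>The given word may enter the second operand after another prefix
          \<open>r1'\<close>; locality at \<open>x\<close> brings back the prefix that
          \<open>rep\<close> speaks of.\<close>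
        have "((r' @ f # s1) @ c) @ x # s' \<in> ?B"
          using mark_local[OF B[unfolded eq] right(3)] .
        then have "(r' @ f # s1) @ c @ x # s' \<in> ?B" by simp
        from repeatableD[OF rep c this] obtain y z where
          yz: "s' = y @ z" "(r' @ f # s1) @ (c @ [x]) @ y @ (c @ [x]) @ y @ z \<in> ?B" .
        show ?thesis
          using concI[OF \<open>r1 \<in> ?A\<close> yz(2)] yz(1) r' by (intro exI[of _ y] exI[of _ z]) simp
      qed
    qed
    then show ?thesis using s by (intro exI[of _ s1] exI[of _ s2]) simp
  qed
next
  case (Or e1 e2)
  let ?A = "re_lang (mark n e1)" and ?B = "re_lang (mark (n + occs e1) e2)"
  have disj: False if "u \<in> ?A" "v \<in> ?B" "c \<in> set u" "c \<in> set v" for u v c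
    using mark_index[OF that(1,3)] mark_index[OF that(2,4)] by simp
  have union: "repeatable (?A \<union> ?B) u v"
    if "repeatable X u v" "\<And>w. u @ w \<in> ?A \<union> ?B \<longleftrightarrow> u @ w \<in> X" for X u v
    using that unfolding repeatable_def by blast
  from Or.prems consider (A) "r @ f # s @ f # t \<in> ?A" | (B) "r @ f # s @ f # t \<in> ?B" by auto
  then show ?case
  proof cases
    case A
    from Or.IH(1)[OF this] obtain s1 s2 where s: "s = s1 @ s2"
      and rep: "repeatable ?A (r @ f # s1) (s2 @ [f])" by blast
    have "(r @ f # s1) @ w \<notin> ?B" for w using disj[OF A, of "(r @ f # s1) @ w" f] by auto
    then have "repeatable (?A \<union> ?B) (r @ f # s1) (s2 @ [f])" using union[OF rep] by blast
    then show ?thesis using s by (intro exI[of _ s1] exI[of _ s2]) simp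
  next
    case B
    from Or.IH(2)[OF this] obtain s1 s2 where s: "s = s1 @ s2"
      and rep: "repeatable ?B (r @ f # s1) (s2 @ [f])" by blast
    have "(r @ f # s1) @ w \<notin> ?A" for w using disj[OF _ B, of "(r @ f # s1) @ w" f] by auto
    then have "repeatable (?A \<union> ?B) (r @ f # s1) (s2 @ [f])" using union[OF rep] by blast
    then show ?thesis using s by (intro exI[of _ s1] exI[of _ s2]) simp
  qed
next
  case (Iter e)
  let ?A = "re_lang (mark n e)"
  from Iter.prems have "(r @ f # s) @ f # t \<in> lplus ?A" by simp
  then obtain r1 r2 t1 t2 where 1: "r @ f # s = r1 @ r2" "t = t1 @ t2" "r1 \<in> lstar ?A"
      "r2 @ f # t1 \<in> ?A" "t2 \<in> lstar ?A"
    by (rule lplus_split)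
  from 1(1) consider (same) r' where "r = r1 @ r'" "r2 = r' @ f # s"
    | (diff) s1 where "r1 = r @ f # s1" "s = s1 @ r2"
    by (auto simp: append_eq_append_conv2 Cons_eq_append_conv)
  then show ?case
  proof cases
    case same
    then have A: "r' @ f # s @ f # t1 \<in> ?A" using 1 by simp
    from Iter.IH[OF this] obtain s1 s2 where s: "s = s1 @ s2"
      and rep: "repeatable ?A (r' @ f # s1) (s2 @ [f])" by blast
    have "repeatable (lplus ?A) (r @ f # s1) (s2 @ [f])"
    proof (rule repeatableI)
      fix c x d s'
      assume c: "c @ x # d = s2 @ [f]" and "(r @ f # s1) @ c @ x # s' \<in> lplus ?A"
      then have "((r @ f # s1) @ c) @ x # s' \<in> lplus ?A" by simp
      then obtain q1 q2 s1' s2' where q: "((r @ f # s1) @ c) = q1 @ q2" "s' = s1' @ s2'"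
          "q1 \<in> lstar ?A" "q2 @ x # s1' \<in> ?A" "s2' \<in> lstar ?A"
        by (rule lplus_split)
      have eq: "r' @ f # s @ f # t1 = ((r' @ f # s1) @ c) @ x # d @ t1"
        using arg_cong[OF c, of "\<lambda>z. z @ t1"] s by simp
      have "((r' @ f # s1) @ c) @ x # s1' \<in> ?A"
        using mark_local[OF A[unfolded eq] q(4)] .
      then have "(r' @ f # s1) @ c @ x # s1' \<in> ?A" by simp
      from repeatableD[OF rep c this] obtain y z where
        yz: "s1' = y @ z" "(r' @ f # s1) @ (c @ [x]) @ y @ (c @ [x]) @ y @ z \<in> ?A" .
      show "\<exists>y z. s' = y @ z \<and> (r @ f # s1) @ (c @ [x]) @ y @ (c @ [x]) @ y @ z \<in> lplus ?A"
        using lplusI[OF 1(3) yz(2) q(5)] yz(1) q(2) same(1)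
        by (intro exI[of _ y] exI[of _ "z @ s2'"]) simp
    qed
    then show ?thesis using s by (intro exI[of _ s1] exI[of _ s2]) simp
  next
    case diff
    have "repeatable (lplus ?A) (r @ f # s1) (r2 @ [f])"
    proof (rule repeatableI)
      fix c x d s'
      assume c: "c @ x # d = r2 @ [f]" and "(r @ f # s1) @ c @ x # s' \<in> lplus ?A"
      then have "((r @ f # s1) @ c) @ x # s' \<in> lplus ?A" by simp
      then obtain q1 q2 s1' s2' where q: "((r @ f # s1) @ c) = q1 @ q2" "s' = s1' @ s2'"
          "q1 \<in> lstar ?A" "q2 @ x # s1' \<in> ?A" "s2' \<in> lstar ?A"
        by (rule lplus_split)
      have eq: "r2 @ f # t1 = c @ x # d @ t1" using arg_cong[OF c, of "\<lambda>z. z @ t1"] by simp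
      \<comment> \<open>This is a complete round, completed by \<open>s1'\<close>; it is the round
        that gets doubled, with \<open>y = s1'\<close>.\<close>
      have cA: "c @ x # s1' \<in> ?A" using mark_local[OF 1(4)[unfolded eq] q(4)] .
      show "\<exists>y z. s' = y @ z \<and> (r @ f # s1) @ (c @ [x]) @ y @ (c @ [x]) @ y @ z \<in> lplus ?A"
        using lplusI[OF lstar_append[OF 1(3) lstar_single[OF cA]] cA q(5)] q(2) diff(1)
        by (intro exI[of _ s1'] exI[of _ s2']) simp
    qed
    then show ?thesis using diff(2) by (intro exI[of _ s1] exI[of _ r2]) simp
  qed
qed auto

lemma map_lplus: "map f ` lplus A = lplus (map f ` A)"
proof (intro equalityI subsetI)
  fix w assume "w \<in> map f ` lplus A"
  then obtain ws where "w = map f (concat ws)" "ws \<noteq> []" "set ws \<subseteq> A"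
    by (auto simp: lplus_def)
  then have "w = concat (map (map f) ws)" "map (map f) ws \<noteq> []" "set (map (map f) ws) \<subseteq> map f ` A"
    by (auto simp: map_concat)
  then show "w \<in> lplus (map f ` A)" unfolding lplus_def by blast
next
  fix w assume "w \<in> lplus (map f ` A)"
  then obtain ws where ws: "w = concat ws" "ws \<noteq> []" "set ws \<subseteq> map f ` A"
    by (auto simp: lplus_def)
  have "\<exists>vs. vs' = map (map f) vs \<and> set vs \<subseteq> A" if "set vs' \<subseteq> map f ` A" for vs'
    using that
  proof (induction vs')
    case (Cons v vs')
    then obtain u us where "v = map f u" "u \<in> A" "vs' = map (map f) us" "set us \<subseteq> A" by auto
    then show ?case by (intro exI[of _ "u # us"]) simp
  qed simp
  then obtain vs where "ws = map (map f) vs" "set vs \<subseteq> A"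
    using ws by blast
  then have "w = map f (concat vs)" "concat vs \<in> lplus A"
    using ws unfolding lplus_def by (simp_all add: map_concat) blast
  then show "w \<in> map f ` lplus A" by blast
qed

lemma map_conc: "map f ` conc A B = conc (map f ` A) (map f ` B)"
  unfolding conc_def
  by (auto simp: image_iff) (metis map_append)+

lemma map_fst_mark: "map fst ` re_lang (mark n e) = re_lang e"
  by (induction e arbitrary: n) (simp_all add: map_conc map_lplus image_Un)

lemma map_fst_marked_lang: "map fst ` marked_lang \<alpha> = ref_lang \<alpha>"
  by (simp add: marked_lang_def map_fst_mark re_lang_rx_re)

section \<open>Ref-words as memory programs\<close>

type_synonym 'a memory = "nat \<Rightarrow> 'a list \<times> status"

primrec emit :: "'a memory \<Rightarrow> 'a sym \<Rightarrow> 'a list" where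
  "emit m (Ter a) = [a]"
| "emit m (Var x) = fst (m x)"
| "emit m (Opn x) = []"
| "emit m (Cls x) = []"

primrec memstep :: "'a memory \<Rightarrow> 'a sym \<Rightarrow> 'a memory" where
  "memstep m (Ter a) = (\<lambda>y. upd [a] IKeep (m y))"
| "memstep m (Var x) = (\<lambda>y. upd (fst (m x)) (if y = x then IClose else IKeep) (m y))"
| "memstep m (Opn x) = m(x := ([], Opened))"
| "memstep m (Cls x) = m(x := (fst (m x), Closed))"

abbreviation memsteps :: "'a memory \<Rightarrow> 'a sym list \<Rightarrow> 'a memory" where
  "memsteps \<equiv> foldl memstep"

primrec emitted :: "'a memory \<Rightarrow> 'a sym list \<Rightarrow> 'a list" where
  "emitted m [] = []"
| "emitted m (c # r) = emit m c @ emitted (memstep m c) r"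

lemma emitted_append: "emitted m (r @ s) = emitted m r @ emitted (memsteps m r) s"
  by (induction r arbitrary: m) simp_all

abbreviation init :: "'a memory" where
  "init \<equiv> \<lambda>_. ([], Closed)"

primrec open_after :: "nat set \<Rightarrow> 'a sym \<Rightarrow> nat set" where
  "open_after S (Ter a) = S"
| "open_after S (Var x) = S"
| "open_after S (Opn x) = insert x S"
| "open_after S (Cls x) = S - {x}"

text \<open>The side condition of \<open>RBind\<close> seen along a ref-word: inside a binding of
  \<open>x\<close> there is neither a reference to \<open>x\<close> nor another binding of
  \<open>x\<close>.\<close>

primrec allowed :: "nat set \<Rightarrow> 'a sym \<Rightarrow> bool" where
  "allowed S (Ter a) = True"
| "allowed S (Var x) = (x \<notin> S)"
| "allowed S (Opn x) = (x \<notin> S)"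
| "allowed S (Cls x) = (x \<in> S)"

primrec well_bracketed :: "nat set \<Rightarrow> 'a sym list \<Rightarrow> bool" where
  "well_bracketed S [] = True"
| "well_bracketed S (c # r) = (allowed S c \<and> well_bracketed (open_after S c) r)"

lemma well_bracketed_append:
  "well_bracketed S (r @ s) \<longleftrightarrow> well_bracketed S r \<and> well_bracketed (foldl open_after S r) s"
  by (induction r arbitrary: S) simp_all

lemma ref_lang_well_bracketed:
  assumes "\<alpha> \<in> RX_nonempty \<Sigma>" "r \<in> ref_lang \<alpha>" "S \<inter> vars \<alpha> = {}"
  shows "well_bracketed S r \<and> foldl open_after S r = S"
  using assms
proof (induction arbitrary: r S rule: RX_nonempty.induct)
  case (4 \<alpha> \<beta>)
  then obtain u v where "r = u @ v" "u \<in> ref_lang \<alpha>" "v \<in> ref_lang \<beta>" by (auto simp: conc_def)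
  moreover have "S \<inter> vars \<alpha> = {}" "S \<inter> vars \<beta> = {}" using 4 by auto
  ultimately show ?case using 4 by (simp add: well_bracketed_append)
next
  case (5 \<alpha> \<beta>)
  moreover have "S \<inter> vars \<alpha> = {}" "S \<inter> vars \<beta> = {}" using 5 by auto
  ultimately show ?case by auto
next
  case (6 \<alpha>)
  have "well_bracketed S (concat ws) \<and> foldl open_after S (concat ws) = S"
    if "set ws \<subseteq> ref_lang \<alpha>" for ws
    using that
  proof (induction ws)
    case (Cons w ws)
    then show ?case using "6.IH"[of w S] "6.prems" by (simp add: well_bracketed_append)
  qed simp
  then show ?case using "6.prems" by (auto simp: lplus_def)
next
  case (7 \<alpha> x)
  then obtain q where "r = [Opn x] @ q @ [Cls x]" "q \<in> ref_lang \<alpha>" by auto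
  moreover have "insert x S \<inter> vars \<alpha> = {}" "x \<notin> S" using 7 by auto
  ultimately show ?case using "7.IH"[of q "insert x S"] by (simp add: well_bracketed_append)
qed auto

section \<open>Nearest factors and memory contents\<close>

lemma terminals_append [simp]: "terminals (r @ s) = terminals r @ terminals s"
  by (induction r) (simp_all split: sym.split)

lemma terminals_map_Ter [simp]: "terminals (map Ter w) = w"
  by (induction w) simp_all

lemma var_valueI: "last_factor x p v \<Longrightarrow> var_value x p = terminals v"
  unfolding var_value_def using last_factor_unique by (metis the_equality)

text \<open>Only a closing bracket completes a factor of \<open>x\<close>. An opening bracket may
  well occur in \<open>ts\<close>: the factor closed before it remains the nearest complete
  one.\<close>

lemma last_factor_append:
  assumes "Cls x \<notin> set ts"
  shows "last_factor x (p @ ts) v \<longleftrightarrow> last_factor x p v"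
proof
  assume "last_factor x (p @ ts) v"
  then obtain u w where *: "p @ ts = (u @ Opn x # v) @ Cls x # w" "Opn x \<notin> set v"
      "Cls x \<notin> set v" "Cls x \<notin> set w"
    unfolding last_factor_def by auto
  obtain w' where "p = (u @ Opn x # v) @ Cls x # w'" "w = w' @ ts"
    using *(1) assms by (auto simp: append_eq_append_conv2 Cons_eq_append_conv append_eq_Cons_conv)
  then show "last_factor x p v" unfolding last_factor_def
    using * by (intro exI[of _ u] exI[of _ w']) auto
next
  assume "last_factor x p v"
  then obtain u w where "p = u @ [Opn x] @ v @ [Cls x] @ w" "Opn x \<notin> set v"
      "Cls x \<notin> set v" "Cls x \<notin> set w"
    unfolding last_factor_def by auto
  then show "last_factor x (p @ ts) v" unfolding last_factor_def
    using assms by (intro exI[of _ u] exI[of _ "w @ ts"]) auto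
qed

lemma var_value_append: "Cls x \<notin> set ts \<Longrightarrow> var_value x (p @ ts) = var_value x p"
proof -
  assume "Cls x \<notin> set ts"
  then have "last_factor x (p @ ts) = last_factor x p" using last_factor_append by blast
  then show ?thesis by (simp add: var_value_def)
qed

text \<open>Simulation invariant: \<open>p\<close> is the part of the ref-word already substituted,
  \<open>S\<close> the set of bindings still open. Open memories need a clause of their own, because
  their content becomes a \<open>last_factor\<close> only at the closing bracket.\<close>

definition agrees :: "nat set \<Rightarrow> 'a sym list \<Rightarrow> 'a memory \<Rightarrow> bool" where
  "agrees S p m \<longleftrightarrow> (\<forall>x.
     (x \<notin> S \<longrightarrow> m x = (var_value x p, Closed)) \<and>
     (x \<in> S \<longrightarrow> (\<exists>u v. p = u @ [Opn x] @ v \<and> Opn x \<notin> set v \<and> Cls x \<notin> set v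
        \<and> m x = (terminals v, Opened))))"

lemma agrees_append:
  assumes "agrees S p m" "x \<notin> S" "Cls x \<notin> set ts"
  shows "m x = (var_value x (p @ ts), Closed)"
  using assms unfolding agrees_def by (simp add: var_value_append)

lemma agrees_append_open:
  assumes "agrees S p m" "x \<in> S" "Opn x \<notin> set ts" "Cls x \<notin> set ts"
  shows "\<exists>u v. p @ ts = u @ [Opn x] @ v \<and> Opn x \<notin> set v \<and> Cls x \<notin> set v
     \<and> m x = (fst (m x), Opened) \<and> fst (m x) @ terminals ts = terminals v"
proof -
  obtain u v where "p = u @ [Opn x] @ v" "Opn x \<notin> set v" "Cls x \<notin> set v"
      "m x = (terminals v, Opened)"
    using assms unfolding agrees_def by blast
  then show ?thesis using assms by (intro exI[of _ u] exI[of _ "v @ ts"]) simp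
qed

lemma agrees_Ter:
  assumes "agrees S p m"
  shows "agrees S (p @ map Ter w) (\<lambda>y. upd w IKeep (m y))"
  unfolding agrees_def
proof (intro allI conjI impI)
  fix y assume "y \<notin> S"
  moreover have "Cls y \<notin> set (map Ter w)" by auto
  ultimately have "m y = (var_value y (p @ map Ter w), Closed)"
    using agrees_append[OF assms] by blast
  then show "upd w IKeep (m y) = (var_value y (p @ map Ter w), Closed)" by simp
next
  fix y assume "y \<in> S"
  from agrees_append_open[OF assms this, of "map Ter w"] obtain u v where
    *: "p @ map Ter w = u @ [Opn y] @ v" "Opn y \<notin> set v" "Cls y \<notin> set v"
      "m y = (fst (m y), Opened)" "fst (m y) @ w = terminals v"
    by auto
  have "upd w IKeep (m y) = (terminals v, Opened)" by (subst *(4)) (simp add: *(5))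
  then show "\<exists>u v. p @ map Ter w = u @ [Opn y] @ v \<and> Opn y \<notin> set v \<and> Cls y \<notin> set v
      \<and> upd w IKeep (m y) = (terminals v, Opened)"
    using * by blast
qed

lemma agrees_step:
  assumes "agrees S p m" "allowed S c"
  shows "agrees (open_after S c) (p @ (case c of Var x \<Rightarrow> map Ter (fst (m x)) | _ \<Rightarrow> [c])) (memstep m c)"
proof (cases c)
  case (Ter a)
  then show ?thesis using agrees_Ter[OF assms(1), of "[a]"] by simp
next
  case (Var x)
  then have "m x = (var_value x p, Closed)" using assms by (simp add: agrees_def)
  \<comment> \<open>Memory \<open>x\<close> is closed here, so the \<open>IClose\<close> that a
    recall gives its own memory acts like \<open>IKeep\<close>.\<close>
  then have "memstep m c = (\<lambda>y. upd (fst (m x)) IKeep (m y))" using Var by auto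
  then show ?thesis using Var agrees_Ter[OF assms(1), of "fst (m x)"] by simp
next
  case (Opn x)
  show ?thesis unfolding agrees_def
  proof (intro allI conjI impI)
    fix y assume "y \<notin> open_after S c"
    then show "memstep m c y = (var_value y (p @ (case c of Var x \<Rightarrow> map Ter (fst (m x)) | _ \<Rightarrow> [c])), Closed)"
      using agrees_append[OF assms(1), of y "[c]"] Opn by simp
  next
    fix y assume "y \<in> open_after S c"
    then show "\<exists>u v. p @ (case c of Var x \<Rightarrow> map Ter (fst (m x)) | _ \<Rightarrow> [c]) = u @ [Opn y] @ v
        \<and> Opn y \<notin> set v \<and> Cls y \<notin> set v \<and> memstep m c y = (terminals v, Opened)"
      using agrees_append_open[OF assms(1), of y "[c]"] Opn
      by (cases "y = x") (fastforce intro: exI[of _ p] exI[of _ "[]"])+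
  qed
next
  case (Cls x)
  then have "x \<in> S" using assms by simp
  then obtain u v where uv: "p = u @ [Opn x] @ v" "Opn x \<notin> set v" "Cls x \<notin> set v"
      "m x = (terminals v, Opened)"
    using assms unfolding agrees_def by blast
  then have "last_factor x (p @ [Cls x]) v"
    unfolding last_factor_def by (intro exI[of _ u] exI[of _ "[]"]) simp
  then have val: "var_value x (p @ [Cls x]) = terminals v" by (rule var_valueI)
  show ?thesis unfolding agrees_def
  proof (intro allI conjI impI)
    fix y assume "y \<notin> open_after S c"
    then show "memstep m c y = (var_value y (p @ (case c of Var x \<Rightarrow> map Ter (fst (m x)) | _ \<Rightarrow> [c])), Closed)"
      using agrees_append[OF assms(1), of y "[c]"] Cls val uv by (cases "y = x") auto
  next
    fix y assume "y \<in> open_after S c"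
    then show "\<exists>u v. p @ (case c of Var x \<Rightarrow> map Ter (fst (m x)) | _ \<Rightarrow> [c]) = u @ [Opn y] @ v
        \<and> Opn y \<notin> set v \<and> Cls y \<notin> set v \<and> memstep m c y = (terminals v, Opened)"
      using agrees_append_open[OF assms(1), of y "[c]"] Cls by fastforce
  qed
qed

lemma replace_vars_emitted:
  assumes "agrees S p m" "well_bracketed S r"
  shows "terminals (replace_vars p r) = terminals p @ emitted m r"
  using assms
proof (induction r arbitrary: S p m)
  case (Cons c r)
  let ?p = "p @ (case c of Var x \<Rightarrow> map Ter (fst (m x)) | _ \<Rightarrow> [c])"
  have "terminals (replace_vars ?p r) = terminals ?p @ emitted (memstep m c) r"
    using Cons.IH[OF agrees_step[OF Cons.prems(1), of c]] Cons.prems(2) by simp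
  moreover have "replace_vars p (c # r) = replace_vars ?p r"
    using Cons.prems by (cases c) (auto simp: agrees_def)
  moreover have "terminals ?p = terminals p @ emit m c" by (cases c) simp_all
  ultimately show ?case by simp
qed simp

lemma deref_emitted:
  assumes "\<alpha> \<in> RX \<Sigma>" "r \<in> ref_lang \<alpha>"
  shows "deref r = emitted init r"
proof -
  have "\<alpha> \<in> RX_nonempty \<Sigma>" using assms unfolding RX_def by auto
  from ref_lang_well_bracketed[OF this assms(2), of "{}"] have "well_bracketed {} r" by simp
  moreover have "agrees {} [] init" by (simp add: agrees_def var_value_def last_factor_def)
  ultimately show ?thesis using replace_vars_emitted[of "{}" "[]" init r] by (simp add: deref_def)
qed

lemma rx_lang_emitted:
  "\<alpha> \<in> RX \<Sigma> \<Longrightarrow> rx_lang \<alpha> = (\<lambda>\<rho>. emitted init (map fst \<rho>)) ` marked_lang \<alpha>"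
  unfolding rx_lang_def map_fst_marked_lang[symmetric] image_image
  by (rule image_cong[OF refl]) (metis deref_emitted image_eqI map_fst_marked_lang)

section \<open>Runs of deterministic memory automata\<close>

text \<open>Recall failures lead to the trap state and thus do not occur in accepting runs when that state
  is not final; they are no steps.\<close>

inductive step :: "'a tmfa \<Rightarrow> nat \<times> ('a list \<times> status) list \<Rightarrow> 'a list \<Rightarrow>
    nat \<times> ('a list \<times> status) list \<Rightarrow> bool" for M :: "'a tmfa" where
  letter: "(p, s) \<in> delta M q (Letter a) \<Longrightarrow> step M (q, m) [a] (p, map2 (upd [a]) s m)"
| eps: "(p, s) \<in> delta M q Eps \<Longrightarrow> step M (q, m) [] (p, map2 (upd []) s m)"
| recall: "(p, s) \<in> delta M q (Mem i) \<Longrightarrow> s ! i = IClose \<Longrightarrow> v = fst (m ! i) \<Longrightarrow>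
     step M (q, m) v (p, map2 (upd v) s m)"

inductive run :: "'a tmfa \<Rightarrow> nat \<times> ('a list \<times> status) list \<Rightarrow> 'a list \<Rightarrow>
    nat \<times> ('a list \<times> status) list \<Rightarrow> bool" for M :: "'a tmfa" where
  refl: "run M c [] c"
| step: "step M c v c' \<Longrightarrow> run M c' w c'' \<Longrightarrow> run M c (v @ w) c''"

lemma run_trans: "run M c u c' \<Longrightarrow> run M c' v c'' \<Longrightarrow> run M c (u @ v) c''"
  by (induction rule: run.induct) (auto intro: run.step)

lemma step_run: "step M c v c' \<Longrightarrow> run M c v c'"
  using run.step[OF _ run.refl] by fastforce

lemma step_move: "step M c v c' \<Longrightarrow> move M (fst c, v @ w, snd c) (fst c', w, snd c')"
proof (induction rule: step.cases)
  case (letter p s q a m)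
  then show ?case using move.letter[of p s M q a w m] by simp
next
  case (eps p s q m)
  then show ?case using move.eps[of p s M q w m] by simp
next
  case (recall p s q i v m)
  then show ?case using move.recall[of p s M q i v m w] by simp
qed

lemma run_moves: "run M c v c' \<Longrightarrow> (move M)\<^sup>*\<^sup>* (fst c, v @ w, snd c) (fst c', w, snd c')"
proof (induction rule: run.induct)
  case (step c v c' w' c'')
  then show ?case using step_move[of M c v c' "w' @ w"]
    by (auto intro: converse_rtranclp_into_rtranclp)
qed simp

lemma trap_moves:
  assumes "M \<in> TMFA" "(move M)\<^sup>*\<^sup>* c c'" "fst c = trap M"
  shows "fst c' = trap M"
  using assms(2,3)
proof (induction rule: rtranclp_induct)
  case (step y z)
  have eq: "delta M (trap M) b = (if b \<in> Letter ` alphabet M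
      then {(trap M, replicate (mems M) IKeep)} else {})" for b
    using assms(1) unfolding TMFA_def by auto
  from step.hyps(2) step.IH[OF step.prems] show ?case
    by cases (auto simp: eq split: if_splits)
qed

lemma moves_run:
  assumes "M \<in> TMFA" "(move M)\<^sup>*\<^sup>* c c'" "fst c' \<noteq> trap M" "fst (snd c') = []"
  shows "run M (fst c, snd (snd c)) (fst (snd c)) (fst c', snd (snd c'))"
  using assms(2)
proof (induction rule: converse_rtranclp_induct)
  case base
  show ?case using run.refl[of M] assms(4) by simp
next
  case (step y z)
  from step.hyps(1) show ?case
  proof cases
    case (letter p s q a w m)
    then show ?thesis using step.IH run.step[OF step.letter[OF letter(3), of m], of w] by simp
  next
    case (eps p s q w m)
    then show ?thesis using step.IH run.step[OF step.eps[OF eps(3), of m], of w] by simp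
  next
    case (recall p s q i v m w)
    then show ?thesis using step.IH run.step[OF step.recall[OF recall(3,4,5)], of w] by simp
  next
    case (failure p s q i m v v' w)
    then show ?thesis using trap_moves[OF assms(1) step.hyps(2)] assms(3) by simp
  qed
qed

section \<open>Well-formed configurations and acceptance by runs\<close>

lemma delta_labels:
  "M \<in> TMFA \<Longrightarrow> (p, s) \<in> delta M q b \<Longrightarrow>
     q \<in> states M \<and> b \<in> labels M \<and> p \<in> states M \<and> length s = mems M"
proof -
  assume M: "M \<in> TMFA" and d: "(p, s) \<in> delta M q b"
  have sub: "\<forall>q \<in> states M. \<forall>b \<in> labels M. delta M q b \<subseteq> states M \<times> {s. length s = mems M}"
    using M unfolding TMFA_def mem_Collect_eq by (elim conjE)
  have out: "\<forall>q b. q \<notin> states M \<or> b \<notin> labels M \<longrightarrow> delta M q b = {}"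
    using M unfolding TMFA_def mem_Collect_eq by (elim conjE)
  have qb: "q \<in> states M" "b \<in> labels M" using out d by fastforce+
  then have "(p, s) \<in> states M \<times> {s. length s = mems M}" using sub d by blast
  then show ?thesis using qb by simp
qed

abbreviation initial :: "'a tmfa \<Rightarrow> nat \<times> ('a list \<times> status) list" where
  "initial M \<equiv> (start M, replicate (mems M) ([], Closed))"

definition valid :: "'a tmfa \<Rightarrow> nat \<times> ('a list \<times> status) list \<Rightarrow> bool" where
  "valid M c \<longleftrightarrow> fst c \<in> states M \<and> length (snd c) = mems M \<and>
     (\<forall>x \<in> set (snd c). set (fst x) \<subseteq> alphabet M)"

lemma set_upd: "set (fst (upd v i x)) \<subseteq> set v \<union> set (fst x)"
  by (cases "(v, i, x)" rule: upd.cases) auto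

lemma valid_map2:
  assumes "valid M c" "p \<in> states M" "length s = mems M" "set v \<subseteq> alphabet M"
  shows "valid M (p, map2 (upd v) s (snd c))"
proof -
  have "set (fst x) \<subseteq> alphabet M" if x: "x \<in> set (map2 (upd v) s (snd c))" for x
  proof -
    obtain i y where "x = upd v i y" "y \<in> set (snd c)"
      using x by (auto dest: set_zip_rightD)
    then show ?thesis using set_upd[of v i y] assms(1,4) unfolding valid_def by blast
  qed
  then show ?thesis using assms(1-3) unfolding valid_def by simp
qed

lemma step_valid:
  assumes "M \<in> TMFA" "step M c v c'" "valid M c"
  shows "valid M c' \<and> set v \<subseteq> alphabet M"
  using assms(2)
proof cases
  case (letter p s q a m)
  then have "set v \<subseteq> alphabet M" using delta_labels[OF assms(1) letter(4)] by (auto simp: labels_def)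
  then show ?thesis using valid_map2[OF assms(3)] delta_labels[OF assms(1) letter(4)] letter by simp
next
  case (eps p s q m)
  then show ?thesis using valid_map2[OF assms(3)] delta_labels[OF assms(1) eps(4)] by simp
next
  case (recall p s q i m)
  note d = delta_labels[OF assms(1) recall(3)]
  then have "i < length m" using assms(3) recall by (auto simp: labels_def valid_def)
  then have "set v \<subseteq> alphabet M" using assms(3) recall by (auto simp: valid_def)
  then show ?thesis using valid_map2[OF assms(3)] d recall by simp
qed

lemma run_valid:
  "M \<in> TMFA \<Longrightarrow> run M c v c' \<Longrightarrow> valid M c \<Longrightarrow> valid M c' \<and> set v \<subseteq> alphabet M"
  by (rotate_tac 1, induction rule: run.induct) (auto dest: step_valid)

lemma valid_initial: "M \<in> TMFA \<Longrightarrow> valid M (initial M)"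
  by (auto simp: valid_def TMFA_def)

lemma tmfa_lang_run:
  assumes "M \<in> TMFA" "trap M \<notin> finals M"
  shows "tmfa_lang M = {w. \<exists>c. fst c \<in> finals M \<and> run M (initial M) w c}"
proof (intro equalityI subsetI)
  fix w assume "w \<in> tmfa_lang M"
  then obtain q m where "q \<in> finals M"
      "(move M)\<^sup>*\<^sup>* (start M, w, replicate (mems M) ([], Closed)) (q, [], m)"
    unfolding tmfa_lang_def by auto
  then have "run M (initial M) w (q, m)" using moves_run[OF assms(1)] assms(2) by fastforce
  then show "w \<in> {w. \<exists>c. fst c \<in> finals M \<and> run M (initial M) w c}"
    using \<open>q \<in> finals M\<close> by auto
next
  fix w assume "w \<in> {w. \<exists>c. fst c \<in> finals M \<and> run M (initial M) w c}"
  then obtain c where *: "fst c \<in> finals M" "run M (initial M) w c" by auto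
  then have "w \<in> lists (alphabet M)"
    using run_valid[OF assms(1) *(2) valid_initial[OF assms(1)]] by auto
  then show "w \<in> tmfa_lang M" using run_moves[OF *(2), of "[]"] *(1)
    unfolding tmfa_lang_def by auto
qed

lemma card_le_1_eq:
  assumes "finite A" "card A \<le> 1" "x \<in> A" "y \<in> A"
  shows "x = y"
  using assms card_le_Suc0_iff_eq[OF assms(1)] by auto

text \<open>A label \<open>Eps\<close> or \<open>Mem\<close> excludes all others, so two different
  steps could only read two different letters. A common input rules this out, and so does a first
  step that does not read exactly one letter. The latter case serves for recalls of longer words,
  compared with an input not known to match.\<close>

lemma step_deterministic:
  assumes M: "M \<in> DTMFA" and "step M c v1 c1" "step M c v2 c2"
    and "v1 @ u1 = v2 @ u2 \<or> length v1 \<noteq> 1"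
  shows "v1 = v2 \<and> c1 = c2"
proof -
  have T: "M \<in> TMFA" and card: "card (delta M q b) \<le> 1" for q b
    using M by (simp_all add: DTMFA_def)
  have exclusive: "\<forall>q x y. x \<in> {Eps} \<union> Mem ` {..<mems M} \<and> delta M q x \<noteq> {} \<and> y \<noteq> x
      \<longrightarrow> delta M q y = {}"
    using M unfolding DTMFA_def mem_Collect_eq by (elim conjE)
  have uniq: "x = y" if "x \<in> delta M q b" "y \<in> delta M q b" for x y q b
    using card_le_1_eq[OF TMFA_finite_delta[OF T] card] that by blast
  have excl: "y = x" if "d1 \<in> delta M q x" "d2 \<in> delta M q y" "x \<in> {Eps} \<union> range Mem" for d1 d2 q x y
  proof -
    have "x \<in> labels M" using delta_labels[OF T, of "fst d1" "snd d1" q x] that by simp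
    then have "x \<in> {Eps} \<union> Mem ` {..<mems M}" using that(3) by (auto simp: labels_def)
    then show ?thesis using exclusive[rule_format, of x q y] that(1,2) by blast
  qed
  have main: "\<exists>p s b. (p, s) \<in> delta M (fst c) b \<and> c' = (p, map2 (upd v) s (snd c)) \<and>
      (case b of Letter a \<Rightarrow> v = [a] | Eps \<Rightarrow> v = [] | Mem i \<Rightarrow> v = fst (snd c ! i))"
    if "step M c v c'" for v c'
    using that by cases (fastforce split: label.split)+
  from main[OF assms(2)] obtain p1 s1 b1 where 1: "(p1, s1) \<in> delta M (fst c) b1"
    "c1 = (p1, map2 (upd v1) s1 (snd c))"
    "case b1 of Letter a \<Rightarrow> v1 = [a] | Eps \<Rightarrow> v1 = [] | Mem i \<Rightarrow> v1 = fst (snd c ! i)" by blast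
  from main[OF assms(3)] obtain p2 s2 b2 where 2: "(p2, s2) \<in> delta M (fst c) b2"
    "c2 = (p2, map2 (upd v2) s2 (snd c))"
    "case b2 of Letter a \<Rightarrow> v2 = [a] | Eps \<Rightarrow> v2 = [] | Mem i \<Rightarrow> v2 = fst (snd c ! i)" by blast
  have "b1 = b2"
  proof (cases "b1 \<in> {Eps} \<union> range Mem \<or> b2 \<in> {Eps} \<union> range Mem")
    case True
    then show ?thesis using excl 1(1) 2(1) by blast
  next
    case False
    then obtain a1 a2 where "b1 = Letter a1" "b2 = Letter a2"
      by (cases b1; cases b2) auto
    then show ?thesis using 1(3) 2(3) assms(4) by auto
  qed
  then show ?thesis using uniq[OF 1(1)] 2 1 by (cases b1) auto
qed

text \<open>With \<open>u = []\<close> the second run might stop before \<open>c1\<close>, at a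
  configuration from which steps reading nothing lead on; a nonempty \<open>u\<close> forces it
  through \<open>c1\<close>.\<close>

lemma run_deterministic:
  assumes M: "M \<in> DTMFA" and "run M c p c1" "run M c (p @ u) c2" "u \<noteq> []"
  shows "run M c1 u c2"
  using assms(2,3)
proof (induction rule: run.induct)
  case (step c v c' w c'')
  from step.prems show ?case
  proof cases
    case refl
    then show ?thesis using assms(4) by simp
  next
    case (step v' d w')
    have "v = v' \<and> c' = d"
      using step_deterministic[OF M \<open>step M c v c'\<close> step(2)] step(1) by (metis append.assoc)
    then show ?thesis using step step.IH by auto
  qed
qed simp

section \<open>Languages without long forced factors\<close>

text \<open>Whenever two letters \<open>c\<close>, \<open>d\<close> can follow, some nonempty
  continuation does not start with both of them. It has to be nonempty because a run on
  \<open>p\<close> alone may end before a recall is reached.\<close>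

definition no_jump :: "'a list set \<Rightarrow> bool" where
  "no_jump L \<longleftrightarrow> (\<forall>p c d u. p @ c # d # u \<in> L \<longrightarrow>
     (\<exists>u'. u' \<noteq> [] \<and> p @ u' \<in> L \<and> take 2 u' \<noteq> [c, d]))"

text \<open>Two letters tell the lengths 0, 1 and at least 2 apart, keep contents of length at most
  1 exactly, and can be updated when an open memory grows.\<close>

definition short :: "'a list \<times> status \<Rightarrow> 'a list \<times> status" where
  "short x = (take 2 (fst x), snd x)"

definition truncate :: "nat \<times> ('a list \<times> status) list \<Rightarrow> nat \<times> ('a list \<times> status) list" where
  "truncate c = (fst c, map short (snd c))"

lemma take_append_cong:
  assumes "take n u = take n u'"
  shows "take n (u @ v) = take n (u' @ v)"
proof -
  have "min n (length u) = min n (length u')" using assms by (metis length_take min.commute)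
  then have "n - length u = n - length u'" by linarith
  then show ?thesis using assms by simp
qed

lemma short_upd:
  assumes "short x = short y"
  shows "short (upd v i x) = short (upd v i y)"
proof -
  obtain u s u' s' where "x = (u, s)" "y = (u', s')" by (cases x, cases y)
  then show ?thesis using assms take_append_cong[of 2 u u' v]
    by (cases i; cases s) (auto simp: short_def)
qed

lemma truncate_upd:
  assumes "map short m = map short m'"
  shows "map short (map2 (upd v) s m) = map short (map2 (upd v) s m')"
proof -
  have len: "length m = length m'" using assms map_eq_imp_length_eq by blast
  have "short (m ! i) = short (m' ! i)" if "i < length m" for i
    using assms that len by (metis nth_map)
  then show ?thesis using len by (intro nth_equalityI) (auto intro!: short_upd)
qed

lemma step_truncate:
  assumes "M \<in> TMFA" "step M c v c'" "length v \<le> 1" "valid M c" "truncate c = truncate e"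
  shows "\<exists>e'. step M e v e' \<and> truncate c' = truncate e'"
proof -
  obtain q m' where e: "e = (q, m')" by fastforce
  have c: "fst c = q" "map short (snd c) = map short m'" using assms(5) e by (auto simp: truncate_def)
  from assms(2) show ?thesis
  proof cases
    case (letter p s q' a m)
    then have "step M e v (p, map2 (upd v) s m')" using c e by (auto intro: step.letter)
    then show ?thesis using letter truncate_upd[of m m'] c by (fastforce simp: truncate_def)
  next
    case (eps p s q' m)
    then have "step M e v (p, map2 (upd v) s m')" using c e by (auto intro: step.eps)
    then show ?thesis using eps truncate_upd[of m m'] c by (fastforce simp: truncate_def)
  next
    case (recall p s q' i m)
    then have "i < length m" using delta_labels[OF assms(1) recall(3)] assms(4)
      by (auto simp: labels_def valid_def)
    moreover have "length m = length m'" using c recall map_eq_imp_length_eq by fastforce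
    ultimately have "short (m ! i) = short (m' ! i)" using c recall by (metis nth_map snd_conv)
    \<comment> \<open>The truncation reveals that a content has length at most one, and then it is
      the content: both configurations recall the same \<open>v\<close>.\<close>
    then have t: "take 2 v = take 2 (fst (m' ! i))" using recall by (simp add: short_def)
    then have "min 2 (length v) = min 2 (length (fst (m' ! i)))" by (metis length_take min.commute)
    then have "length (fst (m' ! i)) \<le> 2" using assms(3) by linarith
    then have "v = fst (m' ! i)" using t assms(3) by simp
    then have "step M e v (p, map2 (upd v) s m')"
      using c e recall step.recall[of p s M q i v m'] by simp
    then show ?thesis using recall truncate_upd[of m m'] c by (fastforce simp: truncate_def)
  qed
qed

section \<open>Finitely many residuals\<close>

context
  fixes M :: "'a tmfa"
  assumes M: "M \<in> DTMFA_rej" and no_jump: "no_jump (tmfa_lang M)"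
begin

lemma M_TMFA: "M \<in> TMFA" and M_DTMFA: "M \<in> DTMFA" and M_rej: "trap M \<notin> finals M"
  using M by (simp_all add: DTMFA_rej_def DTMFA_def)

lemma lang_iff_run: "w \<in> tmfa_lang M \<longleftrightarrow> (\<exists>c. run M (initial M) w c \<and> fst c \<in> finals M)"
  unfolding tmfa_lang_run[OF M_TMFA M_rej] by blast

lemma recall_short:
  assumes "run M (initial M) p c1" "step M c1 v c2" "run M c2 u c3" "fst c3 \<in> finals M"
  shows "length v \<le> 1"
proof (rule ccontr)
  assume "\<not> length v \<le> 1"
  then obtain c d v' where v: "v = c # d # v'" by (cases v; cases "tl v") auto
  have "run M (initial M) (p @ v @ u) c3"
    using run_trans[OF assms(1) run.step[OF assms(2,3)]] .
  then have "p @ v @ u \<in> tmfa_lang M"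
    using assms(4) unfolding lang_iff_run by blast
  then have "p @ c # d # v' @ u \<in> tmfa_lang M" using v by simp
  then obtain u' where u': "u' \<noteq> []" "p @ u' \<in> tmfa_lang M" "take 2 u' \<noteq> [c, d]"
    using no_jump unfolding no_jump_def by blast
  then obtain c4 where "run M (initial M) (p @ u') c4" unfolding lang_iff_run by blast
  \<comment> \<open>As \<open>u'\<close> is nonempty, the run on \<open>p @ u'\<close> passes
    through \<open>c1\<close> and must then make the same step, whose word \<open>v\<close> starts
    with \<open>c\<close> and \<open>d\<close>.\<close>
  from run_deterministic[OF M_DTMFA assms(1) this u'(1)] show False
  proof cases
    case refl
    then show ?thesis using u' by simp
  next
    case (step v2 c' w)
    have "v = v2" using step_deterministic[OF M_DTMFA assms(2) step(2)] v by simp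
    then have "u' = c # d # v' @ w" using step(1) v by simp
    then show ?thesis using u'(3) by simp
  qed
qed

text \<open>By \<open>recall_short\<close> no step reads more than one letter, so none straddles the
  cut. The prefix \<open>p\<close> and the final state are carried along because
  \<open>recall_short\<close> speaks of accepting runs from the initial configuration.\<close>

lemma run_split:
  assumes "run M c w f" "fst f \<in> finals M" "run M (initial M) p c" "w = u1 @ u2"
  shows "\<exists>c'. run M c u1 c' \<and> run M c' u2 f"
  using assms
proof (induction arbitrary: p u1 rule: run.induct)
  case (refl c)
  then have "u1 = []" "u2 = []" by auto
  then show ?case using run.refl by blast
next
  case (step c v c' w' f)
  have "length v \<le> 1" using recall_short[OF step.prems(2) step.hyps step.prems(1)] .
  then consider "u1 = []" | "v = []" | x u1' where "v = [x]" "u1 = x # u1'"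
    using step.prems(3) by (cases v; cases u1) auto
  then show ?case
  proof cases
    case 1
    then have "run M c u1 c" "run M c u2 f"
      using run.refl run.step[OF step.hyps] step.prems(3) by simp_all
    then show ?thesis by blast
  next
    case 2
    then obtain d where d: "run M c' u1 d" "run M d u2 f"
      using step.IH[OF step.prems(1) run_trans[OF step.prems(2) step_run[OF step.hyps(1)]], of u1]
        step.prems(3) by fastforce
    then have "run M c u1 d" using run.step[OF step.hyps(1) d(1)] 2 by simp
    then show ?thesis using d(2) by blast
  next
    case 3
    then obtain d where d: "run M c' u1' d" "run M d u2 f"
      using step.IH[OF step.prems(1) run_trans[OF step.prems(2) step_run[OF step.hyps(1)]], of u1']
        step.prems(3) by fastforce
    then have "run M c u1 d" using run.step[OF step.hyps(1) d(1)] 3 by simp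
    then show ?thesis using d(2) by blast
  qed
qed

lemma run_truncate:
  assumes "run M c w f" "fst f \<in> finals M" "run M (initial M) p c" "truncate c = truncate e"
  shows "\<exists>f'. run M e w f' \<and> fst f' \<in> finals M"
  using assms
proof (induction arbitrary: p e rule: run.induct)
  case (refl c)
  then show ?case using run.refl by (metis fst_conv truncate_def)
next
  case (step c v c' w' f)
  have "length v \<le> 1" using recall_short[OF step.prems(2) step.hyps step.prems(1)] .
  then obtain e' where e': "step M e v e'" "truncate c' = truncate e'"
    using step_truncate[OF M_TMFA step.hyps(1)] run_valid[OF M_TMFA step.prems(2) valid_initial[OF M_TMFA]]
      step.prems(3) by blast
  then obtain f' where "run M e' w' f'" "fst f' \<in> finals M"
    using step.IH[OF step.prems(1) run_trans[OF step.prems(2) step_run[OF step.hyps(1)]]] by blast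
  then show ?case using run.step[OF e'(1)] by blast
qed

text \<open>A set of configurations is compared, because several are reached after \<open>p\<close>
  if steps read nothing. Each word of the residual is accepted from one of them, and acceptance
  depends on its truncation only.\<close>

lemma residual_eq:
  assumes "truncate ` {c. run M (initial M) p c} = truncate ` {c. run M (initial M) p' c}"
    and "p @ u \<in> tmfa_lang M"
  shows "p' @ u \<in> tmfa_lang M"
proof -
  obtain f where f: "run M (initial M) (p @ u) f" "fst f \<in> finals M"
    using assms(2) unfolding lang_iff_run by blast
  then obtain c where c: "run M (initial M) p c" "run M c u f"
    using run_split[OF f run.refl, of p u] by auto
  then obtain e where e: "run M (initial M) p' e" "truncate c = truncate e"
    using assms(1) by blast
  then obtain f' where "run M e u f'" "fst f' \<in> finals M"
    using run_truncate[OF c(2) f(2) c(1)] by blast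
  then show ?thesis using run_trans[OF e(1)] unfolding lang_iff_run by blast
qed

lemma finite_truncations: "finite (range (\<lambda>p. truncate ` {c. run M (initial M) p c}))"
proof -
  let ?U = "{u. set u \<subseteq> alphabet M \<and> length u \<le> 2} \<times> {Opened, Closed}"
  let ?C = "states M \<times> {m. set m \<subseteq> ?U \<and> length m = mems M}"
  have "finite (states M)" "finite (alphabet M)" using M_TMFA by (simp_all add: TMFA_def)
  then have "finite ?C"
    by (intro finite_cartesian_product finite_lists_length_eq finite_lists_length_le) auto
  moreover have "truncate c \<in> ?C" if "run M (initial M) p c" for p c
  proof -
    have v: "valid M c" using run_valid[OF M_TMFA that valid_initial[OF M_TMFA]] by simp
    have "short x \<in> ?U" if "x \<in> set (snd c)" for x
    proof -
      have "set (take 2 (fst x)) \<subseteq> alphabet M"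
        using v that set_take_subset[of 2 "fst x"] unfolding valid_def by blast
      moreover have "snd x \<in> {Opened, Closed}" by (cases "snd x") auto
      ultimately show ?thesis by (simp add: short_def)
    qed
    then have "set (map short (snd c)) \<subseteq> ?U" unfolding set_map by blast
    moreover have "fst c \<in> states M" "length (map short (snd c)) = mems M"
      using v by (simp_all add: valid_def)
    ultimately show ?thesis unfolding truncate_def by blast
  qed
  then have "range (\<lambda>p. truncate ` {c. run M (initial M) p c}) \<subseteq> Pow ?C" by blast
  ultimately show ?thesis by (meson finite_Pow_iff finite_subset)
qed

lemma finite_residuals: "finite (range (\<lambda>p. {u. p @ u \<in> tmfa_lang M}))"
proof -
  let ?R = "\<lambda>p. truncate ` {c. run M (initial M) p c}"
  let ?res = "\<lambda>p. {u. p @ u \<in> tmfa_lang M}"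
  \<comment> \<open>\<open>h\<close> takes any prefix with the given set of truncations; by
    \<open>residual_eq\<close> the choice does not influence the residual.\<close>
  define h where "h X = ?res (SOME p. ?R p = X)" for X
  have "?res p = h (?R p)" for p
  proof -
    have "?R (SOME p'. ?R p' = ?R p) = ?R p"
      using someI[of "\<lambda>p'. ?R p' = ?R p" p] by blast
    then have "u \<in> ?res (SOME p'. ?R p' = ?R p) \<longleftrightarrow> u \<in> ?res p" for u
      using residual_eq[of "SOME p'. ?R p' = ?R p" p u]
        residual_eq[of p "SOME p'. ?R p' = ?R p" u] by (simp only: mem_Collect_eq) argo
    then show ?thesis unfolding h_def by blast
  qed
  then have "range ?res \<subseteq> h ` range ?R" by blast
  then show ?thesis using finite_truncations finite_surj by blast
qed

end

text \<open>The Myhill-Nerode criterion: the prefixes \<open>f n\<close> have pairwise different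
  residuals, contradicting \<open>finite_residuals\<close>.\<close>

lemma not_L_DTMFA_rejI:
  fixes f :: "nat \<Rightarrow> nat list"
  assumes "no_jump L" "\<And>m n. m < n \<Longrightarrow> \<exists>u. (f m @ u \<in> L) \<noteq> (f n @ u \<in> L)"
  shows "L \<notin> L_DTMFA_rej"
proof
  assume "L \<in> L_DTMFA_rej"
  then obtain M where "M \<in> DTMFA_rej" "L = tmfa_lang M" by (auto simp: L_DTMFA_rej_def)
  then have fin: "finite (range (\<lambda>p. {u. p @ u \<in> L}))" using finite_residuals assms(1) by blast
  have "inj (\<lambda>n. {u. f n @ u \<in> L})"
  proof (rule linorder_injI)
    fix m n :: nat assume "m < n"
    from assms(2)[OF this] show "{u. f m @ u \<in> L} \<noteq> {u. f n @ u \<in> L}" by blast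
  qed
  moreover have "finite (range (\<lambda>n. {u. f n @ u \<in> L}))"
    by (rule finite_subset[OF _ fin]) blast
  ultimately show False using finite_imageD infinite_UNIV_nat by blast
qed

section \<open>From deterministic regex to automata\<close>

definition visible :: "'a sym \<times> nat \<Rightarrow> bool" where
  "visible c \<longleftrightarrow> fst c \<notin> Gam"

lemma visible_iff: "visible c \<longleftrightarrow> fst c \<in> range Ter \<union> range Var"
  by (cases "fst c") (auto simp: visible_def Gam_def)

lemma mGam_words_iff: "\<gamma> \<in> mGam_words \<longleftrightarrow> (\<forall>c \<in> set \<gamma>. \<not> visible c)"
  by (auto simp: mGam_words_def visible_def in_lists_conv_set mem_Times_iff)

lemma memsteps_Gam_emitted: "set r \<subseteq> Gam \<Longrightarrow> emitted m r = []"
  by (induction r arbitrary: m) (auto simp: Gam_def)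

lemma mGam_words_Gam: "\<gamma> \<in> mGam_words \<Longrightarrow> set (map fst \<gamma>) \<subseteq> Gam"
  by (auto simp: mGam_words_iff visible_def)

text \<open>Composes the instruction \<open>i\<close> for memory \<open>x\<close> with one more
  bracket. Closing after \<open>IOpen\<close> or \<open>IReset\<close> gives \<open>IReset\<close>,
  since nothing has been read in between and the content is empty.\<close>

definition bracket_instr :: "nat \<Rightarrow> instr \<Rightarrow> 'a sym \<Rightarrow> instr" where
  "bracket_instr x i c = (case c of
     Opn y \<Rightarrow> if y = x then IOpen else i
   | Cls y \<Rightarrow> if y = x then (if i = IKeep \<or> i = IClose then IClose else IReset) else i
   | _ \<Rightarrow> i)"

definition instr_of :: "'a sym list \<Rightarrow> nat \<Rightarrow> instr" where
  "instr_of r x = foldl (bracket_instr x) IKeep r"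

lemma upd_Nil_IKeep [simp]: "upd [] IKeep x = x"
  by (cases x; cases "snd x") auto

text \<open>The brackets act before \<open>v\<close> is read, so one instruction combined with
  \<open>v\<close> has the effect of the whole row of brackets followed by reading
  \<open>v\<close>.\<close>

lemma upd_instr_of:
  assumes "set r \<subseteq> Gam"
  shows "upd v (instr_of r x) (m x) = upd v IKeep (memsteps m r x)"
  using assms
proof (induction r arbitrary: v rule: rev_induct)
  case Nil
  then show ?case by (simp add: instr_of_def)
next
  case (snoc c r)
  let ?i = "instr_of r x" and ?m = "memsteps m r"
  have IH: "upd v ?i (m x) = upd v IKeep (?m x)" for v using snoc by simp
  obtain u s where ms: "m x = (u, s)" by fastforce
  have m: "?m x = upd [] ?i (u, s)" using IH[of "[]"] ms by simp
  have i: "instr_of (r @ [c]) x = bracket_instr x ?i c" by (simp add: instr_of_def)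
  have "c \<in> Gam" using snoc.prems by simp
  then consider (o) y where "c = Opn y" | (c) y where "c = Cls y" by (auto simp: Gam_def)
  then show ?case
  proof cases
    case o
    then show ?thesis using IH ms unfolding i by (auto simp: bracket_instr_def)
  next
    case c
    then show ?thesis using IH[of v] m ms unfolding i
      by (cases ?i) (auto simp: bracket_instr_def)
  qed
qed

lemma ref_lang_symbols:
  assumes "\<alpha> \<in> RX \<Sigma>" "r \<in> ref_lang \<alpha>" "c \<in> set r"
  shows "c \<in> Ter ` \<Sigma> \<union> Var ` vars \<alpha> \<union> Opn ` vars \<alpha> \<union> Cls ` vars \<alpha>"
proof -
  have "\<alpha> \<in> RX_nonempty \<Sigma>" using assms by (auto simp: RX_def)
  then show ?thesis using assms(2,3)
  proof (induction arbitrary: r rule: RX_nonempty.induct)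
    case (4 \<alpha> \<beta>)
    then show ?case by (fastforce simp: conc_def image_Un)
  next
    case (6 \<alpha>)
    then have "r \<in> lplus (ref_lang \<alpha>)" by simp
    from lplus_set[OF this "6.prems"(2)] show ?case using "6.IH" by auto
  qed (auto simp: image_Un)
qed

lemma finite_vars: "finite (vars \<alpha>)"
  by (induction \<alpha>) auto

fun num :: "nat option \<Rightarrow> nat" where
  "num None = 0"
| "num (Some i) = 2 * i + 2"

lemma num_inject [simp]: "num p = num p' \<longleftrightarrow> p = p'"
  by (cases p; cases p') auto

lemma even_num: "even (num p)"
  by (cases p) auto

lemma num_odd [simp]: "num p \<noteq> 2 * j + 3" "2 * j + 3 \<noteq> num p"
  using even_num[of p] by (metis even_add even_mult_iff even_numeral odd_numeral)+

lemma num_one [simp]: "num p \<noteq> Suc 0" "Suc 0 \<noteq> num p"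
  by (cases p; simp)+

definition stops :: "('a sym \<times> nat) list \<Rightarrow> nat option \<Rightarrow> bool" where
  "stops r p \<longleftrightarrow> (case p of None \<Rightarrow> r = []
     | Some i \<Rightarrow> r \<noteq> [] \<and> visible (last r) \<and> snd (last r) = i)"

lemma stops_None [simp]: "stops r None \<longleftrightarrow> r = []"
  by (simp add: stops_def)

lemma stops_snoc: "visible c \<Longrightarrow> stops (r @ [c]) (Some (snd c))"
  by (simp add: stops_def)

lemma ends_visible_induct [consumes 1, case_names Nil snoc]:
  assumes "r = [] \<or> visible (last r)" "P []"
    and "\<And>r \<gamma> c. r = [] \<or> visible (last r) \<Longrightarrow> \<gamma> \<in> mGam_words \<Longrightarrow> visible c \<Longrightarrow> P r \<Longrightarrow>
      P (r @ \<gamma> @ [c])"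
  shows "P r"
  using assms(1)
proof (induction "length r" arbitrary: r rule: less_induct)
  case less
  show ?case
  proof (cases r rule: rev_cases)
    case Nil
    then show ?thesis using assms(2) by simp
  next
    case (snoc r' c)
    define q \<gamma> where "q = rev (dropWhile (\<lambda>d. \<not> visible d) (rev r'))"
      and "\<gamma> = rev (takeWhile (\<lambda>d. \<not> visible d) (rev r'))"
    have r': "r' = q @ \<gamma>" unfolding q_def \<gamma>_def by (metis rev_append rev_rev_ident takeWhile_dropWhile_id)
    have \<gamma>: "\<gamma> \<in> mGam_words" unfolding \<gamma>_def mGam_words_iff by (auto dest: set_takeWhileD)
    have "q = [] \<or> visible (last q)"
      unfolding q_def using hd_dropWhile[of "\<lambda>d. \<not> visible d" "rev r'"] by (auto simp: last_rev)
    moreover have "length q < length r" using snoc r' by simp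
    ultimately have "P q" using less.hyps by blast
    moreover have "visible c" using less.prems snoc by simp
    ultimately show ?thesis
      using assms(3)[of q \<gamma> c] \<gamma> \<open>q = [] \<or> visible (last q)\<close> snoc r' by simp
  qed
qed

section \<open>The position automaton of a deterministic regex\<close>

locale deterministic_regex =
  fixes \<alpha> :: "'a rx" and \<Sigma> :: "'a set"
  assumes DRX: "\<alpha> \<in> DRX \<Sigma>" and finite_alphabet: "finite \<Sigma>"
begin

abbreviation R :: "('a sym \<times> nat) list set" where
  "R \<equiv> marked_lang \<alpha>"

abbreviation mem :: "('a sym \<times> nat) list \<Rightarrow> 'a memory" where
  "mem r \<equiv> memsteps init (map fst r)"

abbreviation out :: "('a sym \<times> nat) list \<Rightarrow> 'a list" where
  "out r \<equiv> emitted init (map fst r)"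

lemma out_append: "out (r @ s) = out r @ emitted (mem r) (map fst s)"
  by (simp add: emitted_append)

lemma out_Gam: "\<gamma> \<in> mGam_words \<Longrightarrow> out (r @ \<gamma>) = out r"
  by (simp add: emitted_append memsteps_Gam_emitted[OF mGam_words_Gam])

lemma RX: "\<alpha> \<in> RX \<Sigma>"
  using DRX by (simp add: DRX_def)

lemma locality: "r @ c # s \<in> R \<Longrightarrow> r' @ c # s' \<in> R \<Longrightarrow> r @ c # s' \<in> R"
  unfolding marked_lang_def by (rule mark_local)

lemma index_unique: "w \<in> R \<Longrightarrow> c \<in> set w \<Longrightarrow> w' \<in> R \<Longrightarrow> c' \<in> set w' \<Longrightarrow> snd c = snd c' \<Longrightarrow> c = c'"
  unfolding marked_lang_def by (rule mark_index_unique)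

text \<open>The clauses of \<open>nondeterministic\<close> for equal terminals and for a variable,
  the latter in both orders, leave only \<open>c = d\<close>; the clause for one symbol behind
  different brackets then gives \<open>\<gamma>1 = \<gamma>2\<close>. Hence the only possible
  branching is between different terminals.\<close>

lemma determinism:
  assumes 1: "r @ \<gamma>1 @ c # s1 \<in> R" and 2: "r @ \<gamma>2 @ d # s2 \<in> R"
    and g: "\<gamma>1 \<in> mGam_words" "\<gamma>2 \<in> mGam_words" and v: "visible c" "visible d"
    and *: "fst c = fst d \<or> fst c \<in> range Var \<or> fst d \<in> range Var"
  shows "c = d \<and> \<gamma>1 = \<gamma>2"
proof -
  have det: "\<not> nondeterministic \<alpha>" using DRX by (simp add: DRX_def)
  obtain \<chi> i where c: "c = (\<chi>, i)" by fastforce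
  obtain \<psi> j where d: "d = (\<psi>, j)" by fastforce
  have "i = j"
  proof (rule ccontr)
    assume ij: "i \<noteq> j"
    consider a where "\<chi> = Ter a" "\<psi> = Ter a" | x where "\<chi> = Var x" | x where "\<psi> = Var x"
      using * v c d by (auto simp: visible_iff)
    then show False
    proof cases
      case (1 a)
      then show ?thesis using det assms(1,2) g ij c d unfolding nondeterministic_def
        by (metis append_Cons append_Nil)
    next
      case (2 x)
      then show ?thesis using det assms(1,2) g ij c d v(2) unfolding nondeterministic_def visible_iff
        by (metis append_Cons append_Nil fst_conv)
    next
      case (3 x)
      then show ?thesis using det assms(1,2) g ij c d v(1) unfolding nondeterministic_def visible_iff
        by (metis append_Cons append_Nil fst_conv)
    qed
  qed
  then have "c = d" using index_unique[OF 1 _ 2, of c d] c d by simp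
  moreover have "\<gamma>1 = \<gamma>2"
  proof (rule ccontr)
    assume "\<gamma>1 \<noteq> \<gamma>2"
    then show False using det assms(1,2) g v(1) \<open>c = d\<close> c unfolding nondeterministic_def visible_iff
      by (metis append_Cons append_Nil fst_conv)
  qed
  ultimately show ?thesis by simp
qed

text \<open>The number of the last visible symbol determines this symbol, and locality does the
  rest; so one state can stand for all prefixes that stop there. No completion is asked of
  \<open>r = []\<close>, which covers the initial state also when \<open>R\<close> is empty.\<close>

lemma stops_local:
  assumes "stops r p" "r = [] \<or> r @ t \<in> R" "stops r' p" "r' @ t' \<in> R"
  shows "r @ t' \<in> R"
proof (cases p)
  case None
  then show ?thesis using assms by simp
next
  case (Some i)
  then obtain q c q' c' where *: "r = q @ [c]" "r' = q' @ [c']" "snd c = i" "snd c' = i"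
    using assms(1,3) unfolding stops_def by (cases r rule: rev_cases; cases r' rule: rev_cases) auto
  then have "c = c'" using index_unique[of "r @ t" c "r' @ t'" c'] assms(2,4) by auto
  then show ?thesis using locality[of q c t q' t'] * assms(2,4) by auto
qed

text \<open>The edges of the position automaton restricted to visible symbols, labelled with the
  brackets passed on the way.\<close>

definition conn :: "nat option \<Rightarrow> ('a sym \<times> nat) list \<Rightarrow> 'a sym \<times> nat \<Rightarrow> bool" where
  "conn p \<gamma> c \<longleftrightarrow> \<gamma> \<in> mGam_words \<and> visible c \<and> (\<exists>r s. stops r p \<and> r @ \<gamma> @ c # s \<in> R)"

lemma conn_determinism:
  assumes "conn p \<gamma>1 c" "conn p \<gamma>2 d" "fst c = fst d \<or> fst c \<in> range Var \<or> fst d \<in> range Var"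
  shows "c = d \<and> \<gamma>1 = \<gamma>2"
proof -
  obtain r s r' s' where *: "stops r p" "r @ \<gamma>1 @ c # s \<in> R" "stops r' p" "r' @ \<gamma>2 @ d # s' \<in> R"
    using assms(1,2) unfolding conn_def by blast
  then have "r @ \<gamma>2 @ d # s' \<in> R" using stops_local by blast
  then show ?thesis using determinism[OF *(2)] assms unfolding conn_def by blast
qed

lemma conn_same_index:
  assumes "conn p \<gamma> c" "conn p' \<gamma>' c'" "snd c = snd c'"
  shows "c = c'"
proof -
  obtain r s r' s' where "r @ \<gamma> @ c # s \<in> R" "r' @ \<gamma>' @ c' # s' \<in> R"
    using assms unfolding conn_def by blast
  from index_unique[OF this(1) _ this(2) _ assms(3)] show ?thesis by simp
qed

text \<open>Memory number \<open>x\<close> serves the variable \<open>x\<close> itself.\<close>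

definition k :: nat where
  "k = Suc (Max (insert 0 (vars \<alpha>)))"

lemma vars_less_k: "x \<in> vars \<alpha> \<Longrightarrow> x < k"
  unfolding k_def using finite_vars[of \<alpha>] by (simp add: le_imp_less_Suc)

text \<open>State 0 is initial, state 1 is the trap, and state \<open>2 * i + 2\<close> is reached after the visible
  symbol number \<open>i\<close>.  A recall must carry the instruction \<open>IClose\<close> for its own memory, so the
  brackets in front of it are executed separately, on the way to the state \<open>2 * i + 3\<close>.\<close>

inductive transition :: "nat \<Rightarrow> 'a label \<Rightarrow> nat \<Rightarrow> instr list \<Rightarrow> bool" where
  letter: "conn p \<gamma> (Ter a, j) \<Longrightarrow>
     transition (num p) (Letter a) (num (Some j)) (map (instr_of (map fst \<gamma>)) [0..<k])"
| brackets: "conn p \<gamma> (Var x, j) \<Longrightarrow>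
     transition (num p) Eps (2 * j + 3) (map (instr_of (map fst \<gamma>)) [0..<k])"
| recall: "conn p \<gamma> (Var x, j) \<Longrightarrow>
     transition (2 * j + 3) (Mem x) (num (Some j)) ((replicate k IKeep)[x := IClose])"
| trap: "a \<in> \<Sigma> \<Longrightarrow> transition (Suc 0) (Letter a) (Suc 0) (replicate k IKeep)"

definition automaton :: "'a tmfa" where
  "automaton = \<lparr>states = {..<2 * occs (rx_re \<alpha>) + 4}, alphabet = \<Sigma>, mems = k,
     delta = (\<lambda>q b. {(p, s). transition q b p s}), start = 0,
     finals = {num p | p r \<gamma>. stops r p \<and> \<gamma> \<in> mGam_words \<and> r @ \<gamma> \<in> R}, trap = Suc 0\<rparr>"

lemma automaton_simps [simp]:
  "states automaton = {..<2 * occs (rx_re \<alpha>) + 4}" "alphabet automaton = \<Sigma>" "mems automaton = k"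
  "(p, s) \<in> delta automaton q b \<longleftrightarrow> transition q b p s" "start automaton = 0" "trap automaton = Suc 0"
  "finals automaton = {num p | p r \<gamma>. stops r p \<and> \<gamma> \<in> mGam_words \<and> r @ \<gamma> \<in> R}"
  by (simp_all add: automaton_def)

text \<open>At an even state an edge to a reference excludes every other edge by
  \<open>conn_determinism\<close>. At a recall state the number \<open>j\<close> alone fixes the
  variable, whatever edge led there.\<close>

lemma transition_deterministic:
  assumes "transition q b p s" "transition q b' p' s'" "b = b' \<or> b \<notin> range Letter \<or> b' \<notin> range Letter"
  shows "b = b' \<and> p = p' \<and> s = s'"
  using assms(1)
proof cases
  case (letter o1 \<gamma> a j)
  note 1 = letter
  from assms(2) show ?thesis
  proof cases
    case (letter o2 \<gamma>2 a2 j2)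
    then have "a2 = a" "o2 = o1" using 1 assms(3) by auto
    then have "j2 = j \<and> \<gamma>2 = \<gamma>" using conn_determinism[OF letter(5), of \<gamma> "(Ter a, j)"] 1 by simp
    then show ?thesis using 1 letter \<open>a2 = a\<close> by simp
  next
    case (brackets o2 \<gamma>2 x2 j2)
    then have "o2 = o1" using 1 by simp
    then show ?thesis using conn_determinism[OF brackets(5), of \<gamma> "(Ter a, j)"] 1 by simp
  qed (use 1 assms(3) in auto)
next
  case (brackets o1 \<gamma> x j)
  note 1 = brackets
  from assms(2) show ?thesis
  proof cases
    case (letter o2 \<gamma>2 a2 j2)
    then have "o2 = o1" using 1 by simp
    then show ?thesis using conn_determinism[OF letter(5), of \<gamma> "(Var x, j)"] 1 by simp
  next
    case (brackets o2 \<gamma>2 x2 j2)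
    then have "o2 = o1" using 1 by simp
    then show ?thesis using conn_determinism[OF brackets(5), of \<gamma> "(Var x, j)"] 1 brackets by simp
  qed (use 1 in auto)
next
  case (recall o1 \<gamma> x j)
  note 1 = recall
  from assms(2) show ?thesis
  proof cases
    case (recall o2 \<gamma>2 x2 j2)
    then have "x2 = x" "j2 = j" using conn_same_index[OF recall(5) 1(5)] 1 by auto
    then show ?thesis using 1 recall by simp
  qed (use 1 in auto)
next
  case (trap a)
  note 1 = trap
  from assms(2) show ?thesis
    by cases (use 1 assms(3) in \<open>auto simp: num_one\<close>)
qed

lemma conn_bounds:
  assumes "conn p \<gamma> c"
  shows "num p < 2 * occs (rx_re \<alpha>) + 4" "snd c < occs (rx_re \<alpha>)"
    "fst c \<in> Ter ` \<Sigma> \<union> Var ` vars \<alpha>"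
proof -
  obtain r s where *: "stops r p" "r @ \<gamma> @ c # s \<in> R" and "visible c"
    using assms unfolding conn_def by blast
  have ind: "snd d < occs (rx_re \<alpha>)" if "d \<in> set (r @ \<gamma> @ c # s)" for d
    using mark_index[OF *(2)[unfolded marked_lang_def] that] by simp
  then show "snd c < occs (rx_re \<alpha>)" by simp
  show "num p < 2 * occs (rx_re \<alpha>) + 4"
    using *(1) ind[of "last r"] by (cases p) (auto simp: stops_def)
  have "map fst (r @ \<gamma> @ c # s) \<in> ref_lang \<alpha>" using *(2) map_fst_marked_lang by blast
  from ref_lang_symbols[OF RX this, of "fst c"] \<open>visible c\<close>
  show "fst c \<in> Ter ` \<Sigma> \<union> Var ` vars \<alpha>" by (auto simp: visible_iff)
qed

lemma transition_bounds:
  assumes "transition q b p s"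
  shows "q \<in> states automaton" "b \<in> labels automaton" "p \<in> states automaton" "length s = k"
  using assms by (cases; force dest: conn_bounds vars_less_k simp: labels_def)+

lemma automaton_TMFA: "automaton \<in> TMFA"
proof -
  have 1: "delta automaton q b \<subseteq> states automaton \<times> {s. length s = mems automaton}" for q b
    using transition_bounds by force
  have 2: "delta automaton q b = {}" if "q \<notin> states automaton \<or> b \<notin> labels automaton" for q b
    using transition_bounds that by fastforce
  have 3: "transition (Suc 0) b p s \<longleftrightarrow> b \<in> Letter ` \<Sigma> \<and> p = Suc 0 \<and> s = replicate k IKeep" for b p s
    by (auto elim: transition.cases simp: num_one intro: transition.trap)
  have 4: "start automaton \<in> states automaton" "trap automaton \<in> states automaton" by auto
  have 5: "finals automaton \<subseteq> states automaton"
  proof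
    fix q assume "q \<in> finals automaton"
    then obtain p r \<gamma> where *: "q = num p" "stops r p" "r @ \<gamma> \<in> R" by auto
    show "q \<in> states automaton"
    proof (cases p)
      case (Some i)
      then have "last r \<in> set (r @ \<gamma>)" "snd (last r) = i" using * by (auto simp: stops_def)
      then have "i < occs (rx_re \<alpha>)"
        using mark_index[OF *(3)[unfolded marked_lang_def], of "last r"] by simp
      then show ?thesis using * Some by simp
    qed (use * in simp)
  qed
  have 6: "\<forall>a\<in>alphabet automaton. delta automaton (trap automaton) (Letter a) =
      {(trap automaton, replicate (mems automaton) IKeep)}"
    using 3 by auto
  have 7: "\<forall>b. b \<notin> Letter ` alphabet automaton \<longrightarrow> delta automaton (trap automaton) b = {}"
    using 3 by auto
  show ?thesis unfolding TMFA_def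
    using 1 2 4 5 6 7 finite_alphabet by (simp del: automaton_simps(4,7))
qed

lemma automaton_DTMFA_rej: "automaton \<in> DTMFA_rej"
proof -
  have "card (delta automaton q b) \<le> 1" for q b
    using card_le_Suc0_iff_eq[OF TMFA_finite_delta[OF automaton_TMFA, of q b]] transition_deterministic
    by fastforce
  moreover have "delta automaton q y = {}"
    if "x \<in> {Eps} \<union> Mem ` {..<k}" "delta automaton q x \<noteq> {}" "y \<noteq> x" for q x y
    using that transition_deterministic by fastforce
  ultimately have "automaton \<in> DTMFA"
    unfolding DTMFA_def using automaton_TMFA by (simp del: automaton_simps(4)) blast
  then show ?thesis by (simp add: DTMFA_rej_def)
qed

end

section \<open>The automaton accepts the language of the regex\<close>

context deterministic_regex
begin

abbreviation contents :: "'a memory \<Rightarrow> ('a list \<times> status) list" where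
  "contents m \<equiv> map m [0..<k]"

lemma contents_letter:
  assumes "\<gamma> \<in> mGam_words"
  shows "map2 (upd [a]) (map (instr_of (map fst \<gamma>)) [0..<k]) (contents m) =
    contents (memstep (memsteps m (map fst \<gamma>)) (Ter a))"
  using upd_instr_of[OF mGam_words_Gam[OF assms]] by (simp add: map2_map_map)

lemma contents_brackets:
  assumes "\<gamma> \<in> mGam_words"
  shows "map2 (upd []) (map (instr_of (map fst \<gamma>)) [0..<k]) (contents m) =
    contents (memsteps m (map fst \<gamma>))"
  using upd_instr_of[OF mGam_words_Gam[OF assms]] by (simp add: map2_map_map)

lemma contents_recall:
  "map2 (upd (fst (m x))) ((replicate k IKeep)[x := IClose]) (contents m) =
    contents (memstep m (Var x))"
proof -
  have "(replicate k IKeep)[x := IClose] = map (\<lambda>y. if y = x then IClose else IKeep) [0..<k]"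
    by (intro nth_equalityI) (simp_all add: nth_list_update)
  then show ?thesis by (simp only: map2_map_map memstep.simps)
qed

text \<open>Invariant of runs: a state remembers only the last visible symbol, but some marked
  prefix stopping there produces the memories and the input read. In a recall state the brackets
  \<open>\<gamma>\<close> have already acted on the memories, while nothing beyond the input of
  \<open>r\<close> has been read.\<close>

definition reached :: "nat \<times> ('a list \<times> status) list \<Rightarrow> 'a list \<Rightarrow> bool" where
  "reached c w \<longleftrightarrow>
     (\<exists>p r t. (r = [] \<or> r @ t \<in> R) \<and> stops r p \<and> c = (num p, contents (mem r)) \<and> w = out r)
   \<or> (\<exists>r \<gamma> x j t. r @ \<gamma> @ (Var x, j) # t \<in> R \<and> \<gamma> \<in> mGam_words \<and>
        c = (2 * j + 3, contents (mem (r @ \<gamma>))) \<and> w = out r)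
   \<or> fst c = Suc 0"

lemma reachedI1:
  "r = [] \<or> r @ t \<in> R \<Longrightarrow> stops r p \<Longrightarrow> reached (num p, contents (mem r)) (out r)"
  unfolding reached_def by blast

lemma reachedI2:
  "r @ \<gamma> @ (Var x, j) # t \<in> R \<Longrightarrow> \<gamma> \<in> mGam_words \<Longrightarrow>
     reached (2 * j + 3, contents (mem (r @ \<gamma>))) (out r)"
  unfolding reached_def by blast

lemma conn_extend:
  assumes "conn p \<gamma> c" "r = [] \<or> r @ t \<in> R" "stops r p"
  obtains s where "r @ \<gamma> @ c # s \<in> R"
  using assms stops_local[OF assms(3,2)] unfolding conn_def by blast

lemma step_reached:
  assumes "step automaton c v c'" "reached c w"
  shows "reached c' (w @ v)"
  using assms(1)
proof cases
  case (letter p s q a m)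
  from assms(2) consider
    (1) o1 r t where "r = [] \<or> r @ t \<in> R" "stops r o1" "q = num o1" "m = contents (mem r)" "w = out r"
    | (2) j where "q = 2 * j + 3" | (3) "q = Suc 0"
    unfolding reached_def letter by auto
  then show ?thesis
  proof cases
    case 1
    from letter(4) have "transition q (Letter a) p s" by simp
    then show ?thesis
    proof cases
      case (letter p2 \<gamma> j)
      then have conn: "conn o1 \<gamma> (Ter a, j)" using 1 by simp
      from conn_extend[OF this 1(1,2)] obtain t' where t': "r @ \<gamma> @ (Ter a, j) # t' \<in> R" .
      have \<gamma>: "\<gamma> \<in> mGam_words" using conn by (simp add: conn_def)
      have "reached (num (Some j), contents (mem (r @ \<gamma> @ [(Ter a, j)]))) (out (r @ \<gamma> @ [(Ter a, j)]))"
        by (rule reachedI1[of _ t']) (use t' in \<open>simp_all add: stops_def visible_iff\<close>)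
      moreover have "out (r @ \<gamma> @ [(Ter a, j)]) = out r @ [a]"
        using out_append[of "r @ \<gamma>" "[(Ter a, j)]"] out_Gam[OF \<gamma>, of r] by simp
      ultimately show ?thesis
        using letter \<open>c' = _\<close> \<open>v = _\<close> 1 contents_letter[OF \<gamma>, of a "mem r"] by simp
    qed (use 1 in auto)
  next
    case 2
    then show ?thesis using letter(4) by (auto elim: transition.cases)
  next
    case 3
    then have "p = Suc 0" using letter(4) by (auto elim: transition.cases)
    then show ?thesis using letter by (simp add: reached_def)
  qed
next
  case (eps p s q m)
  from eps(4) have "transition q Eps p s" by simp
  then show ?thesis
  proof cases
    case (brackets o1 \<gamma> x j)
    from assms(2) obtain r t where 1: "r = [] \<or> r @ t \<in> R" "stops r o1" "m = contents (mem r)" "w = out r"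
      unfolding reached_def eps brackets by auto
    from conn_extend[OF brackets(4) 1(1,2)] obtain t' where t': "r @ \<gamma> @ (Var x, j) # t' \<in> R" .
    have \<gamma>: "\<gamma> \<in> mGam_words" using brackets by (simp add: conn_def)
    from reachedI2[OF t' \<gamma>] show ?thesis
      using brackets eps 1 contents_brackets[OF \<gamma>, of "mem r"] by simp
  qed
next
  case (recall p s q i m)
  from recall(3) have "transition q (Mem i) p s" by simp
  then show ?thesis
  proof cases
    case (recall o1 \<gamma>' j)
    from assms(2) obtain r \<gamma> x t where 2: "r @ \<gamma> @ (Var x, j) # t \<in> R" "\<gamma> \<in> mGam_words"
        "m = contents (mem (r @ \<gamma>))" "w = out r"
      unfolding reached_def \<open>c = _\<close> recall by auto
    obtain r' s' where "r' @ \<gamma>' @ (Var i, j) # s' \<in> R" using recall(4) unfolding conn_def by blast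
    \<comment> \<open>The invariant and the transition each bring a variable of their own; the
      common number \<open>j\<close> identifies them.\<close>
    from index_unique[OF this _ 2(1), of "(Var i, j)" "(Var x, j)"] have x: "x = i" by simp
    have "i < k" using conn_bounds(3)[OF recall(4)] vars_less_k by auto
    then have v: "v = fst (mem (r @ \<gamma>) i)" using \<open>v = _\<close> 2 by simp
    have "reached (num (Some j), contents (mem (r @ \<gamma> @ [(Var x, j)]))) (out (r @ \<gamma> @ [(Var x, j)]))"
      by (rule reachedI1[of _ t]) (use 2 in \<open>simp_all add: stops_def visible_iff\<close>)
    moreover have "out (r @ \<gamma> @ [(Var x, j)]) = out r @ v"
      using out_append[of "r @ \<gamma>" "[(Var x, j)]"] out_Gam[OF 2(2), of r] x v by simp
    ultimately show ?thesis
      using recall \<open>c' = _\<close> 2 x v contents_recall[of "mem (r @ \<gamma>)" i] by simp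
  qed
qed

lemma run_reached: "run automaton c v c' \<Longrightarrow> reached c w \<Longrightarrow> reached c' (w @ v)"
proof (induction arbitrary: w rule: run.induct)
  case (step c v c' w' c'')
  from step.IH[OF step_reached[OF step.hyps(1) step.prems]] show ?case by simp
qed simp

lemma initial_automaton: "initial automaton = (num None, contents (mem []))"
  by (simp add: map_replicate_const)

lemma run_prefix:
  assumes "r = [] \<or> visible (last r)" "r @ t \<in> R"
  shows "\<exists>p. stops r p \<and> run automaton (initial automaton) (out r) (num p, contents (mem r))"
  using assms
proof (induction arbitrary: t rule: ends_visible_induct)
  case Nil
  then show ?case unfolding initial_automaton using run.refl[of automaton "(num None, contents (mem []))"]
    by (intro exI[of _ None]) simp
next
  case (snoc r \<gamma> c)
  from snoc.prems have R': "r @ \<gamma> @ c # t \<in> R" by simp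
  then obtain p where p: "stops r p" "run automaton (initial automaton) (out r) (num p, contents (mem r))"
    using snoc.IH by blast
  obtain j where j: "j = snd c" by simp
  have conn: "conn p \<gamma> c" using snoc p R' unfolding conn_def by blast
  let ?c = "(num (Some j), contents (mem (r @ \<gamma> @ [c])))"
  have out: "out (r @ \<gamma> @ [c]) = out r @ emit (mem (r @ \<gamma>)) (fst c)"
    using out_append[of "r @ \<gamma>" "[c]"] out_Gam[OF snoc.hyps(2), of r] by simp
  consider (t) a where "c = (Ter a, j)" | (v) x where "c = (Var x, j)"
    using snoc.hyps(3) j by (cases c) (auto simp: visible_iff)
  then have "run automaton (num p, contents (mem r)) (emit (mem (r @ \<gamma>)) (fst c)) ?c"
  proof cases
    case t
    have "transition (num p) (Letter a) (num (Some j)) (map (instr_of (map fst \<gamma>)) [0..<k])"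
      using transition.letter conn t by simp
    then have "step automaton (num p, contents (mem r)) [a] ?c"
      using step.letter[of "num (Some j)" "map (instr_of (map fst \<gamma>)) [0..<k]" automaton "num p" a
          "contents (mem r)"] contents_letter[OF snoc.hyps(2), of a "mem r"] t by simp
    then show ?thesis using step_run t by fastforce
  next
    case v
    let ?d = "(2 * j + 3, contents (mem (r @ \<gamma>)))"
    have "transition (num p) Eps (2 * j + 3) (map (instr_of (map fst \<gamma>)) [0..<k])"
      using transition.brackets conn v by simp
    then have 1: "step automaton (num p, contents (mem r)) [] ?d"
      using step.eps[of "2 * j + 3" "map (instr_of (map fst \<gamma>)) [0..<k]" automaton "num p"
          "contents (mem r)"] contents_brackets[OF snoc.hyps(2), of "mem r"] by simp
    have "x < k" using conn_bounds(3)[OF conn] v vars_less_k by auto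
    then have x: "contents (mem (r @ \<gamma>)) ! x = mem (r @ \<gamma>) x"
      "(replicate k IKeep)[x := IClose] ! x = IClose" by simp_all
    have "transition (2 * j + 3) (Mem x) (num (Some j)) ((replicate k IKeep)[x := IClose])"
      using transition.recall conn v by blast
    then have "step automaton ?d (fst (mem (r @ \<gamma>) x)) ?c"
      using step.recall[of "num (Some j)" "(replicate k IKeep)[x := IClose]" automaton "2 * j + 3" x
          "fst (mem (r @ \<gamma>) x)" "contents (mem (r @ \<gamma>))"] x
        contents_recall[of "mem (r @ \<gamma>)" x] v by simp
    from run.step[OF 1 step_run[OF this]] show ?thesis using v by simp
  qed
  from run_trans[OF p(2) this] show ?case
    using out stops_snoc[OF snoc.hyps(3), of "r @ \<gamma>"] j by (intro exI[of _ "Some j"]) simp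
qed

lemma split_visible: obtains r \<gamma> where "\<rho> = r @ \<gamma>" "r = [] \<or> visible (last r)" "\<gamma> \<in> mGam_words"
proof -
  have "\<exists>r \<gamma>. \<rho> = r @ \<gamma> \<and> (r = [] \<or> visible (last r)) \<and> \<gamma> \<in> mGam_words"
  proof (induction \<rho> rule: rev_induct)
    case (snoc c \<rho>)
    then obtain r \<gamma> where "\<rho> = r @ \<gamma>" "r = [] \<or> visible (last r)" "\<gamma> \<in> mGam_words" by blast
    show ?case
    proof (cases "visible c")
      case True
      then show ?thesis
        by (intro exI[of _ "\<rho> @ [c]"] exI[of _ "[]"]) (simp add: mGam_words_iff)
    next
      case False
      then have "\<gamma> @ [c] \<in> mGam_words" using \<open>\<gamma> \<in> mGam_words\<close> by (auto simp: mGam_words_iff)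
      then show ?thesis using \<open>\<rho> = r @ \<gamma>\<close> \<open>r = [] \<or> visible (last r)\<close>
        by (intro exI[of _ r] exI[of _ "\<gamma> @ [c]"]) simp
    qed
  qed (simp add: mGam_words_iff)
  then show thesis using that by blast
qed

lemma automaton_lang: "tmfa_lang automaton = rx_lang \<alpha>"
proof -
  have rej: "trap automaton \<notin> finals automaton" by simp
  have lang: "w \<in> tmfa_lang automaton \<longleftrightarrow>
      (\<exists>c. fst c \<in> finals automaton \<and> run automaton (initial automaton) w c)" for w
    unfolding tmfa_lang_run[OF automaton_TMFA rej] by blast
  have "w \<in> out ` R" if w: "w \<in> tmfa_lang automaton" for w
  proof -
    from w obtain c where c: "fst c \<in> finals automaton" "run automaton (initial automaton) w c"
      unfolding lang by blast
    have "reached (initial automaton) []" unfolding initial_automaton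
      using reachedI1[of "[]" _ None] by simp
    from run_reached[OF c(2) this] have "reached c w" by simp
    moreover from c(1) obtain p r' \<gamma> where f: "fst c = num p" "stops r' p" "\<gamma> \<in> mGam_words" "r' @ \<gamma> \<in> R"
      unfolding automaton_simps(7) mem_Collect_eq by blast
    ultimately have "reached (num p, snd c) w" by (metis prod.collapse)
    then obtain r t where r: "r = [] \<or> r @ t \<in> R" "stops r p" "w = out r"
      unfolding reached_def by auto
    \<comment> \<open>Finality is witnessed by a possibly different prefix \<open>r'\<close>; its
      trailing brackets fit behind \<open>r\<close> as well.\<close>
    then have "r @ \<gamma> \<in> R" using stops_local f by blast
    moreover have "w = out (r @ \<gamma>)" using out_Gam[OF f(3)] r(3) by simp
    ultimately show ?thesis by blast
  qed
  moreover have "out \<rho> \<in> tmfa_lang automaton" if \<rho>: "\<rho> \<in> R" for \<rho>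
  proof -
    obtain r \<gamma> where r: "\<rho> = r @ \<gamma>" "r = [] \<or> visible (last r)" "\<gamma> \<in> mGam_words"
      by (rule split_visible)
    then obtain p where p: "stops r p"
        "run automaton (initial automaton) (out r) (num p, contents (mem r))"
      using run_prefix \<rho> by blast
    moreover have "num p \<in> finals automaton" using p(1) r \<rho> by auto
    ultimately have "out r \<in> tmfa_lang automaton" unfolding lang by (metis fst_conv)
    then show ?thesis using out_Gam[OF r(3)] r(1) by simp
  qed
  ultimately show ?thesis unfolding rx_lang_emitted[OF RX] by blast
qed

end

lemma L_DRX_subset: "L_DRX \<subseteq> L_DTMFA_rej"
proof
  fix L assume "L \<in> L_DRX"
  then obtain \<alpha> \<Sigma> where *: "L = rx_lang \<alpha>" "finite \<Sigma>" "\<alpha> \<in> DRX \<Sigma>" by (auto simp: L_DRX_def)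
  interpret deterministic_regex \<alpha> \<Sigma> using * by unfold_locales
  show "L \<in> L_DTMFA_rej"
    unfolding L_DTMFA_rej_def using automaton_lang automaton_DTMFA_rej * by blast
qed

section \<open>A sufficient condition for determinism\<close>

primrec nullable :: "'s re \<Rightarrow> bool" where
  "nullable Zero = False"
| "nullable One = True"
| "nullable (Atom c) = False"
| "nullable (Times e f) = (nullable e \<and> nullable f)"
| "nullable (Or e f) = (nullable e \<or> nullable f)"
| "nullable (Iter e) = nullable e"

primrec firsts :: "'s re \<Rightarrow> 's set" where
  "firsts Zero = {}"
| "firsts One = {}"
| "firsts (Atom c) = {c}"
| "firsts (Times e f) = firsts e \<union> (if nullable e then firsts f else {})"
| "firsts (Or e f) = firsts e \<union> firsts f"
| "firsts (Iter e) = firsts e"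

primrec lasts :: "'s re \<Rightarrow> 's set" where
  "lasts Zero = {}"
| "lasts One = {}"
| "lasts (Atom c) = {c}"
| "lasts (Times e f) = lasts f \<union> (if nullable f then lasts e else {})"
| "lasts (Or e f) = lasts e \<union> lasts f"
| "lasts (Iter e) = lasts e"

primrec follow :: "'s re \<Rightarrow> ('s \<times> 's) set" where
  "follow Zero = {}"
| "follow One = {}"
| "follow (Atom c) = {}"
| "follow (Times e f) = follow e \<union> follow f \<union> lasts e \<times> firsts f"
| "follow (Or e f) = follow e \<union> follow f"
| "follow (Iter e) = follow e \<union> lasts e \<times> firsts e"

text \<open>For each of the four functions one inclusion is proved: the test for determinism
  quantifies universally over these sets, so over-approximation is sound.\<close>

lemma nullable: "[] \<in> re_lang e \<Longrightarrow> nullable e"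
  by (induction e) (auto simp: conc_def lplus_def neq_Nil_conv)

lemma lplus_Cons:
  assumes "c # s \<in> lplus A"
  shows "\<exists>s1 s2. s = s1 @ s2 \<and> c # s1 \<in> A \<and> s2 \<in> lstar A"
proof -
  have "\<exists>s1 s2. s = s1 @ s2 \<and> c # s1 \<in> A \<and> s2 \<in> lstar A"
    if "c # s = concat ws" "set ws \<subseteq> A" for ws
    using that
  proof (induction ws)
    case (Cons w ws)
    show ?case
    proof (cases w)
      case (Cons d w')
      have "concat ws \<in> lstar A" using Cons.prems(2) unfolding lstar_def by auto
      then show ?thesis using Cons \<open>c # s = concat (w # ws)\<close> \<open>set (w # ws) \<subseteq> A\<close> by auto
    qed (use Cons in auto)
  qed simp
  then show ?thesis using assms unfolding lplus_def by blast
qed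

lemma lstar_Cons:
  assumes "c # s \<in> lstar A"
  shows "\<exists>s1 s2. s = s1 @ s2 \<and> c # s1 \<in> A \<and> s2 \<in> lstar A"
proof -
  obtain ws where "c # s = concat ws" "set ws \<subseteq> A" using assms unfolding lstar_def by blast
  moreover from this have "ws \<noteq> []" by auto
  ultimately show ?thesis using lplus_Cons[of c s A] unfolding lplus_def by blast
qed

lemma firsts: "c # s \<in> re_lang e \<Longrightarrow> c \<in> firsts e"
proof (induction e arbitrary: s)
  case (Times e f)
  then obtain u v where "c # s = u @ v" "u \<in> re_lang e" "v \<in> re_lang f" by (auto simp: conc_def)
  then show ?case using Times.IH nullable by (cases u) auto
next
  case (Iter e)
  then have "c # s \<in> lplus (re_lang e)" by simp
  from lplus_Cons[OF this] show ?case using Iter.IH by auto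
qed auto

lemma lasts: "r @ [c] \<in> re_lang e \<Longrightarrow> c \<in> lasts e"
proof (induction e arbitrary: r)
  case (Times e f)
  then obtain u v where *: "r @ [c] = u @ v" "u \<in> re_lang e" "v \<in> re_lang f" by (auto simp: conc_def)
  show ?case
  proof (cases v rule: rev_cases)
    case Nil
    then show ?thesis using * Times.IH nullable by auto
  next
    case (snoc v' d)
    then show ?thesis using * Times.IH by auto
  qed
next
  case (Iter e)
  then have "r @ [c] \<in> lplus (re_lang e)" by simp
  then obtain r1 r2 s1 s2 where "[] = s1 @ s2" "r2 @ c # s1 \<in> re_lang e"
    by (rule lplus_split)
  then show ?case using Iter.IH by auto
qed auto

lemma follow: "r @ c # d # s \<in> re_lang e \<Longrightarrow> (c, d) \<in> follow e"
proof (induction e arbitrary: r s)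
  case (Atom x)
  then show ?case by (simp add: append_eq_Cons_conv)
next
  case (Times e f)
  then have "r @ c # d # s \<in> conc (re_lang e) (re_lang f)" by simp
  then show ?case
  proof (cases rule: conc_split)
    case (left s1 s2)
    show ?thesis
    proof (cases s1)
      case Nil
      then show ?thesis using left firsts[of d s f] lasts[of r c e] by simp
    next
      case (Cons x s1')
      then show ?thesis using left Times.IH(1)[of r s1'] by simp
    qed
  next
    case (right r1 r2)
    then show ?thesis using Times.IH(2) by simp
  qed
next
  case (Iter e)
  then have "r @ c # d # s \<in> lplus (re_lang e)" by simp
  then obtain r1 r2 s1 s2 where *: "r = r1 @ r2" "d # s = s1 @ s2" "r1 \<in> lstar (re_lang e)"
      "r2 @ c # s1 \<in> re_lang e" "s2 \<in> lstar (re_lang e)"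
    by (rule lplus_split)
  show ?case
  proof (cases s1)
    case Nil
    then have "d # s \<in> lstar (re_lang e)" using * by simp
    from lstar_Cons[OF this] obtain s' where "d # s' \<in> re_lang e" by blast
    then show ?thesis using * Nil firsts[of d s' e] lasts[of r2 c e] by simp
  next
    case (Cons x s1')
    then show ?thesis using * Iter.IH[of r2 s1'] by simp
  qed
qed auto

text \<open>\<open>T i\<close> contains the symbols that can be read next after passing the bracket number \<open>i\<close>.\<close>

locale unambiguous =
  fixes \<alpha> :: "'a rx" and E :: "('a sym \<times> nat) re" and T :: "nat \<Rightarrow> 'a sym set"
    and S :: "'a sym \<times> nat \<Rightarrow> 'a sym set"
  assumes E: "E = mark 0 (rx_re \<alpha>)"
    and S: "S = (\<lambda>c. if visible c then {fst c} else T (snd c))"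
    and bracket: "\<forall>(c, d) \<in> follow E. \<not> visible c \<longrightarrow> S d \<subseteq> S c"
    and first_first: "\<forall>c \<in> firsts E. \<forall>d \<in> firsts E. c \<noteq> d \<longrightarrow> S c \<inter> S d = {} \<and> S c \<inter> range Var = {}"
    and follow_follow: "\<forall>(b, c) \<in> follow E. \<forall>(b', d) \<in> follow E. b = b' \<and> c \<noteq> d \<longrightarrow>
      S c \<inter> S d = {} \<and> S c \<inter> range Var = {}"
    and last: "\<forall>c \<in> lasts E. visible c"
begin

lemma marked_lang_E: "marked_lang \<alpha> = re_lang E"
  by (simp add: E marked_lang_def)

text \<open>Along a row of brackets the sets \<open>S\<close> can only shrink, so the visible symbol
  at its end belongs to all of them.\<close>

lemma next_visible:
  assumes "r @ d # s \<in> re_lang E" "d # s = \<gamma> @ c # s'" "\<gamma> \<in> mGam_words" "visible c"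
  shows "fst c \<in> S d"
  using assms
proof (induction \<gamma> arbitrary: r d s)
  case Nil
  then show ?case by (simp add: S)
next
  case (Cons x \<gamma>)
  then have x: "x = d" "\<not> visible d" "s = \<gamma> @ c # s'" "\<gamma> \<in> mGam_words"
    by (auto simp: mGam_words_iff)
  then have "s \<noteq> []" by simp
  then obtain d' t where t: "s = d' # t" by (cases s) auto
  have "(r @ [d]) @ d' # t \<in> re_lang E" using Cons.prems(1) t by simp
  from Cons.IH[OF this trans[OF t[symmetric] x(3)] x(4) Cons.prems(4)] have "fst c \<in> S d'" .
  moreover have "(d, d') \<in> follow E" using follow[of r d d' t E] Cons.prems(1) t by simp
  ultimately show ?case using bracket x by blast
qed

text \<open>At the first position where the two words part, the competing symbols have disjoint sets
  \<open>S\<close> without variables. By \<open>next_visible\<close> these sets contain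
  \<open>fst c1\<close> and \<open>fst c2\<close>, which are therefore different terminals, contrary
  to the last assumption.\<close>

lemma diverge:
  assumes "r @ \<gamma>1 @ c1 # s1 \<in> re_lang E" "r @ \<gamma>2 @ c2 # s2 \<in> re_lang E"
    and "\<gamma>1 \<in> mGam_words" "\<gamma>2 \<in> mGam_words" "visible c1" "visible c2"
    and "fst c1 = fst c2 \<or> fst c1 \<in> range Var \<or> fst c2 \<in> range Var"
  shows "\<gamma>1 = \<gamma>2 \<and> c1 = c2"
  using assms
proof (induction \<gamma>1 arbitrary: r \<gamma>2)
  case (Nil r \<gamma>2)
  obtain d s where d: "\<gamma>2 @ c2 # s2 = d # s" by (cases \<gamma>2) auto
  have c1: "fst c1 \<in> S c1" using Nil by (simp add: S)
  have c2: "fst c2 \<in> S d" using next_visible[of r d s] Nil d by metis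
  have "c1 = d"
  proof (rule ccontr)
    assume "c1 \<noteq> d"
    have "S c1 \<inter> S d = {} \<and> S c1 \<inter> range Var = {} \<and> S d \<inter> range Var = {}"
    proof (cases r rule: rev_cases)
      case Nil
      then have "c1 \<in> firsts E" "d \<in> firsts E" using firsts Nil.prems(1,2) d by auto
      then show ?thesis using first_first \<open>c1 \<noteq> d\<close> by metis
    next
      case (snoc r' b)
      then have "(b, c1) \<in> follow E" "(b, d) \<in> follow E"
        using follow[of r' b c1 s1 E] follow[of r' b d s E] Nil.prems(1,2) d by auto
      then show ?thesis using follow_follow \<open>c1 \<noteq> d\<close> by fast
    qed
    then show False using c1 c2 Nil.prems(7) by auto
  qed
  then have "visible d" using Nil by simp
  then have "\<gamma>2 = []" using d Nil.prems(4) by (cases \<gamma>2) (auto simp: mGam_words_iff)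
  then show ?case using d \<open>c1 = d\<close> by simp
next
  case (Cons x \<gamma>1 r \<gamma>2)
  obtain d s where d: "\<gamma>2 @ c2 # s2 = d # s" by (cases \<gamma>2) auto
  have c1: "fst c1 \<in> S x" using next_visible[of r x "\<gamma>1 @ c1 # s1" "x # \<gamma>1"] Cons.prems by simp
  have c2: "fst c2 \<in> S d" using next_visible[of r d s] Cons.prems d by metis
  have "x = d"
  proof (rule ccontr)
    assume "x \<noteq> d"
    have "S x \<inter> S d = {} \<and> S x \<inter> range Var = {} \<and> S d \<inter> range Var = {}"
    proof (cases r rule: rev_cases)
      case Nil
      then have "x \<in> firsts E" "d \<in> firsts E" using firsts Cons.prems(1,2) d by auto
      then show ?thesis using first_first \<open>x \<noteq> d\<close> by metis
    next
      case (snoc r' b)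
      then have "(b, x) \<in> follow E" "(b, d) \<in> follow E"
        using follow[of r' b x "\<gamma>1 @ c1 # s1" E] follow[of r' b d s E] Cons.prems(1,2) d by auto
      then show ?thesis using follow_follow \<open>x \<noteq> d\<close> by fast
    qed
    then show False using c1 c2 Cons.prems(7) by auto
  qed
  moreover have "\<not> visible x" using Cons.prems(3) by (simp add: mGam_words_iff)
  ultimately obtain \<gamma> where \<gamma>: "\<gamma>2 = x # \<gamma>" using d Cons.prems(6) by (cases \<gamma>2) auto
  then have "\<gamma>1 = \<gamma> \<and> c1 = c2" using Cons.IH[of "r @ [x]" \<gamma>] Cons.prems by (simp add: mGam_words_iff)
  then show ?case using \<gamma> by simp
qed

text \<open>Deals with the last clause of \<open>nondeterministic\<close>: both rows of brackets at
  the end are empty, hence equal.\<close>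

lemma no_trailing_brackets:
  assumes "r @ \<gamma> \<in> re_lang E" "\<gamma> \<in> mGam_words"
  shows "\<gamma> = []"
proof (cases \<gamma> rule: rev_cases)
  case (snoc \<gamma>' c)
  then have "c \<in> lasts E" using lasts[of "r @ \<gamma>'" c E] assms(1) by simp
  then show ?thesis using last assms(2) snoc by (simp add: mGam_words_iff)
qed

lemma deterministic: "\<not> nondeterministic \<alpha>"
proof
  have vis: "visible (\<chi>, i)" if "\<chi> \<in> range Ter \<union> range Var" for \<chi> :: "'a sym" and i
    using that by (simp add: visible_iff)
  assume "nondeterministic \<alpha>"
  then obtain \<rho>1 \<rho>2 r s1 s2 \<gamma>1 \<gamma>2 where
    *: "\<rho>1 \<in> re_lang E" "\<rho>2 \<in> re_lang E" "\<gamma>1 \<in> mGam_words" "\<gamma>2 \<in> mGam_words"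
    and disj: "(\<exists>a i j. i \<noteq> j \<and> \<rho>1 = r @ \<gamma>1 @ [(Ter a, i)] @ s1 \<and> \<rho>2 = r @ \<gamma>2 @ [(Ter a, j)] @ s2)
     \<or> (\<exists>x \<chi> i j. \<chi> \<in> range Ter \<union> range Var \<and> i \<noteq> j
          \<and> \<rho>1 = r @ \<gamma>1 @ [(Var x, i)] @ s1 \<and> \<rho>2 = r @ \<gamma>2 @ [(\<chi>, j)] @ s2)
     \<or> (\<exists>\<chi> i. \<chi> \<in> range Ter \<union> range Var \<and> \<gamma>1 \<noteq> \<gamma>2
          \<and> \<rho>1 = r @ \<gamma>1 @ [(\<chi>, i)] @ s1 \<and> \<rho>2 = r @ \<gamma>2 @ [(\<chi>, i)] @ s2)
     \<or> (\<gamma>1 \<noteq> \<gamma>2 \<and> \<rho>1 = r @ \<gamma>1 \<and> \<rho>2 = r @ \<gamma>2)"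
    unfolding nondeterministic_def marked_lang_E by (elim bexE exE) (rule that; assumption)
  have div: "\<gamma>1 = \<gamma>2 \<and> c1 = c2"
    if "\<rho>1 = r @ \<gamma>1 @ [c1] @ s1" "\<rho>2 = r @ \<gamma>2 @ [c2] @ s2" "visible c1" "visible c2"
      "fst c1 = fst c2 \<or> fst c1 \<in> range Var \<or> fst c2 \<in> range Var" for c1 c2
    using diverge[of r \<gamma>1 c1 s1 \<gamma>2 c2 s2] * that by simp
  from disj show False
  proof (elim disjE exE conjE)
    fix a i j
    assume "i \<noteq> j" "\<rho>1 = r @ \<gamma>1 @ [(Ter a, i)] @ s1" "\<rho>2 = r @ \<gamma>2 @ [(Ter a, j)] @ s2"
    then show False using div vis by fastforce
  next
    fix x \<chi> i j
    assume "\<chi> \<in> range Ter \<union> range Var" "i \<noteq> j" "\<rho>1 = r @ \<gamma>1 @ [(Var x, i)] @ s1"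
      "\<rho>2 = r @ \<gamma>2 @ [(\<chi>, j)] @ s2"
    then show False using div[of "(Var x, i)" "(\<chi>, j)"] vis by simp
  next
    fix \<chi> i
    assume "\<chi> \<in> range Ter \<union> range Var" "\<gamma>1 \<noteq> \<gamma>2" "\<rho>1 = r @ \<gamma>1 @ [(\<chi>, i)] @ s1"
      "\<rho>2 = r @ \<gamma>2 @ [(\<chi>, i)] @ s2"
    then show False using div[of "(\<chi>, i)" "(\<chi>, i)"] vis by simp
  next
    assume "\<gamma>1 \<noteq> \<gamma>2" "\<rho>1 = r @ \<gamma>1" "\<rho>2 = r @ \<gamma>2"
    then show False using no_trailing_brackets * by metis
  qed
qed

end

section \<open>Languages that are not accepted\<close>

definition star :: "'a \<Rightarrow> 'a rx" where
  "star a = RAlt REps (RPlus (RLet a))"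

lemma lplus_singleton: "lplus {[x]} = {replicate (Suc n) x | n. True}"
proof (intro equalityI subsetI)
  fix w assume "w \<in> lplus {[x]}"
  then obtain ws where ws: "w = concat ws" "ws \<noteq> []" "set ws \<subseteq> {[x]}" by (auto simp: lplus_def)
  then have "replicate (length ws) [x] = ws" by (intro replicate_length_same) auto
  then have "w = replicate (length ws) x" using ws(1) by (metis concat_replicate_single)
  then show "w \<in> {replicate (Suc n) x | n. True}" using ws(2) by (cases ws) auto
next
  fix w assume "w \<in> {replicate (Suc n) x | n. True}"
  then obtain n where "w = concat (replicate (Suc n) [x])" by (auto simp del: replicate_Suc)
  then show "w \<in> lplus {[x]}" unfolding lplus_def
    by (intro CollectI exI[of _ "replicate (Suc n) [x]"]) auto
qed

lemma ref_lang_star: "ref_lang (star a) = map Ter ` range (\<lambda>n. replicate n a)"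
proof -
  have "w \<in> ref_lang (star a) \<longleftrightarrow> (\<exists>n. w = replicate n (Ter a))" for w
    unfolding star_def ref_lang.simps lplus_singleton
    by (auto simp del: replicate_Suc) (metis replicate_0 replicate_Suc old.nat.exhaust)+
  then have "ref_lang (star a) = range (\<lambda>n. replicate n (Ter a))" by blast
  then show ?thesis by (simp add: image_image)
qed

lemma emitted_map_Ter [simp]: "emitted m (map Ter w) = w"
  by (induction w arbitrary: m) simp_all

lemma upd_IKeep_append: "upd w IKeep (upd v IKeep x) = upd (v @ w) IKeep x"
  by (cases x; cases "snd x") auto

lemma memsteps_map_Ter: "memsteps m (map Ter w) = (\<lambda>y. upd w IKeep (m y))"
  by (induction w arbitrary: m) (simp_all add: upd_IKeep_append)

lemma rx_lang_map_Ter: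
  assumes "\<alpha> \<in> RX \<Sigma>" "ref_lang \<alpha> = map Ter ` A"
  shows "rx_lang \<alpha> = A"
proof -
  have "deref (map Ter w) = w" if "w \<in> A" for w
    using deref_emitted[OF assms(1), of "map Ter w"] assms(2) that by simp
  then show ?thesis unfolding rx_lang_def assms(2) image_image by simp
qed

lemma conc_Collect: "conc {f x | x. P x} {g y | y. Q y} = {f x @ g y | x y. P x \<and> Q y}"
  unfolding conc_def by blast

lemma conc_single: "conc {u} {g y | y. Q y} = {u @ g y | y. Q y}"
  unfolding conc_def by blast

text \<open>The common shape of the witnesses with a variable: \<open>0^n 1 0^n\<close> with room
  for a further block in front or behind. The 1 tells a deterministic reader where the bound block
  ends.\<close>

definition copy_rx :: "nat rx \<Rightarrow> nat rx \<Rightarrow> nat rx" where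
  "copy_rx P Q = RCat P (RCat (RBind 0 (star 0)) (RCat (RLet 1) (RCat (RRef 0) Q)))"

lemma rx_lang_copy_rx:
  assumes RX: "copy_rx P Q \<in> RX \<Sigma>" and "ref_lang P = map Ter ` A" "ref_lang Q = map Ter ` B"
  shows "rx_lang (copy_rx P Q) = {u @ replicate n 0 @ 1 # replicate n 0 @ v | u n v. u \<in> A \<and> v \<in> B}"
proof -
  let ?r = "\<lambda>u n v. map Ter u @ Opn 0 # map Ter (replicate n 0) @ Cls 0 # Ter 1 # Var 0 # map Ter v"
  have ref: "ref_lang (copy_rx P Q) = {?r u n v | u n v. u \<in> A \<and> v \<in> B}"
  proof -
    have A: "map Ter ` A = {map Ter u :: nat sym list | u. u \<in> A}"
      and B: "map Ter ` B = {map Ter v :: nat sym list | v. v \<in> B}"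
      and X: "{[Opn 0] @ r @ [Cls 0] | r. r \<in> map Ter ` range (\<lambda>n. replicate n 0)} =
        {[Opn 0] @ map Ter (replicate n (0::nat)) @ [Cls 0] | n. True}"
      by blast+
    let ?s = "\<lambda>n v. ([Opn 0] @ map Ter (replicate n 0) @ [Cls 0]) @ [Ter 1] @ [Var 0] @ map Ter v"
    have Y: "{?s n v | n v. True \<and> v \<in> B} = {?s (fst y) (snd y) | y. snd y \<in> B}" by auto
    have "ref_lang (copy_rx P Q) = {map Ter u @ ?s (fst y) (snd y) | u y. u \<in> A \<and> snd y \<in> B}"
      unfolding copy_rx_def ref_lang.simps ref_lang_star assms(2,3) A B X conc_single conc_Collect Y ..
    then show ?thesis by auto
  qed
  have "deref (?r u n v) = u @ replicate n 0 @ 1 # replicate n 0 @ v" if "u \<in> A" "v \<in> B" for u n v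
  proof -
    have "deref (?r u n v) = emitted init (?r u n v)"
      using deref_emitted[OF RX, of "?r u n v"] ref that by blast
    then show ?thesis by (simp add: emitted_append memsteps_map_Ter del: map_replicate)
  qed
  then have "{deref (?r u n v) | u n v. u \<in> A \<and> v \<in> B} =
      {u @ replicate n 0 @ 1 # replicate n 0 @ v | u n v. u \<in> A \<and> v \<in> B}"
    by (intro Collect_cong ex_cong1) (auto simp only:)
  moreover have "rx_lang (copy_rx P Q) = {deref (?r u n v) | u n v. u \<in> A \<and> v \<in> B}"
    unfolding rx_lang_def ref by blast
  ultimately show ?thesis by simp
qed

lemma DRX_I:
  assumes "\<alpha> \<in> RX \<Sigma>" "unambiguous \<alpha> E T S"
  shows "\<alpha> \<in> DRX \<Sigma>"
  using assms unambiguous.deterministic by (auto simp: DRX_def)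

lemma visible_simps [simp]:
  "visible (Ter a, i)" "visible (Var x, i)" "\<not> visible (Opn x, i)" "\<not> visible (Cls x, i)"
  by (auto simp: visible_def Gam_def)

abbreviation next_symbols :: "(nat \<Rightarrow> 'a sym set) \<Rightarrow> 'a sym \<times> nat \<Rightarrow> 'a sym set" where
  "next_symbols T \<equiv> \<lambda>c. if visible c then {fst c} else T (snd c)"

lemma star_DRX: "star (0::nat) \<in> DRX {0, 1}"
  by (rule DRX_I[of _ _ "mark 0 (rx_re (star 0))" "\<lambda>_. {}" "next_symbols (\<lambda>_. {})"])
    (auto simp: star_def RX_def unambiguous_def intro!: RX_nonempty.intros)

text \<open>The numbers are those given by \<open>mark\<close>: 0 is the opening bracket, behind
  which 0 or 1 comes next because the bound star may be empty; the closing bracket, number 2, is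
  followed by 1.\<close>

lemma copy_DRX: "copy_rx REps REps \<in> DRX {0, 1}"
  by (rule DRX_I[of _ _ "mark 0 (rx_re (copy_rx REps REps))" "\<lambda>i. if i = 0 then {Ter 0, Ter 1} else {Ter 1}"
      "next_symbols (\<lambda>i. if i = 0 then {Ter 0, Ter 1} else {Ter 1})"])
    (auto simp: copy_rx_def star_def RX_def unambiguous_def intro!: RX_nonempty.intros)

lemma copy_star_DRX: "copy_rx REps (star 0) \<in> DRX {0, 1}"
  by (rule DRX_I[of _ _ "mark 0 (rx_re (copy_rx REps (star 0)))" "\<lambda>i. if i = 0 then {Ter 0, Ter 1} else {Ter 1}"
      "next_symbols (\<lambda>i. if i = 0 then {Ter 0, Ter 1} else {Ter 1})"])
    (auto simp: copy_rx_def star_def RX_def unambiguous_def intro!: RX_nonempty.intros)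

text \<open>A star over 0 in front would compete with the bound star, so the leading block uses a
  new letter 2, which a homomorphism later turns into 0. That letter takes number 0 and shifts the
  opening bracket to \<open>Suc 0\<close>.\<close>

lemma star_copy_DRX: "copy_rx (star 2) REps \<in> DRX {0, 1, 2}"
  by (rule DRX_I[of _ _ "mark 0 (rx_re (copy_rx (star 2) REps))" "\<lambda>i. if i = Suc 0 then {Ter 0, Ter 1} else {Ter 1}"
      "next_symbols (\<lambda>i. if i = Suc 0 then {Ter 0, Ter 1} else {Ter 1})"])
    (auto simp: copy_rx_def star_def RX_def unambiguous_def intro!: RX_nonempty.intros)

text \<open>Made for the union with \<open>copies\<close>: it allows every prefix of a copy to be
  finished by ones, yet its words contain two ones and so are never copies.\<close>

definition two_rx :: "nat rx" where
  "two_rx = RCat (star 0) (RCat (RLet 1) (RCat (star 0) (RLet 1)))"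

lemma two_DRX: "two_rx \<in> DRX {0, 1}"
  by (rule DRX_I[of _ _ "mark 0 (rx_re two_rx)" "\<lambda>_. {}" "next_symbols (\<lambda>_. {})"])
    (auto simp: two_rx_def star_def RX_def unambiguous_def intro!: RX_nonempty.intros)

lemma DRX_RX: "\<alpha> \<in> DRX \<Sigma> \<Longrightarrow> \<alpha> \<in> RX \<Sigma>"
  by (simp add: DRX_def)

lemma L_DRX_I: "\<alpha> \<in> DRX \<Sigma> \<Longrightarrow> finite \<Sigma> \<Longrightarrow> rx_lang \<alpha> = L \<Longrightarrow> L \<in> L_DRX"
  unfolding L_DRX_def by blast

definition copies :: "nat list set" where
  "copies = {replicate n 0 @ 1 # replicate n 0 | n. True}"

lemma ref_lang_REps: "ref_lang REps = map Ter ` {[]}"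
  by simp

lemma copies_L_DRX: "copies \<in> L_DRX"
  by (rule L_DRX_I[OF copy_DRX])
    (auto simp: rx_lang_copy_rx[OF DRX_RX[OF copy_DRX] ref_lang_REps ref_lang_REps] copies_def)

lemma star_L_DRX: "range (\<lambda>n. replicate n 0) \<in> L_DRX"
  by (rule L_DRX_I[OF star_DRX]) (simp_all add: rx_lang_map_Ter[OF DRX_RX[OF star_DRX] ref_lang_star])

lemma copies_star_L_DRX: "{replicate n 0 @ 1 # replicate (n + m) 0 | n m. True} \<in> L_DRX"
  by (rule L_DRX_I[OF copy_star_DRX])
    (auto simp: rx_lang_copy_rx[OF DRX_RX[OF copy_star_DRX] ref_lang_REps ref_lang_star] replicate_add)

lemma star_copies_L_DRX: "{replicate m 2 @ replicate n 0 @ 1 # replicate n 0 | m n. True} \<in> L_DRX"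
  by (rule L_DRX_I[OF star_copy_DRX])
    (auto simp: rx_lang_copy_rx[OF DRX_RX[OF star_copy_DRX] ref_lang_star ref_lang_REps])

lemma two_L_DRX: "{replicate m 0 @ 1 # replicate n 0 @ [1] | m n. True} \<in> L_DRX"
proof -
  have "ref_lang two_rx = map Ter ` {replicate m 0 @ 1 # replicate n 0 @ [1] | m n. True}"
    unfolding two_rx_def ref_lang.simps ref_lang_star conc_def by (fastforce simp: image_iff)
  then show ?thesis using L_DRX_I[OF two_DRX] rx_lang_map_Ter[OF DRX_RX[OF two_DRX]] by simp
qed

section \<open>Residuals of the languages produced by the operations\<close>

lemma replicate_Cons_eq:
  assumes "a \<noteq> b"
  shows "replicate m a @ b # u = replicate n a @ b # v \<longleftrightarrow> m = n \<and> u = v"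
proof (induction m arbitrary: n)
  case 0
  then show ?case using assms by (cases n) auto
next
  case (Suc m)
  then show ?case using assms by (cases n) auto
qed

lemma append_eq_replicate: "u @ v = replicate n a \<Longrightarrow> u = replicate (length u) a \<and> length u + length v = n"
proof (induction n arbitrary: u)
  case (Suc n)
  then show ?case by (cases u) auto
qed simp

lemma prefix_shape:
  assumes "p @ u = replicate m a @ b # replicate n a"
  obtains i where "p = replicate i a" "i \<le> m"
  | j where "p = replicate m a @ b # replicate j a" "j + length u = n"
proof -
  from assms consider (1) us where "p @ us = replicate m a" | (2) us where "p = replicate m a @ us" "us \<noteq> []"
    "us @ u = b # replicate n a"
    by (auto simp: append_eq_append_conv2) (metis append_Nil2)
  then show thesis
  proof cases
    case 1
    from append_eq_replicate[OF this] that(1) show thesis by (metis le_add1)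
  next
    case 2
    then obtain us' where us': "us = b # us'" "us' @ u = replicate n a" by (cases us) auto
    from append_eq_replicate[OF this(2)] that(2) 2 us' show thesis by metis
  qed
qed

text \<open>Three operations lead here: a block of zeros concatenated in front of
  \<open>copies\<close>, reversal of copies with extra zeros behind, and renaming of a leading block
  of twos.\<close>

definition short_copies :: "nat list set" where
  "short_copies = {replicate m 0 @ 1 # replicate n 0 | m n. n \<le> m}"

lemma short_copies_iff: "replicate m 0 @ 1 # replicate n 0 \<in> short_copies \<longleftrightarrow> n \<le> m"
  by (auto simp: short_copies_def replicate_Cons_eq)

lemma short_copies_not_L_DTMFA_rej: "short_copies \<notin> L_DTMFA_rej"
proof (rule not_L_DTMFA_rejI)
  show "no_jump short_copies" unfolding no_jump_def
  proof (intro allI impI)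
    fix p c d u assume "p @ c # d # u \<in> short_copies"
    then obtain m n where *: "p @ c # d # u = replicate m 0 @ 1 # replicate n 0" "n \<le> m"
      by (auto simp: short_copies_def)
    from *(1) show "\<exists>u'. u' \<noteq> [] \<and> p @ u' \<in> short_copies \<and> take 2 u' \<noteq> [c, d]"
    proof (cases rule: prefix_shape)
      case (1 i)
      \<comment> \<open>Inside the first block both letters are possible, so one continuation
        differs from \<open>[c, d]\<close> in its first letter.\<close>
      have "p @ [1] \<in> short_copies" "p @ [0, 1] \<in> short_copies"
        using short_copies_iff[of i 0] short_copies_iff[of "Suc i" 0] 1
        by (simp_all add: replicate_app_Cons_same)
      then show ?thesis by (cases "c = 0") (fastforce intro: exI[of _ "[1]"], fastforce intro: exI[of _ "[0, 1]"])
    next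
      case (2 j)
      \<comment> \<open>At least two letters were still to come, so one more zero stays within the
        bound \<open>m\<close>; a continuation of length one cannot start with
        \<open>[c, d]\<close>.\<close>
      have "p @ [0] \<in> short_copies"
        using short_copies_iff[of m "Suc j"] 2 *(2) by (simp add: replicate_append_same)
      then show ?thesis by fastforce
    qed
  qed
next
  fix m n :: nat assume "m < n"
  then show "\<exists>u. ((replicate m 0 @ [1]) @ u \<in> short_copies) \<noteq> ((replicate n 0 @ [1]) @ u \<in> short_copies)"
    using short_copies_iff[of m n] short_copies_iff[of n n] by (intro exI[of _ "replicate n 0"]) simp
qed

text \<open>A prefix with two letters still to come is a prefix of some \<open>0^m 1 0^n\<close>,
  and the second language finishes it by ones, so nothing is forced. Words with a single 1 still
  compare the two blocks, which separates the residuals.\<close>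

lemma union_not_L_DTMFA_rej: "copies \<union> {replicate m 0 @ 1 # replicate n 0 @ [1] | m n. True} \<notin> L_DTMFA_rej" (is "?U \<notin> _")
proof (rule not_L_DTMFA_rejI)
  have two: "replicate m 0 @ 1 # replicate n 0 @ [1] \<in> ?U" for m n by blast
  show "no_jump ?U" unfolding no_jump_def
  proof (intro allI impI)
    fix p c d u assume "p @ c # d # u \<in> ?U"
    then consider n where "p @ c # d # u = replicate n 0 @ 1 # replicate n 0"
      | m n where "p @ c # d # u = (replicate m 0 @ 1 # replicate n 0) @ [1]"
      by (auto simp: copies_def)
    then obtain m n s where "p @ s = replicate m 0 @ 1 # replicate n 0"
    proof cases
      case (2 m n)
      have "butlast (p @ c # d # u) = replicate m 0 @ 1 # replicate n 0"
        by (simp only: 2 butlast_snoc)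
      \<comment> \<open>Dropping the final 1 does not touch \<open>p\<close>, because
        \<open>c\<close> and \<open>d\<close> follow it.\<close>
      then show thesis using that[of "butlast (c # d # u)" m n] by (simp add: butlast_append)
    qed (use that in blast)
    then show "\<exists>u'. u' \<noteq> [] \<and> p @ u' \<in> ?U \<and> take 2 u' \<noteq> [c, d]"
    proof (cases rule: prefix_shape)
      case (1 i)
      have "p @ [1, 1] \<in> ?U" "p @ [0, 1, 1] \<in> ?U"
        using two[of i 0] two[of "Suc i" 0] 1 by (simp_all add: replicate_app_Cons_same)
      then show ?thesis
        by (cases "c = 0") (fastforce intro: exI[of _ "[1, 1]"], fastforce intro: exI[of _ "[0, 1, 1]"])
    next
      case (2 j)
      then have "p @ [1] \<in> ?U" using two[of m j] by simp
      then show ?thesis by fastforce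
    qed
  qed
next
  fix m n :: nat assume "m < n"
  have "replicate n 0 @ 1 # replicate m 0 \<noteq> replicate i 0 @ 1 # replicate j 0 @ [1::nat]" for i j
  proof
    assume "replicate n 0 @ 1 # replicate m 0 = replicate i 0 @ 1 # replicate j 0 @ [1::nat]"
    then have "replicate m 0 = replicate j 0 @ [1::nat]" by (simp add: replicate_Cons_eq)
    then have "(1::nat) \<in> set (replicate m 0)" by simp
    then show False by simp
  qed
  then show "\<exists>u. ((replicate m 0 @ [1]) @ u \<in> ?U) \<noteq> ((replicate n 0 @ [1]) @ u \<in> ?U)"
    using \<open>m < n\<close> by (intro exI[of _ "replicate m 0"]) (auto simp: copies_def replicate_Cons_eq)
qed

lemma copies_iff: "replicate m 0 @ 1 # replicate n 0 \<in> copies \<longleftrightarrow> m = n"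
  by (auto simp: copies_def replicate_Cons_eq)

lemma copies_lists: "copies \<subseteq> lists {0, 1}"
  by (auto simp: copies_def)

lemma complement_not_L_DTMFA_rej: "lists {0, 1} - copies \<notin> L_DTMFA_rej"
proof (rule not_L_DTMFA_rejI)
  show "no_jump (lists {0, 1} - copies)" unfolding no_jump_def
  proof (intro allI impI)
    fix p c d u assume p: "p @ c # d # u \<in> lists {0, 1} - copies"
    have copies: "filter (\<lambda>x. x = 1) w = [1]" if "w \<in> copies" for w
      using that by (auto simp: copies_def filter_replicate)
    \<comment> \<open>Natural subtraction exchanges 0 and 1. The two ones put behind
      \<open>x\<close> lead outside \<open>copies\<close>, whose words contain exactly one.\<close>
    define x where "x = (1::nat) - c"
    have "x \<noteq> c" "x \<in> {0, 1}" using p by (auto simp: x_def)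
    then have "p @ [x, 1, 1] \<in> lists {0, 1}" using p by auto
      moreover have "length (filter (\<lambda>x. x = 1) (p @ [x, 1, 1])) \<noteq> length [1::nat]" by simp
    then have "p @ [x, 1, 1] \<notin> copies" using copies[of "p @ [x, 1, 1]"] by metis
    ultimately show "\<exists>u'. u' \<noteq> [] \<and> p @ u' \<in> lists {0, 1} - copies \<and> take 2 u' \<noteq> [c, d]"
      using \<open>x \<noteq> c\<close> by (intro exI[of _ "[x, 1, 1]"]) simp
  qed
next
  fix m n :: nat assume "m < n"
  then show "\<exists>u. ((replicate m 0 @ [1]) @ u \<in> lists {0, 1} - copies) \<noteq>
      ((replicate n 0 @ [1]) @ u \<in> lists {0, 1} - copies)"
    using copies_iff[of m m] copies_iff[of n m] by (intro exI[of _ "replicate m 0"]) auto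
qed

definition merge :: "nat \<Rightarrow> nat" where
  "merge x = (if x = 2 then 0 else x)"

lemma hom_ext_map: "hom_ext (\<lambda>x. [g x]) w = map g w"
  by (induction w) (simp_all add: hom_ext_def)

text \<open>Each zero of a copy has the preimages 0 and 2, so it never forces a particular letter.
  Only the middle 1 needs another way out: prolong the first block and choose the second one
  accordingly.\<close>

lemma merge_not_L_DTMFA_rej: "{w \<in> lists {0, 1, 2}. map merge w \<in> copies} \<notin> L_DTMFA_rej" (is "?I \<notin> _")
proof (rule not_L_DTMFA_rejI)
  show "no_jump ?I" unfolding no_jump_def
  proof (intro allI impI)
    fix p c d u assume *: "p @ c # d # u \<in> ?I"
    then have l: "p \<in> lists {0, 1, 2}" "d # u \<in> lists {0, 1, 2}" "c \<in> {0, 1, 2}" by auto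
    show "\<exists>u'. u' \<noteq> [] \<and> p @ u' \<in> ?I \<and> take 2 u' \<noteq> [c, d]"
    proof (cases "c = 1")
      case True
      obtain n where n: "map merge p @ 1 # map merge (d # u) = replicate n 0 @ 1 # replicate n 0"
        using * True by (auto simp: copies_def merge_def)
      have "\<exists>i. map merge p = replicate i 0"
        using n
      proof (cases rule: prefix_shape)
        case (2 j)
        have "filter (\<lambda>x. x = 1) (map merge p @ 1 # map merge (d # u)) = [1]"
          unfolding n by (simp add: filter_replicate)
        then show ?thesis using 2 by simp
      qed blast
      then obtain i where "map merge p = replicate i 0" by blast
      then have "map merge (p @ 0 # 1 # replicate (Suc i) 0) = replicate (Suc i) 0 @ 1 # replicate (Suc i) 0"
        by (simp add: merge_def replicate_app_Cons_same)
      then have "map merge (p @ 0 # 1 # replicate (Suc i) 0) \<in> copies"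
        using copies_iff[of "Suc i" "Suc i"] by metis
      then have "p @ 0 # 1 # replicate (Suc i) 0 \<in> ?I" using l by auto
      then show ?thesis using True by (intro exI[of _ "0 # 1 # replicate (Suc i) 0"]) simp
    next
      case False
      \<comment> \<open>This exchanges 0 and 2, the two letters with the same image.\<close>
      define e where "e = 2 - c"
      have e: "e \<in> {0, 1, 2}" "merge e = merge c" "e \<noteq> c"
        using l(3) False by (auto simp: e_def merge_def)
      then have "p @ e # d # u \<in> ?I" using * by auto
      then show ?thesis using e(3) by (intro exI[of _ "e # d # u"]) simp
    qed
  qed
next
  fix m n :: nat assume "m < n"
  have *: "(replicate k 0 @ [1]) @ replicate m 0 \<in> ?I \<longleftrightarrow> k = m" for k
  proof -
    have "map merge ((replicate k 0 @ [1]) @ replicate m 0) = replicate k 0 @ 1 # replicate m 0"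
      by (simp add: merge_def)
    moreover have "(replicate k 0 @ [1]) @ replicate m 0 \<in> lists {0, 1, 2::nat}" by auto
    ultimately show ?thesis unfolding mem_Collect_eq using copies_iff[of k m] by argo
  qed
  show "\<exists>u. ((replicate m 0 @ [1]) @ u \<in> ?I) \<noteq> ((replicate n 0 @ [1]) @ u \<in> ?I)"
    by (rule exI[of _ "replicate m 0"], unfold *) (use \<open>m < n\<close> in simp)
qed

lemma short_copies_alt:
  "short_copies = {replicate m 0 @ replicate n 0 @ 1 # replicate n 0 | m n. True}"
proof -
  have "replicate m 0 @ replicate n 0 @ 1 # replicate n 0 = replicate (m + n) 0 @ 1 # replicate n (0::nat)"
    for m n
    by (simp add: replicate_add)
  then have "{replicate m 0 @ replicate n 0 @ 1 # replicate n 0 | m n. True} =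
      {replicate (m + n) 0 @ 1 # replicate n (0::nat) | m n. True}"
    by (simp only:)
  also have "\<dots> = short_copies"
    unfolding short_copies_def by (metis le_add2 le_Suc_ex add.commute)
  finally show ?thesis by (rule sym)
qed

text \<open>Failure of closure is not inherited by larger or smaller classes, so an arbitrary class
  between the two is treated: operands come from the smaller one, while results lie outside the
  larger one.\<close>

lemma not_closed:
  assumes "L_DRX \<subseteq> \<C>" "\<C> \<subseteq> L_DTMFA_rej"
  shows "\<not> closed_union \<C>" "\<not> closed_concatenation \<C>" "\<not> closed_reversal \<C>"
    "\<not> closed_complement \<C>" "\<not> closed_homomorphism \<C>" "\<not> closed_inverse_homomorphism \<C>"
proof -
  have short: "short_copies \<notin> \<C>" using short_copies_not_L_DTMFA_rej assms(2) by blast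
  show "\<not> closed_union \<C>"
    using copies_L_DRX two_L_DRX union_not_L_DTMFA_rej assms unfolding closed_union_def by blast
  have "conc (range (\<lambda>n. replicate n 0)) copies = short_copies"
    unfolding conc_def copies_def short_copies_alt by blast
  then show "\<not> closed_concatenation \<C>"
    using star_L_DRX copies_L_DRX short assms(1) unfolding closed_concatenation_def by (metis subsetD)
  let ?V = "{replicate n 0 @ 1 # replicate (n + m) 0 | n m. True} :: nat list set"
  have rev: "rev (replicate n 0 @ 1 # replicate (n + m) 0) =
      replicate m 0 @ replicate n 0 @ 1 # replicate n (0::nat)" for n m
    by (simp add: replicate_add append_replicate_commute)
  have "rev ` ?V = {rev (replicate n 0 @ 1 # replicate (n + m) 0) | n m. True}" by blast
  also have "\<dots> = short_copies" unfolding rev short_copies_alt by blast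
  finally have "rev ` ?V = short_copies" .
  then show "\<not> closed_reversal \<C>"
    using bspec[of \<C> "\<lambda>L. rev ` L \<in> \<C>", OF _ subsetD[OF assms(1) copies_star_L_DRX]] short
    unfolding closed_reversal_def by metis
  have copies: "copies \<in> \<C>" using copies_L_DRX assms(1) by blast
  show "\<not> closed_complement \<C>"
  proof
    assume "closed_complement \<C>"
    from this[unfolded closed_complement_def, rule_format, OF copies, of "{0, 1}"]
    show False using copies_lists complement_not_L_DTMFA_rej assms(2) by auto
  qed
  let ?h = "\<lambda>x. [merge x]"
  let ?W = "{replicate m 2 @ replicate n 0 @ 1 # replicate n 0 | m n. True} :: nat list set"
  have "hom_ext ?h ` ?W = {map merge (replicate m 2 @ replicate n 0 @ 1 # replicate n 0) | m n. True}"
    unfolding hom_ext_map by blast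
  also have "\<dots> = short_copies" unfolding short_copies_alt by (simp add: merge_def)
  finally have W: "hom_ext ?h ` ?W = short_copies" .
  have h: "?h ` {0, 1, 2} \<subseteq> lists {0, 1}" "?W \<subseteq> lists {0, 1, 2}" by (auto simp: merge_def)
  have "?W \<in> \<C>" using star_copies_L_DRX assms(1) by blast
  show "\<not> closed_homomorphism \<C>"
  proof
    assume "closed_homomorphism \<C>"
    from this[unfolded closed_homomorphism_def, rule_format, of ?W "{0, 1, 2}" "{0, 1}" ?h]
    show False using h \<open>?W \<in> \<C>\<close> W short by simp
  qed
  have I: "{w \<in> lists {0, 1, 2}. hom_ext ?h w \<in> copies} \<notin> \<C>"
    unfolding hom_ext_map using merge_not_L_DTMFA_rej assms(2) by blast
  show "\<not> closed_inverse_homomorphism \<C>"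
  proof
    assume "closed_inverse_homomorphism \<C>"
    from this[unfolded closed_inverse_homomorphism_def, rule_format, OF copies, of "{0, 1, 2}" "{0, 1}" ?h]
    show False using h(1) copies_lists I by simp
  qed
qed

section \<open>Intersection\<close>

lemma split_first_visible:
  assumes "set (map fst t) \<inter> - Gam \<noteq> {}"
  obtains \<gamma> c t' where "t = \<gamma> @ c # t'" "\<gamma> \<in> mGam_words" "visible c"
proof -
  have "\<exists>c \<in> set t. visible c" using assms by (auto simp: visible_def)
  from split_list_first_prop[OF this] show thesis using that by (auto simp: mGam_words_iff)
qed

section \<open>Parsing and recalls when every position branches\<close>

context deterministic_regex
begin

lemma emitted_snoc: "\<gamma> \<in> mGam_words \<Longrightarrow> out (r @ \<gamma> @ c # t) =
    out r @ emit (mem (r @ \<gamma>)) (fst c) @ emitted (mem (r @ \<gamma> @ [c])) (map fst t)"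
  using out_append[of "r @ \<gamma>" "c # t"] out_Gam[of \<gamma> r] by simp

lemma rx_lang_out: "rx_lang \<alpha> = out ` R"
  using rx_lang_emitted[OF RX] .

text \<open>The output determines the marked symbols that produced it, as branching takes place only
  between different terminals. If nothing is left to read, \<open>r\<close> must not end in a
  reference: its value might be empty, and \<open>\<rho>\<close> could stop before it.\<close>

lemma common_prefix:
  assumes "r = [] \<or> visible (last r)" "r @ t \<in> R" "\<rho> \<in> R" "out \<rho> = out r @ u"
    and "u \<noteq> [] \<or> r = [] \<or> fst (last r) \<in> range Ter"
  shows "\<exists>t'. \<rho> = r @ t'"
  using assms
proof (induction arbitrary: t u rule: ends_visible_induct)
  case Nil
  then show ?case by simp
next
  case (snoc r \<gamma> c)
  have R1: "r @ \<gamma> @ c # t \<in> R" using snoc.prems(1) by simp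
  let ?e = "emit (mem (r @ \<gamma>)) (fst c)"
  have out: "out \<rho> = out r @ ?e @ u"
    using snoc.prems(3) emitted_snoc[OF snoc.hyps(2), of r c "[]"] by simp
  have ne: "?e @ u \<noteq> []" using snoc.prems(4) by auto
  then obtain t' where t': "\<rho> = r @ t'" using snoc.IH[OF R1 snoc.prems(2) out] by blast
  have "emitted (mem r) (map fst t') = ?e @ u" using out t' out_append[of r t'] by simp
  then have "\<not> set (map fst t') \<subseteq> Gam" using ne memsteps_Gam_emitted by metis
  then obtain \<gamma>' d s where d: "t' = \<gamma>' @ d # s" "\<gamma>' \<in> mGam_words" "visible d"
    using split_first_visible[of t'] by blast
  have R2: "r @ \<gamma>' @ d # s \<in> R" using snoc.prems(2) t' d by simp
  have out2: "out \<rho> = out r @ emit (mem (r @ \<gamma>')) (fst d) @ emitted (mem (r @ \<gamma>' @ [d])) (map fst s)"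
    using emitted_snoc[OF d(2)] t' d(1) by simp
  \<comment> \<open>Two different terminals would put different letters directly after
    \<open>out r\<close>.\<close>
  have "fst c = fst d \<or> fst c \<in> range Var \<or> fst d \<in> range Var"
  proof (rule ccontr)
    assume *: "\<not> ?thesis"
    then obtain a b where "fst c = Ter a" "fst d = Ter b" "a \<noteq> b"
      using snoc.hyps(3) d(3) by (auto simp: visible_iff)
    then show False using out out2 by simp
  qed
  from determinism[OF R1 R2 snoc.hyps(2) d(2) snoc.hyps(3) d(3) this]
  show ?case using t' d(1) by simp
qed

context
  assumes branching: "\<And>p c w. p @ c # w \<in> rx_lang \<alpha> \<Longrightarrow> \<exists>d w'. d \<noteq> c \<and> p @ d # w' \<in> rx_lang \<alpha>"
begin

text \<open>If the recalled value began with \<open>c\<close>, then \<open>branching\<close> would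
  give a word with another letter there. Its marked form shares the prefix \<open>r\<close>, and
  determinism admits nothing but the same reference next, which outputs \<open>c\<close>
  again.\<close>

lemma recall_empty:
  assumes "r = [] \<or> visible (last r)" "r @ \<gamma> @ (Var x, i) # t \<in> R" "\<gamma> \<in> mGam_words"
  shows "fst (mem (r @ \<gamma>) x) = []"
proof (rule ccontr)
  assume "fst (mem (r @ \<gamma>) x) \<noteq> []"
  then obtain c v where cv: "fst (mem (r @ \<gamma>) x) = c # v" by (cases "fst (mem (r @ \<gamma>) x)") auto
  let ?w = "v @ emitted (mem (r @ \<gamma> @ [(Var x, i)])) (map fst t)"
  have "out (r @ \<gamma> @ (Var x, i) # t) = out r @ c # ?w"
    using emitted_snoc[OF assms(3), of r "(Var x, i)" t] cv by simp
  then have "out r @ c # ?w \<in> rx_lang \<alpha>" unfolding rx_lang_out using assms(2) by (metis image_eqI)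
  then obtain d w' where d: "d \<noteq> c" "out r @ d # w' \<in> rx_lang \<alpha>" using branching by blast
  then obtain \<rho> where \<rho>: "\<rho> \<in> R" "out \<rho> = out r @ d # w'" unfolding rx_lang_out by auto
  then obtain t' where t': "\<rho> = r @ t'" using common_prefix[OF assms(1,2)] by blast
  have "emitted (mem r) (map fst t') = d # w'" using \<rho> t' out_append[of r t'] by simp
  then have "\<not> set (map fst t') \<subseteq> Gam" using memsteps_Gam_emitted[of "map fst t'" "mem r"] by auto
  then obtain \<gamma>' e s where e: "t' = \<gamma>' @ e # s" "\<gamma>' \<in> mGam_words" "visible e"
    using split_first_visible[of t'] by blast
  have "r @ \<gamma>' @ e # s \<in> R" using \<rho> t' e by simp
  from determinism[OF assms(2) this assms(3) e(2) _ e(3)] have "e = (Var x, i)" "\<gamma>' = \<gamma>" by auto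
  then have "out \<rho> = out r @ (c # v) @ emitted (mem (r @ \<gamma> @ [(Var x, i)])) (map fst s)"
    using emitted_snoc[OF assms(3), of r "(Var x, i)" s] cv t' e(1) by simp
  then show False using \<rho>(2) d(1) by simp
qed

lemma out_terminals: "\<rho> @ t \<in> R \<Longrightarrow> out \<rho> = terminals (map fst \<rho>)"
proof (induction \<rho> arbitrary: t rule: rev_induct)
  case (snoc c \<rho>)
  have IH: "out \<rho> = terminals (map fst \<rho>)" using snoc.IH[of "c # t"] snoc.prems by simp
  have "emit (mem \<rho>) (fst c) = terminals [fst c]"
  proof (cases "fst c")
    case (Var x)
    obtain r \<gamma> where r: "\<rho> = r @ \<gamma>" "r = [] \<or> visible (last r)" "\<gamma> \<in> mGam_words"
      by (rule split_visible)
    have "r @ \<gamma> @ (Var x, snd c) # t \<in> R" using snoc.prems r Var by (metis append.assoc append_Cons append_Nil prod.collapse)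
    from recall_empty[OF r(2) this r(3)] show ?thesis using Var r(1) by simp
  qed simp_all
  then show ?case using out_append[of \<rho> "[c]"] IH by simp
qed simp

lemma terminals_filter: "length (terminals r) = length (filter (\<lambda>c. c \<in> range Ter) r)"
  by (induction r) (auto split: sym.split)

text \<open>Pigeonhole: references contribute nothing, so each letter of \<open>w\<close> comes from
  an occurrence of a terminal, and there are fewer numbers than letters.\<close>

lemma long_word_repeats:
  assumes "w \<in> rx_lang \<alpha>" "length w > occs (rx_re \<alpha>)"
  obtains r f s t where "r @ f # s @ f # t \<in> R" "fst f \<in> range Ter"
    "w = terminals (map fst (r @ f # s @ f # t))"
proof -
  obtain \<rho> where \<rho>: "\<rho> \<in> R" "w = out \<rho>" using assms(1) unfolding rx_lang_out by blast
  then have w: "w = terminals (map fst \<rho>)" using out_terminals[of \<rho> "[]"] by simp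
  let ?P = "\<lambda>c. fst c \<in> range Ter"
  let ?f = "filter ?P \<rho>"
  have "length w = length ?f"
    unfolding w terminals_filter filter_map by (simp add: comp_def)
  have "\<not> distinct ?f"
  proof
    assume "distinct ?f"
    have "inj_on snd (set ?f)" using index_unique[OF \<rho>(1) _ \<rho>(1)] by (intro inj_onI) simp
    then have "length ?f = card (snd ` set ?f)"
      using card_image distinct_card[OF \<open>distinct ?f\<close>] by metis
    also have "\<dots> \<le> card {..<occs (rx_re \<alpha>)}"
      using mark_index[OF \<rho>(1)[unfolded marked_lang_def]] by (intro card_mono) auto
    finally show False using \<open>length w = length ?f\<close> assms(2) by simp
  qed
  from not_distinct_decomp[OF this] obtain xs ys zs f where f: "?f = xs @ f # ys @ f # zs" by auto
  then have fP: "f \<in> set ?f" by simp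
  then have "f \<in> set \<rho>" "?P f" by auto
  from split_list_first[OF this(1)] obtain r vs where r: "\<rho> = r @ f # vs" "f \<notin> set r" by blast
  have "f \<in> set vs"
  proof (rule ccontr)
    assume "f \<notin> set vs"
    then have "count_list ?f f = 1" using r \<open>?P f\<close> by (simp add: count_list_append)
    then show False unfolding f by (simp add: count_list_append)
  qed
  then obtain s t where "vs = s @ f # t" by (meson split_list)
  then show thesis using that[of r f s t] \<rho>(1) r(1) \<open>?P f\<close> w by simp
qed

lemma square_factor:
  assumes prefix: "\<And>u v. u @ v \<in> rx_lang \<alpha> \<Longrightarrow> u \<in> rx_lang \<alpha>"
    and "w \<in> rx_lang \<alpha>" "length w > occs (rx_re \<alpha>)"
  shows "\<exists>p a s. p @ a # a # s \<in> rx_lang \<alpha>"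
proof -
  obtain r f s t where f: "r @ f # s @ f # t \<in> R" "fst f \<in> range Ter"
      "w = terminals (map fst (r @ f # s @ f # t))"
    using long_word_repeats[OF assms(2,3)] .
  obtain s1 s2 where s: "s = s1 @ s2" and rep: "repeatable R (r @ f # s1) (s2 @ [f])"
    using mark_loop[OF f(1)[unfolded marked_lang_def]] unfolding marked_lang_def by blast
  \<comment> \<open>The first letter produced by the loop is wanted; \<open>f\<close> is itself a
    terminal, so there is one.\<close>
  have "\<exists>g \<in> set (s2 @ [f]). fst g \<in> range Ter" using f(2) by simp
  from split_list_first_prop[OF this] obtain c g d where
    c: "s2 @ [f] = c @ g # d" "fst g \<in> range Ter" "\<forall>x \<in> set c. fst x \<notin> range Ter" by blast
  have no_ter: "terminals (map fst x) = []" if "\<forall>y \<in> set x. fst y \<notin> range Ter" for x :: "('a sym \<times> nat) list"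
    using that by (induction x) (auto split: sym.split)
  from c(2) obtain a where a: "fst g = Ter a" by auto
  let ?q = "(r @ f # s1) @ c @ [g]"
  have "r @ f # s @ f # t = (r @ f # s1) @ (s2 @ [f]) @ t" using s by simp
  also have "\<dots> = ?q @ d @ t" unfolding c(1) by simp
  finally have split: "r @ f # s @ f # t = ?q @ d @ t" .
  then have "?q @ d @ t \<in> R" using f(1) by metis
  note q = out_terminals[OF this]
  have "w = terminals (map fst (?q @ d @ t))"
    using f(3) split by metis
  then have "w = terminals (map fst ?q) @ terminals (map fst (d @ t))"
    by (simp only: map_append terminals_append)
  \<comment> \<open>The word cut off right after this letter is in the language as well. Because
    \<open>g\<close> is a terminal, \<open>common_prefix\<close> applies with nothing left to read:
    the marked form of the shorter word is \<open>?q\<close> followed by symbols without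
    output.\<close>
  then have "terminals (map fst ?q) \<in> rx_lang \<alpha>" using prefix assms(2) by blast
  then obtain \<rho> where \<rho>: "\<rho> \<in> R" "out \<rho> = out ?q" unfolding q rx_lang_out by auto
  have "visible g" using c(2) by (simp add: visible_iff)
  then obtain s' where s': "\<rho> = ?q @ s'"
    using common_prefix[OF _ \<open>?q @ d @ t \<in> R\<close> \<rho>(1), of "[]"] \<rho>(2) c(2) by auto
  have "out \<rho> = terminals (map fst \<rho>)" using out_terminals[of \<rho> "[]"] \<rho>(1) by simp
  then have "terminals (map fst (?q @ s')) = terminals (map fst ?q)" using \<rho>(2) q s' by metis
  then have "terminals (map fst s') = []" by (simp only: map_append terminals_append append_self_conv)
  moreover have "(r @ f # s1) @ c @ g # s' \<in> R" using \<rho>(1) s' by simp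
  from repeatableD[OF rep c(1)[symmetric] this] obtain y z where
    yz: "s' = y @ z" "(r @ f # s1) @ (c @ [g]) @ y @ (c @ [g]) @ y @ z \<in> R" .
  \<comment> \<open>Both \<open>c\<close> and \<open>y\<close> are silent, so the two passes through
    \<open>g\<close> yield adjacent equal letters.\<close>
  ultimately have y: "terminals (map fst y) = []" by simp
  let ?z = "(r @ f # s1) @ (c @ [g]) @ y @ (c @ [g]) @ y @ z"
  have "?z @ [] \<in> R" using yz(2) by simp
  from out_terminals[OF this] have "out ?z = terminals (map fst ?z)" .
  also have "\<dots> = terminals (map fst (r @ f # s1)) @
      (terminals (map fst c) @ terminals (map fst [g])) @ terminals (map fst y) @
      (terminals (map fst c) @ terminals (map fst [g])) @ terminals (map fst y) @ terminals (map fst z)"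
    by (simp only: map_append terminals_append)
  also have "\<dots> = terminals (map fst (r @ f # s1)) @ a # a # terminals (map fst z)"
    unfolding y no_ter[OF c(3)] using a by simp
  finally have "terminals (map fst (r @ f # s1)) @ a # a # terminals (map fst z) \<in> rx_lang \<alpha>"
    unfolding rx_lang_out using imageI[OF yz(2), of out] by simp
  then show ?thesis by blast
qed

end

end

section \<open>Alternating words as an intersection\<close>

lemma insert_lplus: "insert [] (lplus A) = lstar A"
proof (intro equalityI subsetI)
  fix w assume "w \<in> lstar A"
  then obtain ws where "w = concat ws" "set ws \<subseteq> A" unfolding lstar_def by blast
  then show "w \<in> insert [] (lplus A)" unfolding lplus_def by (cases "ws = []") auto
qed (auto intro: lplus_lstar)

definition opt_rx :: "'a \<Rightarrow> 'a \<Rightarrow> 'a rx" where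
  "opt_rx a b = RAlt REps (RAlt (RLet a) (RLet b))"

text \<open>Every occurrence of \<open>a\<close> or \<open>b\<close> except possibly the first
  letter of the word is attached to a preceding \<open>c\<close> or \<open>d\<close>, so
  \<open>a\<close> and \<open>b\<close> never stand next to each other. This factorization also
  makes the expression deterministic.\<close>

definition isolated_rx :: "'a \<Rightarrow> 'a \<Rightarrow> 'a \<Rightarrow> 'a \<Rightarrow> 'a rx" where
  "isolated_rx a b c d = RCat (opt_rx a b) (RAlt REps (RPlus (RCat (RAlt (RLet c) (RLet d)) (opt_rx a b))))"

text \<open>Greedy decomposition: a letter of \<open>C\<close> takes along the letter of
  \<open>A\<close> behind it, if there is one; only the first letter of the word can be a letter of
  \<open>A\<close> without such a partner.\<close>

lemma isolated_words:
  assumes "A \<inter> C = {}" and B: "B = conc {[x] | x. x \<in> C} (insert [] {[x] | x. x \<in> A})"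
  shows "conc (insert [] {[x] | x. x \<in> A}) (lstar B) =
    {w \<in> lists (A \<union> C). successively (\<lambda>x y. \<not> (x \<in> A \<and> y \<in> A)) w}" (is "_ = {w \<in> _. ?s w}")
proof -
  let ?C = "{[x] | x. x \<in> C}" and ?A = "insert [] {[x] | x. x \<in> A}"
  have B1: "[x] \<in> B" if "x \<in> C" for x
    using concI[of "[x]" ?C "[]" ?A] that unfolding B by simp
  have B2: "[x, y] \<in> B" if "x \<in> C" "y \<in> A" for x y
    using concI[of "[x]" ?C "[y]" ?A] that unfolding B by simp
  have BE: "(\<exists>x \<in> C. w = [x]) \<or> (\<exists>x \<in> C. \<exists>y \<in> A. w = [x, y])" if "w \<in> B" for w
  proof -
    from that have "\<exists>u v. w = u @ v \<and> u \<in> ?C \<and> v \<in> ?A" unfolding B conc_def mem_Collect_eq .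
    then obtain u v where "w = u @ v" "u \<in> ?C" "v \<in> ?A" by (elim exE conjE)
    then show ?thesis by auto
  qed
  have "concat ws \<in> lists (A \<union> C) \<and> ?s (concat ws) \<and> (concat ws = [] \<or> hd (concat ws) \<in> C)"
    if "set ws \<subseteq> B" for ws
    using that
  proof (induction ws)
    case (Cons w ws)
    then have IH: "concat ws \<in> lists (A \<union> C)" "?s (concat ws)" "concat ws = [] \<or> hd (concat ws) \<in> C"
      by auto
    from Cons.prems have "w \<in> B" by simp
    from BE[OF this] show ?case
      using IH assms(1) by (auto simp: successively_Cons)
  qed simp
  then have star: "v \<in> lists (A \<union> C) \<and> ?s v \<and> (v = [] \<or> hd v \<in> C)" if "v \<in> lstar B" for v
    using that unfolding lstar_def by blast
  have star': "w \<in> lists (A \<union> C) \<Longrightarrow> ?s w \<Longrightarrow> w = [] \<or> hd w \<in> C \<Longrightarrow> w \<in> lstar B" for w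
  proof (induction w rule: length_induct)
    case (1 w)
    have IH: "v \<in> lstar B"
      if "length v < length w" "v \<in> lists (A \<union> C)" "?s v" "v = [] \<or> hd v \<in> C" for v
      using 1(1) that by blast
    show ?case
    proof (cases w)
      case (Cons x v)
      note x = Cons
      show ?thesis
      proof (cases "v = [] \<or> hd v \<in> C")
        case True
        have "v \<in> lists (A \<union> C)" "?s v" using 1(2,3) Cons by (auto simp: successively_Cons)
        then have "v \<in> lstar B" using IH[of v] True Cons by simp
        then show ?thesis using lstar_append[OF lstar_single[OF B1[of x]], of v] 1 Cons by simp
      next
        case False
        then obtain y u where v: "v = y # u" "y \<in> A" using 1 Cons by (cases v) auto
        have "u = [] \<or> hd u \<in> C" using 1(2,3) Cons v by (cases u) auto
        moreover have "u \<in> lists (A \<union> C)" "?s u" using 1(2,3) Cons v by (auto simp: successively_Cons)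
        ultimately have "u \<in> lstar B" using IH[of u] Cons v by simp
        then show ?thesis using lstar_append[OF lstar_single[OF B2[of x y]], of u] 1 Cons v by simp
      qed
    qed simp
  qed
  show ?thesis
  proof (intro equalityI subsetI)
    fix w assume "w \<in> conc (insert [] {[x] | x. x \<in> A}) (lstar B)"
    then obtain v where v: "v \<in> lstar B" "w = v \<or> (\<exists>x \<in> A. w = x # v)" by (auto simp: conc_def)
    then show "w \<in> {w \<in> lists (A \<union> C). ?s w}"
      using star[OF v(1)] assms(1) by (auto simp: successively_Cons)
  next
    fix w assume w: "w \<in> {w \<in> lists (A \<union> C). ?s w}"
    show "w \<in> conc (insert [] {[x] | x. x \<in> A}) (lstar B)"
    proof (cases "w = [] \<or> hd w \<in> C")
      case True
      then have "w \<in> lstar B" using star' w by blast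
      then show ?thesis using concI[of "[]" "insert [] {[x] | x. x \<in> A}" w] by simp
    next
      case False
      then obtain x v where x: "w = x # v" "x \<in> A" using w by (cases w) auto
      then have "v = [] \<or> hd v \<in> C" using w by (cases v) auto
      then have "v \<in> lstar B" using star' w x by (auto simp: successively_Cons)
      then show ?thesis using concI[of "[x]" "insert [] {[x] | x. x \<in> A}" v] x by simp
    qed
  qed
qed

lemma rx_lang_isolated_rx:
  assumes "isolated_rx a b c d \<in> RX \<Sigma>" "{a, b} \<inter> {c, d} = {}"
  shows "rx_lang (isolated_rx a b c d) = {w \<in> lists ({a, b} \<union> {c, d}).
    successively (\<lambda>x y. \<not> (x \<in> {a, b} \<and> y \<in> {a, b})) w}"
proof -
  let ?O = "insert [] {[x] | x. x \<in> {a, b}}" and ?C = "{[x] | x. x \<in> {c, d}}"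
  have sets: "{[x] | x. x \<in> {u, v}} = {[u], [v]}" for u v :: 'a by auto
  have O: "ref_lang (opt_rx a b) = map Ter ` ?O" unfolding sets by (auto simp: opt_rx_def)
  have C: "ref_lang (RAlt (RLet c) (RLet d)) = map Ter ` ?C" unfolding sets by auto
  have map_star: "lstar (map Ter ` X) = map Ter ` lstar X" for X :: "'a list set"
    unfolding insert_lplus[symmetric] map_lplus[symmetric] by simp
  have "ref_lang (isolated_rx a b c d) = map Ter ` conc ?O (lstar (conc ?C ?O))"
    unfolding isolated_rx_def map_conc map_star[symmetric] O[symmetric] C[symmetric]
    by (simp add: insert_lplus)
  from rx_lang_map_Ter[OF assms(1) this] show ?thesis
    using isolated_words[OF assms(2) HOL.refl] by simp
qed

lemma isolated_DREG:
  "isolated_rx 0 1 2 3 \<in> DREG {0, 1, 2, (3::nat)}"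
  "isolated_rx 2 3 0 1 \<in> DREG {0, 1, 2, (3::nat)}"
proof -
  have "isolated_rx 0 1 2 3 \<in> DRX {0, 1, 2, (3::nat)}"
    by (rule DRX_I[of _ _ "mark 0 (rx_re (isolated_rx 0 1 2 3))" "\<lambda>_. {}" "next_symbols (\<lambda>_. {})"])
      (auto simp: isolated_rx_def opt_rx_def RX_def unambiguous_def intro!: RX_nonempty.intros)
  then show "isolated_rx 0 1 2 3 \<in> DREG {0, 1, 2, (3::nat)}"
    by (simp add: DREG_def isolated_rx_def opt_rx_def)
  have "isolated_rx 2 3 0 1 \<in> DRX {0, 1, 2, (3::nat)}"
    by (rule DRX_I[of _ _ "mark 0 (rx_re (isolated_rx 2 3 0 1))" "\<lambda>_. {}" "next_symbols (\<lambda>_. {})"])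
      (auto simp: isolated_rx_def opt_rx_def RX_def unambiguous_def intro!: RX_nonempty.intros)
  then show "isolated_rx 2 3 0 1 \<in> DREG {0, 1, 2, (3::nat)}"
    by (simp add: DREG_def isolated_rx_def opt_rx_def)
qed

definition alternating :: "nat list set" where
  "alternating = {w \<in> lists {0, 1, 2, 3}. successively (\<lambda>x y. (x < 2) \<noteq> (y < 2)) w}"

lemma alternating_Int:
  "rx_lang (isolated_rx 0 1 2 3) \<inter> rx_lang (isolated_rx 2 3 0 1) = alternating"
proof -
  have RX: "isolated_rx 0 1 2 3 \<in> RX {0, 1, 2, (3::nat)}" "isolated_rx 2 3 0 1 \<in> RX {0, 1, 2, (3::nat)}"
    using isolated_DREG by (simp_all add: DREG_def DRX_def)
  have less2: "(x \<in> {0, 1} \<longleftrightarrow> x < 2) \<and> (x \<in> {2, 3} \<longleftrightarrow> \<not> x < 2)" if "x \<in> {0, 1, 2, 3}" for x :: nat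
    using that by auto
  have iff: "successively (\<lambda>x y. (x < 2) \<noteq> (y < 2)) w \<longleftrightarrow>
      successively (\<lambda>x y. \<not> (x \<in> {0, 1} \<and> y \<in> {0, 1})) w \<and>
      successively (\<lambda>x y. \<not> (x \<in> {2, 3} \<and> y \<in> {2, 3})) w"
    if "w \<in> lists {0, 1, 2, 3}" for w :: "nat list"
    using that
  proof (induction w rule: induct_list012)
    case (3 x y w)
    then have "x \<in> {0, 1, 2, 3}" "y \<in> {0, 1, 2, 3}" by simp_all
    then have "((x < 2) \<noteq> (y < 2)) \<longleftrightarrow> \<not> (x \<in> {0, 1} \<and> y \<in> {0, 1}) \<and> \<not> (x \<in> {2, 3} \<and> y \<in> {2, 3})"
      using less2[of x] less2[of y] by argo
    then show ?case using 3 unfolding successively.simps by (simp only: Cons_in_lists_iff) argo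
  qed simp_all
  have letters: "{0, 1} \<union> {2, 3} = {0, 1, 2, (3::nat)}" "{2, 3} \<union> {0, 1} = {0, 1, 2, (3::nat)}"
    by auto
  have "rx_lang (isolated_rx 0 1 2 3) = {w \<in> lists {0, 1, 2, 3::nat}.
      successively (\<lambda>x y. \<not> (x \<in> {0, 1} \<and> y \<in> {0, 1})) w}"
    "rx_lang (isolated_rx 2 3 0 1) = {w \<in> lists {0, 1, 2, 3::nat}.
      successively (\<lambda>x y. \<not> (x \<in> {2, 3} \<and> y \<in> {2, 3})) w}"
    using rx_lang_isolated_rx[OF RX(1)] rx_lang_isolated_rx[OF RX(2)] unfolding letters by simp_all
  then show ?thesis unfolding alternating_def using iff by blast
qed

lemma alternating_prefix: "u @ v \<in> alternating \<Longrightarrow> u \<in> alternating"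
  by (auto simp: alternating_def successively_append_iff)

lemma alternating_not_L_DRX: "alternating \<notin> L_DRX"
proof
  assume "alternating \<in> L_DRX"
  then obtain \<alpha> \<Sigma> where *: "alternating = rx_lang \<alpha>" "finite \<Sigma>" "\<alpha> \<in> DRX \<Sigma>" by (auto simp: L_DRX_def)
  interpret deterministic_regex \<alpha> \<Sigma> using * by unfold_locales
  have branching: "\<exists>d w'. d \<noteq> c \<and> p @ d # w' \<in> rx_lang \<alpha>" if pc: "p @ c # w \<in> rx_lang \<alpha>" for p c w
  proof -
    have pc': "p @ [c] \<in> alternating" using alternating_prefix[of "p @ [c]" w] pc * by simp
    then have c: "c \<in> {0, 1, 2, 3}" by (simp add: alternating_def)
    \<comment> \<open>The other letter of the same pair, so that alternation is preserved.\<close>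
    define d :: nat where "d = (if c = 0 then 1 else if c = 1 then 0 else if c = 2 then 3 else 2)"
    have "d \<noteq> c" "d < 2 \<longleftrightarrow> c < 2" "d \<in> {0, 1, 2, 3}" using c by (auto simp: d_def)
    then have "p @ [d] \<in> alternating" using pc' by (auto simp: alternating_def successively_append_iff)
    then show ?thesis using \<open>d \<noteq> c\<close> * by blast
  qed
  \<comment> \<open>The word 0202..., with one letter more than the expression has
    occurrences.\<close>
  let ?w = "map (\<lambda>i. if even i then 0 else 2) [0..<Suc (occs (rx_re \<alpha>))] :: nat list"
  have "?w \<in> alternating"
    by (auto simp: alternating_def successively_conv_nth simp del: upt_Suc)
  have prefix: "u \<in> rx_lang \<alpha>" if "u @ v \<in> rx_lang \<alpha>" for u v
    using alternating_prefix that *(1) by metis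
  have "\<exists>p a s. p @ a # a # s \<in> rx_lang \<alpha>"
  proof (rule square_factor[where w = ?w])
    show "?w \<in> rx_lang \<alpha>" using \<open>?w \<in> alternating\<close> *(1) by metis
    show "length ?w > occs (rx_re \<alpha>)" by simp
  qed (fact branching prefix)+
  then obtain p a s where "p @ a # a # s \<in> alternating" using *(1) by metis
  then show False by (auto simp: alternating_def successively_append_iff)
qed

lemma not_closed_intersection: "\<not> closed_intersection_with L_DRX L_DREG"
proof -
  have "rx_lang (isolated_rx 0 1 2 3) \<in> L_DREG" "rx_lang (isolated_rx 2 3 0 1) \<in> L_DREG"
    unfolding L_DREG_def using isolated_DREG by (metis (mono_tags, lifting) CollectI finite.emptyI finite.insertI)+
  moreover have "L_DREG \<subseteq> L_DRX" by (auto simp: L_DREG_def L_DRX_def DREG_def)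
  ultimately show ?thesis
    using alternating_not_L_DRX alternating_Int unfolding closed_intersection_with_def by (metis subsetD)
qed

theorem theorem8:
  shows "(\<forall>\<C> \<in> {L_DRX, L_DTMFA_rej}.
            \<not> closed_union \<C> \<and> \<not> closed_concatenation \<C> \<and> \<not> closed_reversal \<C>
          \<and> \<not> closed_complement \<C> \<and> \<not> closed_homomorphism \<C>
          \<and> \<not> closed_inverse_homomorphism \<C>)
        \<and> \<not> closed_intersection L_DRX
        \<and> \<not> closed_intersection_with L_DRX L_DREG"
proof -
  have "L_DREG \<subseteq> L_DRX" by (auto simp: L_DREG_def L_DRX_def DREG_def)
  \<comment> \<open>Both witnesses are free of variables, so the stronger statement about
    \<open>L_DREG\<close> gives this one by inclusion.\<close>
  then have "\<not> closed_intersection L_DRX"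
    using not_closed_intersection unfolding closed_intersection_def closed_intersection_with_def by blast
  then show ?thesis
    using not_closed[of L_DRX] not_closed[of L_DTMFA_rej] L_DRX_subset not_closed_intersection by simp
qed

end
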